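(* The space $Z(T^2)$ is a weak Hilbert space.
   Context: Tsirelson's space $T$: for $x\in c_{00}$ let $\|x\|_0=\max_j|x_j|$ and $\|x\|_{m+1}=\max\{\|x\|_m,\tfrac12\max\sum_{j=1}^k\|A_jx\|_m\}$, the inner max over all $k$ and finite sets $k\le A_1<\dots<A_k$ of naturals ($A<B$ means $\max A<\min B$, $A_jx$ the restriction of $x$ to $A_j$); $T$ is the completion of $c_{00}$ under $\|x\|=\lim_m\|x\|_m$. $T^2$ is the completion of $c_{00}$ under $\|\sum x_je_j\|_{T^2}=\|\sum|x_j|^2e_j\|_T^{1/2}$ (complex scalars); the unit vectors $(e_j)$ form an unconditional basis of $T^2$, and $(T^2)^*$ is viewed as a sequence space via the biorthogonal basis. For Banach sequence spaces $X_0,X_1$ with the unit vectors as joint unconditional basis, continuously included in the space $\omega$ of all sequences (pointwise topology), $\mathcal F(X_0,X_1)$ denotes the bounded continuous functions $F$ from the strip $\{0\le\mathrm{Re}\,z\le1\}$ to $\omega$, analytic inside, with $t\mapsto F(j+it)\in X_j$ bounded, continuous, vanishing at infinity, normed by $\|F\|=\max_j\sup_t\|F(j+it)\|_{X_j}$. The derived space $d(X_0,X_1)_\theta$ is the space of pairs $(x,y)\in\omega\times\omega$ with $\|(x,y)\|=\inf\{\|F\|:F\in\mathcal F(X_0,X_1),F(\theta)=y,F'(\theta)=x\}<\infty$. $Z(T^2):=d(T^2,(T^2)^* )_{1/2}$; it is a twisted sum of $\ell_2$ with $\ell_2$ since $(T^2,(T^2)^* )_{1/2}=\ell_2$ with equivalent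 norms. A Banach space $X$ is a weak Hilbert space if there are $0<\delta_0<1$ and $C$ such that every finite-dimensional subspace $E\subseteq X$ contains a subspace $F$ with $\dim F\ge\delta_0\dim E$, $d(F,\ell_2^{\dim F})\le C$ (Banach–Mazur distance), and a projection $P:X\to F$ with $\|P\|\le C$. *)

theory Defs
  imports "HOL-Complex_Analysis.Complex_Analysis"
begin

type_synonym seq = "nat \<Rightarrow> complex"
type_synonym pseq = "seq \<times> seq"

text \<open>Coordinate j (0-based) of a sequence corresponds to the unit vector e_(j+1) of the paper,
  whose natural numbers start at 1.\<close>

definition restr :: "nat set \<Rightarrow> (nat \<Rightarrow> real) \<Rightarrow> nat \<Rightarrow> real" where
  "restr A x = (\<lambda>j. if j \<in> A then x j else 0)"

text \<open>Admissible families A_0 < ... < A_(k-1) with k \<le> min A_0 (in 1-based numbering).\<close>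
definition admissible :: "nat \<Rightarrow> (nat \<Rightarrow> nat set) \<Rightarrow> bool" where
  "admissible k A \<longleftrightarrow>
     (\<forall>i<k. finite (A i) \<and> A i \<noteq> {}) \<and>
     (\<forall>i. Suc i < k \<longrightarrow> Max (A i) < Min (A (Suc i))) \<and>
     (0 < k \<longrightarrow> k \<le> Min (A 0) + 1)"

fun tnorm_m :: "nat \<Rightarrow> (nat \<Rightarrow> real) \<Rightarrow> real" where
  "tnorm_m 0 x = Sup (range (\<lambda>j. \<bar>x j\<bar>))"
| "tnorm_m (Suc m) x = max (tnorm_m m x)
     (1/2 * Sup {(\<Sum>i<k. tnorm_m m (restr (A i) x)) | k A. admissible k A})"

text \<open>Tsirelson norm on finitely supported real sequences.\<close>
definition tnorm :: "(nat \<Rightarrow> real) \<Rightarrow> real" where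
  "tnorm x = lim (\<lambda>m. tnorm_m m x)"

definition t2norm :: "seq \<Rightarrow> real" where
  "t2norm x = sqrt (tnorm (\<lambda>j. (cmod (x j))\<^sup>2))"

definition trunc :: "nat \<Rightarrow> seq \<Rightarrow> seq" where
  "trunc n x = (\<lambda>j. if j < n then x j else 0)"

definition fin_supp :: "seq \<Rightarrow> bool" where
  "fin_supp x \<longleftrightarrow> finite {j. x j \<noteq> 0}"

text \<open>T^2 realised as a sequence space: the completion of c00, identified with the sequences
  whose truncations form a Cauchy sequence (the unit vectors form a basis).\<close>
definition T2 :: "seq set" where
  "T2 = {x. \<forall>e>0. \<exists>N. \<forall>m\<ge>N. \<forall>n\<ge>N. t2norm (\<lambda>j. trunc m x j - trunc n x j) < e}"

definition T2N :: "seq \<Rightarrow> real" where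
  "T2N x = lim (\<lambda>n. t2norm (trunc n x))"

text \<open>The dual (T^2)^* as a sequence space via y_j = f(e_j); norm = norm of the functional.\<close>
definition dual_vals :: "seq \<Rightarrow> real set" where
  "dual_vals y = {cmod (\<Sum>j<n. x j * y j) | x n. (\<forall>j\<ge>n. x j = 0) \<and> t2norm x \<le> 1}"

definition T2D :: "seq set" where
  "T2D = {y. bdd_above (dual_vals y)}"

definition T2DN :: "seq \<Rightarrow> real" where
  "T2DN y = Sup (dual_vals y)"

definition strip :: "complex set" where
  "strip = {z. 0 \<le> Re z \<and> Re z \<le> 1}"

definition boundary_ok :: "seq set \<Rightarrow> (seq \<Rightarrow> real) \<Rightarrow> (real \<Rightarrow> seq) \<Rightarrow> bool" where
  "boundary_ok X N g \<longleftrightarrow>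
     (\<forall>t. g t \<in> X) \<and>
     (\<exists>M. \<forall>t. N (g t) \<le> M) \<and>
     (\<forall>t. \<forall>e>0. \<exists>d>0. \<forall>s. \<bar>s - t\<bar> < d \<longrightarrow> N (\<lambda>j. g s j - g t j) < e) \<and>
     ((\<lambda>t. N (g t)) \<longlongrightarrow> 0) at_infinity"

definition Fclass :: "seq set \<Rightarrow> (seq \<Rightarrow> real) \<Rightarrow> seq set \<Rightarrow> (seq \<Rightarrow> real) \<Rightarrow> (complex \<Rightarrow> seq) set" where
  "Fclass X0 N0 X1 N1 = {F.
     (\<forall>j. continuous_on strip (\<lambda>z. F z j)) \<and>
     (\<forall>j. bounded ((\<lambda>z. F z j) ` strip)) \<and>
     (\<forall>j. (\<lambda>z. F z j) holomorphic_on {z. 0 < Re z \<and> Re z < 1}) \<and>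
     boundary_ok X0 N0 (\<lambda>t. F (\<i> * of_real t)) \<and>
     boundary_ok X1 N1 (\<lambda>t. F (1 + \<i> * of_real t))}"

definition Fnorm :: "(seq \<Rightarrow> real) \<Rightarrow> (seq \<Rightarrow> real) \<Rightarrow> (complex \<Rightarrow> seq) \<Rightarrow> real" where
  "Fnorm N0 N1 F = max (SUP t. N0 (F (\<i> * of_real t))) (SUP t. N1 (F (1 + \<i> * of_real t)))"

definition represents :: "complex \<Rightarrow> (complex \<Rightarrow> seq) \<Rightarrow> pseq \<Rightarrow> bool" where
  "represents \<theta> F p \<longleftrightarrow> F \<theta> = snd p \<and> (\<forall>j. deriv (\<lambda>z. F z j) \<theta> = fst p j)"

definition derived :: "seq set \<Rightarrow> (seq \<Rightarrow> real) \<Rightarrow> seq set \<Rightarrow> (seq \<Rightarrow> real) \<Rightarrow> real \<Rightarrow> pseq set" where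
  "derived X0 N0 X1 N1 \<theta> = {p. \<exists>F\<in>Fclass X0 N0 X1 N1. represents (of_real \<theta>) F p}"

definition derived_norm :: "seq set \<Rightarrow> (seq \<Rightarrow> real) \<Rightarrow> seq set \<Rightarrow> (seq \<Rightarrow> real) \<Rightarrow> real \<Rightarrow> pseq \<Rightarrow> real" where
  "derived_norm X0 N0 X1 N1 \<theta> p =
     Inf {Fnorm N0 N1 F | F. F \<in> Fclass X0 N0 X1 N1 \<and> represents (of_real \<theta>) F p}"

definition ZT2 :: "pseq set" where
  "ZT2 = derived T2 T2N T2D T2DN (1/2)"

definition ZT2N :: "pseq \<Rightarrow> real" where
  "ZT2N = derived_norm T2 T2N T2D T2DN (1/2)"

definition padd :: "pseq \<Rightarrow> pseq \<Rightarrow> pseq" where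
  "padd p q = (\<lambda>j. fst p j + fst q j, \<lambda>j. snd p j + snd q j)"

definition pscale :: "complex \<Rightarrow> pseq \<Rightarrow> pseq" where
  "pscale c p = (\<lambda>j. c * fst p j, \<lambda>j. c * snd p j)"

definition pzero :: pseq where
  "pzero = (\<lambda>j. 0, \<lambda>j. 0)"

definition pdiff :: "pseq \<Rightarrow> pseq \<Rightarrow> pseq" where
  "pdiff p q = (\<lambda>j. fst p j - fst q j, \<lambda>j. snd p j - snd q j)"

definition lincomb :: "(pseq \<Rightarrow> complex) \<Rightarrow> pseq set \<Rightarrow> pseq" where
  "lincomb c S = (\<lambda>j. \<Sum>b\<in>S. c b * fst b j, \<lambda>j. \<Sum>b\<in>S. c b * snd b j)"

definition csubspace :: "pseq set \<Rightarrow> bool" where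
  "csubspace E \<longleftrightarrow> pzero \<in> E \<and> (\<forall>x\<in>E. \<forall>y\<in>E. padd x y \<in> E) \<and> (\<forall>c. \<forall>x\<in>E. pscale c x \<in> E)"

definition cspan :: "pseq set \<Rightarrow> pseq set" where
  "cspan B = {lincomb c S | c S. finite S \<and> S \<subseteq> B}"

definition cindep :: "pseq set \<Rightarrow> bool" where
  "cindep B \<longleftrightarrow> (\<forall>S c. finite S \<and> S \<subseteq> B \<and> lincomb c S = pzero \<longrightarrow> (\<forall>b\<in>S. c b = 0))"

definition cbasis :: "pseq set \<Rightarrow> pseq set \<Rightarrow> bool" where
  "cbasis B E \<longleftrightarrow> B \<subseteq> E \<and> cindep B \<and> cspan B = E"

definition has_cdim :: "pseq set \<Rightarrow> nat \<Rightarrow> bool" where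
  "has_cdim E n \<longleftrightarrow> csubspace E \<and> (\<exists>B. finite B \<and> card B = n \<and> cbasis B E)"

definition clinear_on :: "pseq set \<Rightarrow> (pseq \<Rightarrow> 'b) \<Rightarrow> ('b \<Rightarrow> 'b \<Rightarrow> 'b) \<Rightarrow> (complex \<Rightarrow> 'b \<Rightarrow> 'b) \<Rightarrow> bool" where
  "clinear_on E S add sc \<longleftrightarrow>
     (\<forall>x\<in>E. \<forall>y\<in>E. S (padd x y) = add (S x) (S y)) \<and> (\<forall>c. \<forall>x\<in>E. S (pscale c x) = sc c (S x))"

definition l2fin :: "nat \<Rightarrow> seq set" where
  "l2fin n = {v. \<forall>j\<ge>n. v j = 0}"

definition l2norm :: "nat \<Rightarrow> seq \<Rightarrow> real" where
  "l2norm n v = sqrt (\<Sum>j<n. (cmod (v j))\<^sup>2)"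

definition bm_dist_l2 :: "(pseq \<Rightarrow> real) \<Rightarrow> pseq set \<Rightarrow> nat \<Rightarrow> real" where
  "bm_dist_l2 N F n = Inf {a * b | a b S.
      clinear_on F S (\<lambda>u v j. u j + v j) (\<lambda>c u j. c * u j) \<and> bij_betw S F (l2fin n) \<and>
      0 < a \<and> 0 < b \<and> (\<forall>x\<in>F. l2norm n (S x) \<le> a * N x) \<and> (\<forall>x\<in>F. N x \<le> b * l2norm n (S x))}"

definition banach_on :: "pseq set \<Rightarrow> (pseq \<Rightarrow> real) \<Rightarrow> bool" where
  "banach_on X N \<longleftrightarrow> csubspace X \<and>
     (\<forall>x\<in>X. 0 \<le> N x) \<and> (\<forall>x\<in>X. N x = 0 \<longleftrightarrow> x = pzero) \<and>
     (\<forall>x\<in>X. \<forall>y\<in>X. N (padd x y) \<le> N x + N y) \<and>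
     (\<forall>c. \<forall>x\<in>X. N (pscale c x) = cmod c * N x) \<and>
     (\<forall>u. (\<forall>k. u k \<in> X) \<and> (\<forall>e>0. \<exists>K. \<forall>m\<ge>K. \<forall>k\<ge>K. N (pdiff (u m) (u k)) < e) \<longrightarrow>
        (\<exists>x\<in>X. (\<lambda>k. N (pdiff (u k) x)) \<longlonglongrightarrow> 0))"

definition weak_hilbert :: "pseq set \<Rightarrow> (pseq \<Rightarrow> real) \<Rightarrow> bool" where
  "weak_hilbert X N \<longleftrightarrow> banach_on X N \<and>
     (\<exists>\<delta>0 C. 0 < \<delta>0 \<and> \<delta>0 < 1 \<and>
       (\<forall>E n. E \<subseteq> X \<and> has_cdim E n \<longrightarrow>
          (\<exists>F m. F \<subseteq> E \<and> has_cdim F m \<and> real m \<ge> \<delta>0 * real n \<and>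
             bm_dist_l2 N F m \<le> C \<and>
             (\<exists>P. clinear_on X P padd pscale \<and> (\<forall>x\<in>X. P x \<in> F) \<and> (\<forall>x\<in>F. P x = x) \<and>
                  (\<forall>x\<in>X. N (P x) \<le> C * N x)))))"

end

theory Submission
  imports Defs "HOL-Library.Function_Algebras"
begin

text \<open>The unit ball of the dual of \<open>T\<close> supplies weights \<open>h\<close>, and the norm of \<open>T\<^sup>2\<close> is the supremum of the
  Hilbert norms of \<open>\<ell>\<^sub>2(h)\<close>. If \<open>v / sqrt h\<close> is bounded by \<open>v\<close> in \<open>T\<^sup>2\<close> for all \<open>v\<close> in a subspace \<open>V\<close> of
  \<open>\<ell>\<^sub>2\<close>, then \<open>z \<mapsto> v h\<^sup>z\<^sup>-\<^sup>1\<^sup>/\<^sup>2\<close> is a linear choice of analytic families on \<open>V\<close>, so that over \<open>V\<close> the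
  twisted sum is split by \<open>(x, y) \<mapsto> (x - y ln h, y)\<close>, with absolute constants.

  Such a weight is found for a large part of any \<open>n\<close>-dimensional space supported beyond \<open>n / 8\<close>. Let \<open>h\<close>
  maximize \<open>\<Prod>j. h j powr \<rho> j\<close>, where \<open>\<rho>\<close> is the diagonal of the orthogonal projection onto the space;
  this bounds the trace of multiplication by \<open>g / h\<close>, compressed to the space, for every weight \<open>g\<close>.
  Beyond coordinate \<open>N\<close> the maximum of \<open>N + 1\<close> norming functionals of \<open>T\<close> is dominated by a multiple of one
  weight, whence an orthonormal system of vectors that are bad for \<open>h\<close> has few elements, and the
  orthogonal complement of a maximal one is good.

  The second components of a subspace of \<open>Z(T\<^sup>2)\<close> give a first weight \<open>h0\<close>; a second weight \<open>h1\<close>, good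
  also for the sheared first components \<open>x - y ln h0\<close>, serves to extend the resulting inner product
  boundedly to all of \<open>Z(T\<^sup>2)\<close>.\<close>

section \<open>Norming functionals of Tsirelson's space\<close>

text \<open>A loss at every level of a tree would ruin the domination of many functionals by one, so
  the merging must reproduce a single constant. Two facts make this possible. The root of a tree
  starting at position a has at most a branches, and on [a, a 2^a) the norm of T is that of l_1 up
  to the factor 4; so a few blocks after each start absorb the growth in the number of branches, and
  the factor 1/2 of the new node cancels against that of the merged trees.

  The second weight has to come after the first: the sheared first components are known to be
  square-summable only once the second components are good for \<open>h0\<close>. For p outside the
  chosen subspace neither component need be good. What is controlled is the pairing of
  \<open>shear h1 p\<close> with a vector good for \<open>h1\<close>. On the subspace this differs
  from the inner product of the vectors \<open>shear h0 p\<close> by a term that contains the second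
  component multiplied by ln h0 - ln h1. The multiplication is bounded there because the second
  components are good for both weights, and the term extends to all p through the orthogonal
  projection of second components.\<close>

primrec tfun :: "nat \<Rightarrow> (nat \<Rightarrow> real) set" where
  "tfun 0 = {}"
| "tfun (Suc d) = insert (\<lambda>_. 0) (range (\<lambda>j i. if i = j then 1 else 0) \<union>
     {(\<lambda>j. (\<Sum>i<k. f i j) / 2) | k A f. admissible k A \<and>
        (\<forall>i<k. f i \<in> tfun d \<and> (\<forall>j. j \<notin> A i \<longrightarrow> f i j = 0))})"

text \<open>The nonnegative part of the usual norming set of Tsirelson's space; nonnegative
  coefficients suffice because the norm depends only on the moduli of the coordinates.\<close>

definition tfuns :: "(nat \<Rightarrow> real) set" where
  "tfuns = (\<Union>d. tfun d)"

lemma tfun_cases: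
  assumes "h \<in> tfun (Suc d)"
  obtains "h = (\<lambda>_. 0)" | j where "h = (\<lambda>i. if i = j then 1 else 0)"
  | k A f where "h = (\<lambda>j. (\<Sum>i<k. f i j) / 2)" "admissible k A"
      "\<And>i. i < k \<Longrightarrow> f i \<in> tfun d" "\<And>i j. i < k \<Longrightarrow> j \<notin> A i \<Longrightarrow> f i j = 0"
  using assms by auto

lemma tfun_zero: "(\<lambda>_. 0) \<in> tfun (Suc d)" by simp

lemma tfun_unit: "(\<lambda>i. if i = j then 1 else 0) \<in> tfun (Suc d)" by auto

lemma tfun_node:
  assumes "admissible k A" "\<And>i. i < k \<Longrightarrow> f i \<in> tfun d" "\<And>i j. i < k \<Longrightarrow> j \<notin> A i \<Longrightarrow> f i j = 0"
  shows "(\<lambda>j. (\<Sum>i<k. f i j) / 2) \<in> tfun (Suc d)"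
  using assms by auto blast

lemma tfun_Suc: "tfun d \<subseteq> tfun (Suc d)"
proof (induction d)
  case (Suc d)
  show ?case
  proof
    fix h assume "h \<in> tfun (Suc d)"
    then show "h \<in> tfun (Suc (Suc d))"
    proof (cases rule: tfun_cases)
      case 1 then show ?thesis by (simp only: tfun_zero)
    next
      case 2 then show ?thesis by (simp only: tfun_unit)
    next
      case (3 k A f) then show ?thesis using Suc tfun_node[of k A f "Suc d"] by (metis subsetD)
    qed
  qed
qed simp

lemma tfun_mono: "d \<le> d' \<Longrightarrow> tfun d \<subseteq> tfun d'"
  by (rule lift_Suc_mono_le[of tfun]) (use tfun_Suc in auto)

lemma finite_subset_tfun:
  assumes "finite H" "H \<subseteq> tfuns"
  shows "\<exists>d. H \<subseteq> tfun d"
  using assms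
proof (induction H rule: finite_induct)
  case (insert h H)
  then obtain d d' where "H \<subseteq> tfun d" "h \<in> tfun d'" by (auto simp: tfuns_def)
  then have "insert h H \<subseteq> tfun (max d d')" using tfun_mono[of d "max d d'"] tfun_mono[of d' "max d d'"] by auto
  then show ?case by blast
qed auto

lemma tfuns_zero: "(\<lambda>_. 0) \<in> tfuns" and tfuns_unit: "(\<lambda>i. if i = j then 1 else 0) \<in> tfuns"
  unfolding tfuns_def using tfun_zero tfun_unit by (metis UNIV_I UN_iff)+

lemma tfuns_node:
  assumes "admissible k A" "\<And>i. i < k \<Longrightarrow> f i \<in> tfuns" "\<And>i j. i < k \<Longrightarrow> j \<notin> A i \<Longrightarrow> f i j = 0"
  shows "(\<lambda>j. (\<Sum>i<k. f i j) / 2) \<in> tfuns"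
proof -
  obtain d where "f ` {..<k} \<subseteq> tfun d" using finite_subset_tfun[of "f ` {..<k}"] assms(2) by auto
  then show ?thesis using tfun_node[of k A f d] assms unfolding tfuns_def by blast
qed

lemma admissible_ordered:
  assumes "admissible k A" "i < i'" "i' < k" "x \<in> A i" "y \<in> A i'"
  shows "x < y"
  using assms(2,3,5)
proof (induction i' arbitrary: y)
  case (Suc m)
  have fin: "finite (A m)" "A m \<noteq> {}" "finite (A (Suc m))" "Max (A m) < Min (A (Suc m))"
    using assms(1) Suc.prems unfolding admissible_def by auto
  have "x \<le> Max (A m)"
  proof (cases "i = m")
    case True then show ?thesis using assms(4) fin by simp
  next
    case False
    then have "x < Max (A m)" using Suc.IH[of "Max (A m)"] Suc.prems fin Max_in by simp
    then show ?thesis by simp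
  qed
  also have "\<dots> < Min (A (Suc m))" by fact
  also have "\<dots> \<le> y" using Suc.prems fin by simp
  finally show ?case .
qed simp

lemma admissible_disjoint:
  assumes "admissible k A" "i < k" "i' < k" "x \<in> A i" "x \<in> A i'"
  shows "i = i'"
  using admissible_ordered[OF assms(1)] assms(2-) by (metis less_irrefl linorder_neqE_nat)

text \<open>Children of a node have disjoint supports, so at a fixed coordinate a sum over the
  children has at most one nonzero term.\<close>

lemma sum_single_le:
  fixes f :: "'a \<Rightarrow> real"
  assumes "finite I" "\<And>i i'. i \<in> I \<Longrightarrow> i' \<in> I \<Longrightarrow> f i \<noteq> 0 \<Longrightarrow> f i' \<noteq> 0 \<Longrightarrow> i = i'" "\<And>i. i \<in> I \<Longrightarrow> f i \<le> c" "0 \<le> c"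
  shows "sum f I \<le> c"
proof (cases "\<exists>i\<in>I. f i \<noteq> 0")
  case True
  then obtain i where i: "i \<in> I" "f i \<noteq> 0" by blast
  then have "sum f I = sum f {i}" using assms by (intro sum.mono_neutral_right) auto
  then show ?thesis using assms i by simp
qed (use assms in simp)

lemma tfun_props: "h \<in> tfun d \<Longrightarrow> finite {j. h j \<noteq> 0} \<and> (\<forall>j. 0 \<le> h j \<and> h j \<le> 1)"
proof (induction d arbitrary: h)
  case (Suc d)
  from Suc.prems show ?case
  proof (cases rule: tfun_cases)
    case (2 j)
    then have "{i. h i \<noteq> 0} \<subseteq> {j}" by (simp add: subset_iff)
    then show ?thesis using 2 by (auto intro: finite_subset)
  next
    case (3 k A f)
    have "{j. h j \<noteq> 0} \<subseteq> (\<Union>i<k. {j. f i j \<noteq> 0})"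
      unfolding 3(1) by (auto intro: ccontr)
    moreover have "finite (\<Union>i<k. {j. f i j \<noteq> 0})" using Suc.IH 3 by auto
    ultimately have "finite {j. h j \<noteq> 0}" by (rule finite_subset)
    moreover have "0 \<le> h j \<and> h j \<le> 1" for j
    proof -
      have "(\<Sum>i<k. f i j) \<le> 1"
      proof (rule sum_single_le)
        fix i i' assume *: "i \<in> {..<k}" "i' \<in> {..<k}" "f i j \<noteq> 0" "f i' j \<noteq> 0"
        then have "j \<in> A i" "j \<in> A i'" using 3(4) by auto
        then show "i = i'" using admissible_disjoint[OF 3(2)] * by blast
      qed (use Suc.IH 3 in auto)
      moreover have "0 \<le> (\<Sum>i<k. f i j)" using Suc.IH 3 by (intro sum_nonneg) auto
      ultimately show ?thesis by (simp add: 3(1))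
    qed
    ultimately show ?thesis by blast
  qed auto
qed simp

lemma tfuns_finite: "h \<in> tfuns \<Longrightarrow> finite {j. h j \<noteq> 0}"
  and tfuns_nonneg: "h \<in> tfuns \<Longrightarrow> 0 \<le> h j"
  and tfuns_le1: "h \<in> tfuns \<Longrightarrow> h j \<le> 1"
  unfolding tfuns_def using tfun_props by blast+

text \<open>Trees will be cut at block boundaries and at the sets of admissible families. A unit
  vector may be cut to zero, which is why zero belongs to every positive level.\<close>

lemma tfun_restrict: "h \<in> tfun d \<Longrightarrow> (\<lambda>j. if j \<in> B then h j else 0) \<in> tfun d"
proof (induction d arbitrary: h)
  case (Suc d)
  from Suc.prems show ?case
  proof (cases rule: tfun_cases)
    case 1 then show ?thesis by (simp only: if_cancel tfun_zero)
  next
    case (2 j)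
    have "(\<lambda>i. if i \<in> B then h i else 0) = (if j \<in> B then (\<lambda>i. if i = j then 1 else 0) else (\<lambda>_. 0))"
      by (auto simp: 2)
    then show ?thesis by (metis tfun_unit tfun_zero)
  next
    case (3 k A f)
    have "(\<lambda>j. if j \<in> B then h j else 0) = (\<lambda>j. (\<Sum>i<k. if j \<in> B then f i j else 0) / 2)"
      by (auto simp: 3)
    also have "\<dots> \<in> tfun (Suc d)" by (rule tfun_node[OF 3(2)]) (use Suc.IH 3 in auto)
    finally show ?thesis .
  qed
qed simp

lemma tfuns_restrict: "h \<in> tfuns \<Longrightarrow> (\<lambda>j. if j \<in> B then h j else 0) \<in> tfuns"
  unfolding tfuns_def using tfun_restrict by blast

section \<open>Comparison of the iterated norms with the norming functionals\<close>

lemma admissible_sum_le: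
  assumes "admissible k A"
  shows "(\<Sum>i<k. \<Sum>j<L. \<bar>restr (A i) x j\<bar>) \<le> (\<Sum>j<L. \<bar>x j\<bar>)"
proof -
  have "(\<Sum>i<k. \<Sum>j<L. \<bar>restr (A i) x j\<bar>) = (\<Sum>j<L. \<Sum>i<k. \<bar>restr (A i) x j\<bar>)" by (rule sum.swap)
  also have "\<dots> \<le> (\<Sum>j<L. \<bar>x j\<bar>)"
  proof (intro sum_mono sum_single_le)
    fix j i i' assume *: "i \<in> {..<k}" "i' \<in> {..<k}" "\<bar>restr (A i) x j\<bar> \<noteq> 0" "\<bar>restr (A i') x j\<bar> \<noteq> 0"
    then have "j \<in> A i" "j \<in> A i'" by (auto simp: restr_def split: if_splits)
    then show "i = i'" using admissible_disjoint[OF assms] * by blast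
  qed (auto simp: restr_def)
  finally show ?thesis .
qed

text \<open>The disjoint pieces of an admissible family cannot exceed the l_1 norm in total. This
  bound makes the suprema defining \<open>tnorm_m\<close> suprema of bounded sets.\<close>

lemma tnorm_m_bounds:
  assumes "\<And>j. L \<le> j \<Longrightarrow> x j = 0"
  shows "0 \<le> tnorm_m m x \<and> tnorm_m m x \<le> (\<Sum>j<L. \<bar>x j\<bar>)"
  using assms
proof (induction m arbitrary: x)
  case 0
  have le: "\<bar>x j\<bar> \<le> (\<Sum>j<L. \<bar>x j\<bar>)" for j
  proof (cases "j < L")
    case True then show ?thesis by (intro member_le_sum) auto
  qed (use 0 in \<open>auto intro: sum_nonneg\<close>)
  then have "\<bar>x 0\<bar> \<le> Sup (range (\<lambda>j. \<bar>x j\<bar>))" by (intro cSup_upper bdd_aboveI2) auto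
  then have "0 \<le> Sup (range (\<lambda>j. \<bar>x j\<bar>))" by (meson abs_ge_zero order_trans)
  moreover have "Sup (range (\<lambda>j. \<bar>x j\<bar>)) \<le> (\<Sum>j<L. \<bar>x j\<bar>)" using le by (intro cSup_least) auto
  ultimately show ?case by simp
next
  case (Suc m)
  have adm: "(\<Sum>i<k. tnorm_m m (restr (A i) x)) \<le> (\<Sum>j<L. \<bar>x j\<bar>)" if "admissible k A" for k A
  proof -
    have "(\<Sum>i<k. tnorm_m m (restr (A i) x)) \<le> (\<Sum>i<k. \<Sum>j<L. \<bar>restr (A i) x j\<bar>)"
      using Suc by (intro sum_mono) (simp add: restr_def)
    also have "\<dots> \<le> (\<Sum>j<L. \<bar>x j\<bar>)" by (rule admissible_sum_le[OF that])
    finally show ?thesis .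
  qed
  have "Sup {(\<Sum>i<k. tnorm_m m (restr (A i) x)) | k A. admissible k A} \<le> (\<Sum>j<L. \<bar>x j\<bar>)"
    \<comment> \<open>The set is nonempty because the empty family, k = 0, is admissible.\<close>
    using adm by (intro cSup_least) (auto intro!: exI[of _ 0] simp: admissible_def)
  moreover have "0 \<le> tnorm_m m x" "tnorm_m m x \<le> (\<Sum>j<L. \<bar>x j\<bar>)" using Suc by blast+
  moreover have "0 \<le> (\<Sum>j<L. \<bar>x j\<bar>)" by (auto intro: sum_nonneg)
  ultimately show ?case by auto
qed

lemma tnorm_m_Suc_ge:
  assumes "\<And>j. L \<le> j \<Longrightarrow> x j = 0" "admissible k A"
  shows "(\<Sum>i<k. tnorm_m m (restr (A i) x)) / 2 \<le> tnorm_m (Suc m) x"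
proof -
  have "(\<Sum>i<k. tnorm_m m (restr (A i) x)) \<le> Sup {(\<Sum>i<k. tnorm_m m (restr (A i) x)) | k A. admissible k A}"
  proof (rule cSup_upper)
    show "bdd_above {(\<Sum>i<k. tnorm_m m (restr (A i) x)) | k A. admissible k A}"
    proof (rule bdd_aboveI, safe)
      fix k A assume adm: "admissible k A"
      have "(\<Sum>i<k. tnorm_m m (restr (A i) x)) \<le> (\<Sum>i<k. \<Sum>j<L. \<bar>restr (A i) x j\<bar>)"
        using assms(1) tnorm_m_bounds[of L "restr (A i) x" m for i] by (intro sum_mono) (auto simp: restr_def)
      also have "\<dots> \<le> (\<Sum>j<L. \<bar>x j\<bar>)" by (rule admissible_sum_le[OF adm])
      finally show "(\<Sum>i<k. tnorm_m m (restr (A i) x)) \<le> (\<Sum>j<L. \<bar>x j\<bar>)" .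
    qed
  qed (use assms(2) in blast)
  then show ?thesis by simp
qed

text \<open>Unit vectors appear in \<open>tfun 1\<close> and correspond to the norm of index 0,
  hence the shift between the depth of a tree and the index of the norm.\<close>

lemma tfun_le_tnorm_m:
  assumes "h \<in> tfun (Suc m)" "\<And>j. L \<le> j \<Longrightarrow> x j = 0"
  shows "(\<Sum>j<L. h j * \<bar>x j\<bar>) \<le> tnorm_m m x"
  using assms
proof (induction m arbitrary: h x)
  have unit: "(\<Sum>j<L. h j * \<bar>x j\<bar>) \<le> tnorm_m 0 x"
    if h: "h = (\<lambda>i. if i = j then 1 else 0)" and x: "\<And>j. L \<le> j \<Longrightarrow> x j = 0" for h j and x :: "nat \<Rightarrow> real"
  proof -
    have "(\<Sum>i<L. h i * \<bar>x i\<bar>) = (\<Sum>i<L. if i = j then \<bar>x j\<bar> else 0)" by (rule sum.cong) (auto simp: h)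
    also have "\<dots> \<le> \<bar>x j\<bar>" by (simp add: sum.delta)
    also have "\<dots> \<le> Sup (range (\<lambda>j. \<bar>x j\<bar>))"
    proof (rule cSup_upper[OF _ bdd_aboveI2])
      show "\<bar>x i\<bar> \<le> (\<Sum>j<L. \<bar>x j\<bar>)" for i
      proof (cases "i < L")
        case True then show ?thesis by (intro member_le_sum) auto
      qed (use x in \<open>auto intro: sum_nonneg\<close>)
    qed auto
    finally show ?thesis by simp
  qed
  {
    case 0
    then show ?case
    proof (cases rule: tfun_cases)
      case 1 then show ?thesis using tnorm_m_bounds[of L x 0] 0 by simp
    next
      case 2 then show ?thesis using unit 0 by blast
    next
      case (3 k A f)
      then have "k = 0" using gr0I by fastforce
      then show ?thesis using tnorm_m_bounds[of L x 0] 0 3 by simp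
    qed
  next
    case (Suc m)
    have mono: "tnorm_m 0 x \<le> tnorm_m (Suc m) x"
      by (induction m) auto
    from Suc.prems(1) show ?case
    proof (cases rule: tfun_cases)
      case 1 then show ?thesis using tnorm_m_bounds[of L x "Suc m"] Suc.prems by simp
    next
      case (2 j) then show ?thesis using unit[of h j x] Suc.prems(2) mono by fastforce
    next
      case (3 k A f)
      have "(\<Sum>j<L. h j * \<bar>x j\<bar>) = (\<Sum>j<L. \<Sum>i<k. f i j * \<bar>x j\<bar>) / 2"
        by (simp add: 3 sum_divide_distrib sum_distrib_right)
      also have "(\<Sum>j<L. \<Sum>i<k. f i j * \<bar>x j\<bar>) = (\<Sum>i<k. \<Sum>j<L. f i j * \<bar>x j\<bar>)" by (rule sum.swap)
      also have "\<dots> = (\<Sum>i<k. \<Sum>j<L. f i j * \<bar>restr (A i) x j\<bar>)"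
        by (intro sum.cong refl) (use 3 in \<open>auto simp: restr_def\<close>)
      also have "\<dots> / 2 \<le> (\<Sum>i<k. tnorm_m m (restr (A i) x)) / 2"
        by (intro divide_right_mono sum_mono Suc.IH) (use 3 Suc.prems in \<open>auto simp: restr_def\<close>)
      finally have "(\<Sum>j<L. h j * \<bar>x j\<bar>) \<le> (\<Sum>i<k. tnorm_m m (restr (A i) x)) / 2" by simp
      also have "\<dots> \<le> tnorm_m (Suc m) x" by (rule tnorm_m_Suc_ge) (use Suc.prems 3 in auto)
      finally show ?thesis .
    qed
  }
qed

text \<open>Each summand is approached by some functional cut to its set, and half the sum of these
  is again a functional. The supremum is over all depths, so no depth has to be tracked.\<close>

lemma tnorm_m_le:
  assumes "\<And>j. L \<le> j \<Longrightarrow> x j = 0" "\<And>h. h \<in> tfuns \<Longrightarrow> (\<Sum>j<L. h j * \<bar>x j\<bar>) \<le> s"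
  shows "tnorm_m m x \<le> s"
  using assms
proof (induction m arbitrary: x s)
  case 0
  have s: "0 \<le> s" using 0(2)[OF tfuns_zero] by simp
  have "\<bar>x j\<bar> \<le> s" for j
  proof (cases "j < L")
    case True
    have "(\<Sum>i<L. (if i = j then 1 else 0) * \<bar>x i\<bar>) = (\<Sum>i<L. if i = j then \<bar>x j\<bar> else 0)"
      by (rule sum.cong) auto
    then show ?thesis using 0(2)[OF tfuns_unit, of j] True by (simp add: sum.delta)
  qed (use 0 s in auto)
  then show ?case by (auto intro: cSup_least)
next
  case (Suc m)
  have "(\<Sum>i<k. tnorm_m m (restr (A i) x)) \<le> 2 * s" if adm: "admissible k A" for k A
  proof (rule field_le_epsilon)
    fix e :: real assume e: "0 < e"
    \<comment> \<open>The error e is shared among the k children; k + 1 keeps the denominator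
      positive.\<close>
    define d where "d = e / (real k + 1)"
    have d: "0 < d" using e by (simp add: d_def)
    have "\<exists>h. h \<in> tfuns \<and> tnorm_m m (restr (A i) x) - d < (\<Sum>j<L. h j * \<bar>restr (A i) x j\<bar>)" for i
    proof (rule ccontr)
      assume "\<nexists>h. h \<in> tfuns \<and> tnorm_m m (restr (A i) x) - d < (\<Sum>j<L. h j * \<bar>restr (A i) x j\<bar>)"
      then have "tnorm_m m (restr (A i) x) \<le> tnorm_m m (restr (A i) x) - d"
        by (intro Suc.IH) (use Suc.prems in \<open>auto simp: restr_def not_less\<close>)
      then show False using d by simp
    qed
    then obtain h where h: "\<And>i. h i \<in> tfuns"
        "\<And>i. tnorm_m m (restr (A i) x) - d < (\<Sum>j<L. h i j * \<bar>restr (A i) x j\<bar>)" by metis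
    define f where "f i = (\<lambda>j. if j \<in> A i then h i j else 0)" for i
    have "(\<lambda>j. (\<Sum>i<k. f i j) / 2) \<in> tfuns"
      by (rule tfuns_node[OF adm]) (auto simp: f_def intro: tfuns_restrict h)
    from Suc.prems(2)[OF this] have "(\<Sum>j<L. \<Sum>i<k. f i j * \<bar>x j\<bar>) \<le> 2 * s"
      by (simp add: sum_distrib_right flip: sum_divide_distrib)
    moreover have "(\<Sum>j<L. \<Sum>i<k. f i j * \<bar>x j\<bar>) = (\<Sum>i<k. \<Sum>j<L. h i j * \<bar>restr (A i) x j\<bar>)"
      by (subst sum.swap) (auto intro!: sum.cong simp: f_def restr_def)
    moreover have "(\<Sum>i<k. tnorm_m m (restr (A i) x) - d) \<le> (\<Sum>i<k. \<Sum>j<L. h i j * \<bar>restr (A i) x j\<bar>)"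
      by (intro sum_mono less_imp_le h)
    moreover have "real k * d \<le> e" using e by (simp add: d_def field_simps)
    ultimately show "(\<Sum>i<k. tnorm_m m (restr (A i) x)) \<le> 2 * s + e" by (simp add: sum_subtractf)
  qed
  then have "Sup {(\<Sum>i<k. tnorm_m m (restr (A i) x)) | k A. admissible k A} \<le> 2 * s"
    by (intro cSup_least) (auto intro!: exI[of _ 0] simp: admissible_def)
  then show ?case using Suc by simp
qed

lemma tnorm_m_incseq: "incseq (\<lambda>m. tnorm_m m x)"
  by (rule incseq_SucI) simp

lemma tnorm_m_LIMSEQ:
  assumes "\<And>j. L \<le> j \<Longrightarrow> x j = 0"
  shows "(\<lambda>m. tnorm_m m x) \<longlonglongrightarrow> tnorm x"
proof -
  have "convergent (\<lambda>m. tnorm_m m x)"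
    using incseq_convergent[OF tnorm_m_incseq, of x "\<Sum>j<L. \<bar>x j\<bar>"] tnorm_m_bounds[of L x] assms
    by (metis convergent_def)
  then show ?thesis by (simp add: convergent_LIMSEQ_iff tnorm_def)
qed

lemma tnorm_ge:
  assumes "h \<in> tfuns" "\<And>j. L \<le> j \<Longrightarrow> x j = 0"
  shows "(\<Sum>j<L. h j * \<bar>x j\<bar>) \<le> tnorm x"
proof -
  obtain m where "h \<in> tfun (Suc m)" using assms(1) tfun_Suc unfolding tfuns_def by blast
  then have "(\<Sum>j<L. h j * \<bar>x j\<bar>) \<le> tnorm_m m x" using assms by (intro tfun_le_tnorm_m) auto
  also have "\<dots> \<le> tnorm x" using incseq_le[OF tnorm_m_incseq tnorm_m_LIMSEQ] assms by blast
  finally show ?thesis .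
qed

lemma tnorm_le:
  assumes "\<And>j. L \<le> j \<Longrightarrow> x j = 0" "\<And>h. h \<in> tfuns \<Longrightarrow> (\<Sum>j<L. h j * \<bar>x j\<bar>) \<le> s"
  shows "tnorm x \<le> s"
  by (rule LIMSEQ_le_const2[OF tnorm_m_LIMSEQ]) (use assms tnorm_m_le[of L x s] in auto)

section \<open>Merging norming functionals\<close>

text \<open>A node of a norming tree is given by a monotone labelling of the coordinates: coordinates with
  the same label belong to the same child.\<close>
lemma tfuns_labels:
  fixes \<kappa> :: "nat \<Rightarrow> nat"
  assumes "mono \<kappa>" "finite C" "card C \<le> m + 1" "\<And>c. c \<in> C \<Longrightarrow> f c \<in> tfuns"
  shows "(\<lambda>j. if m \<le> j \<and> \<kappa> j \<in> C then f (\<kappa> j) j / 2 else 0) \<in> tfuns"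
proof -
  \<comment> \<open>Admissible families consist of finite nonempty sets, so only labels met by the
    support are kept.\<close>
  define D where "D = {j. m \<le> j \<and> \<kappa> j \<in> C \<and> f (\<kappa> j) j \<noteq> 0}"
  have "D \<subseteq> (\<Union>c\<in>C. {j. f c j \<noteq> 0})" by (auto simp: D_def)
  then have finD: "finite D" using assms tfuns_finite by (auto intro: finite_subset)
  define cs where "cs = sorted_list_of_set (\<kappa> ` D)"
  define k where "k = length cs"
  have set_cs: "set cs = \<kappa> ` D" and sorted: "sorted_wrt (<) cs"
    using finD by (auto simp: cs_def)
  have dist: "distinct cs" by (simp add: cs_def)
  have k: "k = card (\<kappa> ` D)" by (simp add: k_def cs_def)
  have kle: "k \<le> m + 1"
  proof -
    have "\<kappa> ` D \<subseteq> C" by (auto simp: D_def)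
    then show ?thesis unfolding k using card_mono[of C "\<kappa> ` D"] assms by linarith
  qed
  define A where "A i = {j \<in> D. \<kappa> j = cs ! i}" for i
  have ne: "A i \<noteq> {}" and finA: "finite (A i)" if "i < k" for i
  proof -
    have "cs ! i \<in> \<kappa> ` D" using that set_cs k_def nth_mem by blast
    then show "A i \<noteq> {}" by (auto simp: A_def)
    show "finite (A i)" using finD by (simp add: A_def)
  qed
  have adm: "admissible k A"
    unfolding admissible_def
  proof (intro conjI allI impI)
    fix i assume i: "Suc i < k"
    have "cs ! i < cs ! Suc i" using sorted i by (simp add: k_def sorted_wrt_nth_less)
    moreover have "\<kappa> (Max (A i)) = cs ! i" "\<kappa> (Min (A (Suc i))) = cs ! Suc i"
      using Max_in[of "A i"] Min_in[of "A (Suc i)"] ne finA i by (auto simp: A_def)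
    ultimately show "Max (A i) < Min (A (Suc i))"
      using monoD[OF assms(1), of "Min (A (Suc i))" "Max (A i)"] by linarith
  next
    \<comment> \<open>Coordinate m has one-based position m + 1, so a family starting there may have
      m + 1 members.\<close>
    assume "0 < k"
    then have "Min (A 0) \<in> A 0" by (intro Min_in ne finA)
    then have "m \<le> Min (A 0)" by (auto simp: A_def D_def)
    then show "k \<le> Min (A 0) + 1" using kle by simp
  qed (use ne finA in auto)
  define F where "F i = (\<lambda>j. if j \<in> A i then f (cs ! i) j else 0)" for i
  have "cs ! i \<in> C" if "i < k" for i
  proof -
    have "cs ! i \<in> \<kappa> ` D" using that set_cs k_def nth_mem by blast
    then show ?thesis by (auto simp: D_def)
  qed
  then have "(\<lambda>j. (\<Sum>i<k. F i j) / 2) \<in> tfuns"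
    using assms(4) by (intro tfuns_node[OF adm]) (auto simp: F_def intro: tfuns_restrict)
  also have "(\<lambda>j. (\<Sum>i<k. F i j) / 2) = (\<lambda>j. if m \<le> j \<and> \<kappa> j \<in> C then f (\<kappa> j) j / 2 else 0)"
  proof
    fix j
    show "(\<Sum>i<k. F i j) / 2 = (if m \<le> j \<and> \<kappa> j \<in> C then f (\<kappa> j) j / 2 else 0)"
    proof (cases "j \<in> D")
      case True
      then obtain i where i: "i < k" "cs ! i = \<kappa> j" using set_cs by (metis imageI in_set_conv_nth k_def)
      have "F i' j = (if i' = i then f (\<kappa> j) j else 0)" if "i' < k" for i'
        using that i True nth_eq_iff_index_eq[OF dist] by (auto simp: F_def A_def k_def)
      then have "(\<Sum>i<k. F i j) = (\<Sum>i'<k. if i' = i then f (\<kappa> j) j else 0)" by (intro sum.cong) auto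
      then show ?thesis using True i by (simp add: D_def)
    next
      case False
      then have "F i j = 0" for i by (simp add: F_def A_def)
      then show ?thesis using False by (auto simp: D_def)
    qed
  qed
  finally show ?thesis .
qed

text \<open>Blocks of consecutive coordinates, in 1-based positions \<open>[a, a 2^a)\<close>: on such a block the
  norm of \<open>T\<close> is equivalent to the norm of \<open>\<ell>\<^sub>1\<close>.\<close>
primrec bpt :: "nat \<Rightarrow> nat \<Rightarrow> nat" where
  "bpt N 0 = N + 1"
| "bpt N (Suc r) = bpt N r * 2 ^ bpt N r"

lemma bpt_pos: "0 < bpt N r" by (induction r) auto

lemma bpt_ge: "r + 1 \<le> bpt N r"
proof (induction r)
  case (Suc r)
  have "bpt N r < 2 ^ bpt N r" by (rule less_exp)
  also have "\<dots> \<le> bpt N r * 2 ^ bpt N r" using bpt_pos[of N r] by simp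
  finally show ?case using Suc unfolding bpt.simps by linarith
qed simp

lemma bpt_mono: "r \<le> s \<Longrightarrow> bpt N r \<le> bpt N s"
  by (rule lift_Suc_mono_le[of "bpt N"]) auto

text \<open>Counts children in \<open>tfun_merge\<close>: fewer than \<open>bpt N (Suc r)\<close>
  trees, each with fewer than \<open>bpt N (Suc r)\<close> children, have together fewer children
  than the next boundary, as the induction requires.\<close>

lemma bpt_square: "(bpt N (Suc r) - 1) * (bpt N (Suc r) - 1) < bpt N (Suc (Suc r))"
proof -
  define a where "a = bpt N (Suc r)"
  have "(a - 1) * (a - 1) \<le> a * a" by (intro mult_mono) auto
  also have "\<dots> < a * 2 ^ a" using bpt_pos[of N "Suc r"] by (intro mult_strict_left_mono) (auto simp: a_def)
  finally show ?thesis by (simp add: a_def)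
qed

text \<open>In \<open>tfun_merge\<close> every starting block uses four labels; all of them must fit
  into one admissible family that begins a block later.\<close>

lemma bpt_four: "4 * (bpt N r - 1) \<le> bpt N (Suc r)"
proof -
  define a where "a = bpt N r"
  have "4 * (a - 1) \<le> a * 2 ^ a"
  proof (cases "a \<le> 1")
    case False
    then have "(2::nat) ^ 2 \<le> 2 ^ a" by (intro power_increasing) auto
    then have "a * 4 \<le> a * 2 ^ a" by (intro mult_le_mono2) simp
    then show ?thesis by linarith
  qed simp
  then show ?thesis by (simp add: a_def)
qed

text \<open>The block splits into a dyadic pieces [a 2^c, a 2^(c+1)). A piece has as many
  coordinates as its first position, so half its indicator is a node over unit vectors; the a
  pieces, starting at position a, form another node. The two halvings give 1/4.\<close>

lemma block_tfuns:
  assumes "0 < a"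
  shows "(\<lambda>j. if a \<le> j + 1 \<and> j + 1 < a * 2 ^ a then 1/4 else 0) \<in> tfuns"
proof -
  have half: "(\<lambda>j. if j \<in> B then 1/2 else 0) \<in> tfuns" if B: "B \<subseteq> {m..}" "finite B" "card B \<le> m + 1" for B m
  proof -
    have "(\<lambda>j. if m \<le> j \<and> id j \<in> B then (\<lambda>i. if i = id j then 1 else 0) j / 2 else 0) \<in> tfuns"
      by (rule tfuns_labels[where f = "\<lambda>c i. if i = c then 1 else 0"]) (use B in \<open>auto simp: mono_def tfuns_unit\<close>)
    also have "(\<lambda>j. if m \<le> j \<and> id j \<in> B then (\<lambda>i. if i = id j then 1 else 0) j / 2 else 0) = (\<lambda>j. if j \<in> B then 1/2 else (0::real))"
      using B by (auto simp: fun_eq_iff)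
    finally show ?thesis .
  qed
  \<comment> \<open>For a \<le> j + 1 this is the index of the dyadic piece containing coordinate j.
    As a cardinality it is monotone on all coordinates, also those before the block.\<close>
  define \<kappa> where "\<kappa> j = card {i. 0 < i \<and> a * 2 ^ i \<le> j + 1}" for j
  have fin: "finite {i. 0 < i \<and> a * 2 ^ i \<le> j + 1}" for j
  proof (rule finite_subset)
    show "{i. 0 < i \<and> a * 2 ^ i \<le> j + 1} \<subseteq> {..j + 1}"
    proof safe
      fix i assume "a * 2 ^ i \<le> j + 1"
      moreover have "i < 2 ^ i" by simp
      moreover have "(2::nat) ^ i \<le> a * 2 ^ i" using assms by simp
      ultimately show "i \<le> j + 1" by linarith
    qed
  qed simp
  have mono: "mono \<kappa>"
    unfolding \<kappa>_def by (intro monoI card_mono fin) auto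
  have \<kappa>: "a * 2 ^ \<kappa> j \<le> j + 1 \<and> j + 1 < a * 2 ^ (\<kappa> j + 1)" if "a \<le> j + 1" for j
  proof -
    define i where "i = (LEAST i. j + 1 < a * 2 ^ (i + 1))"
    have "j + 1 < 2 ^ (j + 1)" by (rule less_exp)
    also have "\<dots> \<le> a * 2 ^ (j + 1)" using assms by simp
    finally have ex: "j + 1 < a * 2 ^ (i + 1)" unfolding i_def by (rule LeastI)
    have low: "a * 2 ^ i \<le> j + 1"
    proof (cases i)
      case (Suc n)
      then have "\<not> j + 1 < a * 2 ^ (n + 1)" unfolding i_def by (metis not_less_Least lessI)
      then show ?thesis using Suc by simp
    qed (use that in simp)
    have "{l. 0 < l \<and> a * 2 ^ l \<le> j + 1} = {0<..i}"
    proof safe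
      fix l assume "l \<in> {0<..i}"
      then have "a * 2 ^ l \<le> a * 2 ^ i" by (intro mult_le_mono2 power_increasing) auto
      then show "a * 2 ^ l \<le> j + 1" using low by (rule order_trans)
    next
      fix l assume l: "a * 2 ^ l \<le> j + 1" "0 < l"
      show "l \<in> {0<..i}"
      proof (rule ccontr)
        assume "l \<notin> {0<..i}"
        then have "a * 2 ^ (i + 1) \<le> a * 2 ^ l" using l by (intro mult_le_mono2 power_increasing) auto
        then show False using ex l by linarith
      qed
    qed auto
    then have "\<kappa> j = i" by (simp add: \<kappa>_def)
    then show ?thesis using low ex by simp
  qed
  define B where "B c = {j. a * 2 ^ c \<le> j + 1 \<and> j + 1 < a * 2 ^ (c + 1)}" for c
  have Bt: "(\<lambda>j. if j \<in> B c then 1/2 else 0) \<in> tfuns" for c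
  proof (rule half[of _ "a * 2 ^ c - 1"])
    have "B c \<subseteq> {a * 2 ^ c - 1..<a * 2 ^ (c + 1) - 1}" by (auto simp: B_def)
    then show "finite (B c)" "card (B c) \<le> a * 2 ^ c - 1 + 1"
      using card_mono[of "{a * 2 ^ c - 1..<a * 2 ^ (c + 1) - 1}" "B c"] assms by (auto intro: finite_subset)
  qed (auto simp: B_def)
  have "(\<lambda>j. if a - 1 \<le> j \<and> \<kappa> j \<in> {..<a} then (\<lambda>j'. if j' \<in> B (\<kappa> j) then 1/2 else 0) j / 2 else 0) \<in> tfuns"
    by (rule tfuns_labels[where f = "\<lambda>c j. if j \<in> B c then 1/2 else 0"]) (use mono Bt assms in auto)
  also have "(\<lambda>j. if a - 1 \<le> j \<and> \<kappa> j \<in> {..<a} then (\<lambda>j'. if j' \<in> B (\<kappa> j) then 1/2 else 0) j / 2 else 0)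
    = (\<lambda>j. if a \<le> j + 1 \<and> j + 1 < a * 2 ^ a then 1/4 else (0::real))"
  proof
    fix j
    have "\<kappa> j < a \<longleftrightarrow> j + 1 < a * 2 ^ a" if j: "a \<le> j + 1"
    proof
      assume "\<kappa> j < a"
      then have "a * 2 ^ (\<kappa> j + 1) \<le> a * 2 ^ a" by (intro mult_le_mono2 power_increasing) auto
      then show "j + 1 < a * 2 ^ a" using \<kappa>[OF j] by linarith
    next
      assume *: "j + 1 < a * 2 ^ a"
      show "\<kappa> j < a"
      proof (rule ccontr)
        assume "\<not> \<kappa> j < a"
        then have "a * 2 ^ a \<le> a * 2 ^ \<kappa> j" by (intro mult_le_mono2 power_increasing) auto
        then show False using \<kappa>[OF j] * by linarith
      qed
    qed
    then show "(if a - 1 \<le> j \<and> \<kappa> j \<in> {..<a} then (\<lambda>j'. if j' \<in> B (\<kappa> j) then 1/2 else 0) j / 2 else 0)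
      = (if a \<le> j + 1 \<and> j + 1 < a * 2 ^ a then 1/4 else (0::real))"
      using \<kappa>[of j] by (auto simp: B_def)
  qed
  finally show ?thesis .
qed

text \<open>The number of the block containing coordinate j. Coordinates before the first block also
  receive 0, so the labelling is monotone everywhere and only \<open>bidx_ge\<close> has to assume
  that j is at least N.\<close>

definition bidx :: "nat \<Rightarrow> nat \<Rightarrow> nat" where
  "bidx N j = (LEAST r. j + 1 < bpt N (Suc r))"

lemma bidx_less: "j + 1 < bpt N (Suc (bidx N j))"
  unfolding bidx_def by (rule LeastI[of _ "j + 1"]) (use bpt_ge[of "Suc (j + 1)" N] in linarith)

lemma bidx_ge: "N \<le> j \<Longrightarrow> bpt N (bidx N j) \<le> j + 1"
proof (cases "bidx N j")
  case (Suc n)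
  then have "\<not> j + 1 < bpt N (Suc n)" unfolding bidx_def by (metis not_less_Least lessI)
  then show ?thesis using Suc by simp
qed simp

lemma bidx_mono: "mono (bidx N)"
proof (rule monoI)
  fix i j :: nat assume "i \<le> j"
  then have "i + 1 < bpt N (Suc (bidx N j))" using bidx_less[of j N] by simp
  then show "bidx N i \<le> bidx N j" unfolding bidx_def[of N i] by (rule Least_le)
qed

lemma bidx_geI: "bpt N s \<le> j + 1 \<Longrightarrow> s \<le> bidx N j"
proof (rule ccontr)
  assume *: "bpt N s \<le> j + 1" "\<not> s \<le> bidx N j"
  then have "bpt N (Suc (bidx N j)) \<le> bpt N s" by (intro bpt_mono) simp
  then show False using bidx_less[of j N] * by simp
qed

text \<open>The start of a tree is the block from which on it may be nonzero; its root then has fewer than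
  \<open>bpt N (Suc \<sigma>)\<close> children, and outside the first block the tree is half the maximum of its children.\<close>
lemma tfun_start:
  assumes h: "h \<in> tfun (Suc d)" and supp: "\<And>j. j + 1 < bpt N s \<Longrightarrow> h j = 0"
  shows "\<exists>\<sigma> Ch. s \<le> \<sigma> \<and> finite Ch \<and> card Ch < bpt N (Suc \<sigma>) \<and> Ch \<subseteq> tfun d \<and>
     (\<forall>j. h j \<noteq> 0 \<longrightarrow> \<sigma> \<le> bidx N j) \<and>
     (\<forall>j. h j \<noteq> 0 \<longrightarrow> \<sigma> < bidx N j \<longrightarrow> (\<exists>c\<in>Ch. h j = c j / 2))"
  using h
proof (cases rule: tfun_cases)
  case 1
  then show ?thesis using bpt_pos by (intro exI[of _ s] exI[of _ "{}"]) simp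
next
  case (2 j0)
  then have "\<not> j0 + 1 < bpt N s" using supp[of j0] by auto
  then have "s \<le> bidx N j0" by (intro bidx_geI) simp
  \<comment> \<open>A unit vector starts in the block of its only coordinate, so no coordinate in a
    later block requires a child.\<close>
  then show ?thesis using bpt_pos 2 by (intro exI[of _ "bidx N j0"] exI[of _ "{}"]) (simp split: if_splits)
next
  case (3 k A f)
  show ?thesis
  proof (cases "k = 0")
    case True
    then show ?thesis using 3 bpt_pos by (intro exI[of _ s] exI[of _ "{}"]) simp
  next
    case False
    \<comment> \<open>The tree vanishes before its first set and before block s. The later of these
      two starting points bounds the number k of children and determines the block where the tree
      starts.\<close>
    define j0 where "j0 = max (Min (A 0)) (bpt N s - 1)"
    have pos: "0 < bpt N s" by (rule bpt_pos)
    have Sj: "s \<le> bidx N j0" using pos by (intro bidx_geI) (auto simp: j0_def)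
    have kj: "k \<le> j0 + 1" using 3(2) False by (auto simp: admissible_def j0_def)
    have ex: "\<exists>i<k. h j = f i j / 2 \<and> j \<in> A i" if "h j \<noteq> 0" for j
    proof -
      have "(\<Sum>i<k. f i j) \<noteq> 0" using that by (simp add: 3)
      then obtain i where i: "i < k" "f i j \<noteq> 0" by (meson lessThan_iff sum.neutral)
      then have ji: "j \<in> A i" using 3(4) by blast
      have "f i' j = 0" if "i' < k" "i' \<noteq> i" for i'
        using admissible_disjoint[OF 3(2) \<open>i < k\<close> that(1) ji] that 3(4) by blast
      then have "(\<Sum>i<k. f i j) = (\<Sum>i'\<in>{i}. f i' j)" using i by (intro sum.mono_neutral_right) auto
      then show ?thesis using i ji 3(1) by auto
    qed
    have ge: "bidx N j0 \<le> bidx N j" if hj: "h j \<noteq> 0" for j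
    proof -
      obtain i where i: "i < k" "j \<in> A i" using ex[OF hj] by blast
      have "Min (A 0) \<le> j"
      proof (cases "i = 0")
        case True then show ?thesis using i 3(2) by (auto simp: admissible_def)
      next
        case F: False
        have "Min (A 0) \<in> A 0" using 3(2) False by (auto simp: admissible_def)
        then show ?thesis using admissible_ordered[OF 3(2), of 0 i "Min (A 0)" j] F i by (simp add: less_imp_le)
      qed
      moreover have "bpt N s - 1 \<le> j" using supp[of j] hj by linarith
      ultimately show ?thesis by (intro monoD[OF bidx_mono]) (simp add: j0_def)
    qed
    have "card (f ` {..<k}) \<le> k" using card_image_le[of "{..<k}" f] by simp
    then have "card (f ` {..<k}) < bpt N (Suc (bidx N j0))" using kj bidx_less[of j0 N] by linarith
    moreover have "f ` {..<k} \<subseteq> tfun d" using 3 by auto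
    moreover have "\<exists>c\<in>f ` {..<k}. h j = c j / 2" if "h j \<noteq> 0" for j using ex[OF that] by blast
    ultimately show ?thesis using Sj ge
      by (intro exI[of _ "bidx N j0"] exI[of _ "f ` {..<k}"] conjI allI impI) auto
  qed
qed

text \<open>Induction on the depth. For each starting block \<tau>, the children of all trees
  started by then are few enough to be merged by the induction hypothesis into one functional
  \<open>g \<tau>\<close>, which dominates them from block \<tau> + 3 on. The three blocks in
  between are covered by \<open>block_tfuns\<close>. One node puts these four functionals together
  for every \<tau>, each up to the next start.\<close>

lemma tfun_merge:
  assumes "finite H" "card H < bpt N (Suc s)" "H \<subseteq> tfun d" "\<And>h j. h \<in> H \<Longrightarrow> j + 1 < bpt N s \<Longrightarrow> h j = 0"
  shows "\<exists>g\<in>tfuns. \<forall>h\<in>H. \<forall>j. bpt N (s + 2) \<le> j + 1 \<longrightarrow> h j \<le> 8 * g j"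
  using assms
proof (induction d arbitrary: H s)
  case 0
  then show ?case using tfuns_zero by auto
next
  case (Suc d)
  define Q where "Q h \<sigma> Ch \<longleftrightarrow> s \<le> \<sigma> \<and> finite Ch \<and> card Ch < bpt N (Suc \<sigma>) \<and> Ch \<subseteq> tfun d \<and>
     (\<forall>j. h j \<noteq> 0 \<longrightarrow> \<sigma> \<le> bidx N j) \<and>
     (\<forall>j. h j \<noteq> 0 \<longrightarrow> \<sigma> < bidx N j \<longrightarrow> (\<exists>c\<in>Ch. h j = c j / 2))" for h \<sigma> Ch
  have "\<forall>h\<in>H. \<exists>\<sigma> Ch. Q h \<sigma> Ch"
  proof
    fix h assume "h \<in> H"
    then show "\<exists>\<sigma> Ch. Q h \<sigma> Ch" unfolding Q_def by (intro tfun_start) (use Suc.prems in auto)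
  qed
  from bchoice[OF this] obtain \<sigma> where "\<forall>h\<in>H. \<exists>Ch. Q h (\<sigma> h) Ch" by blast
  from bchoice[OF this] obtain Ch where Q: "\<And>h. h \<in> H \<Longrightarrow> Q h (\<sigma> h) (Ch h)" by blast
  have \<sigma>: "\<And>h. h \<in> H \<Longrightarrow> s \<le> \<sigma> h" and finCh: "\<And>h. h \<in> H \<Longrightarrow> finite (Ch h)"
    and cardCh: "\<And>h. h \<in> H \<Longrightarrow> card (Ch h) < bpt N (Suc (\<sigma> h))"
    and Chd: "\<And>h. h \<in> H \<Longrightarrow> Ch h \<subseteq> tfun d"
    and start: "\<And>h j. h \<in> H \<Longrightarrow> h j \<noteq> 0 \<Longrightarrow> \<sigma> h \<le> bidx N j"
    and child: "\<And>h j. h \<in> H \<Longrightarrow> h j \<noteq> 0 \<Longrightarrow> \<sigma> h < bidx N j \<Longrightarrow> \<exists>c\<in>Ch h. h j = c j / 2"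
    using Q unfolding Q_def by blast+
  define S where "S = \<sigma> ` H"
  have finS: "finite S" and cardS: "card S \<le> bpt N (Suc s) - 1"
    using Suc.prems card_image_le[of H \<sigma>] by (auto simp: S_def)
  define R where "R \<tau> c = (\<lambda>j. if j \<in> {j. bpt N (Suc \<tau>) \<le> j + 1} then c j else (0::real))" for \<tau> c
  \<comment> \<open>Trees with earlier starts are still present, so their children are included as
    well. After a start at \<tau> only the functional merged at \<tau> is used, until the next
    start.\<close>
  define H' where "H' \<tau> = R \<tau> ` (\<Union>h\<in>{h\<in>H. \<sigma> h \<le> \<tau>}. Ch h)" for \<tau>
  have "\<exists>g\<in>tfuns. \<forall>h\<in>H' \<tau>. \<forall>j. bpt N (Suc \<tau> + 2) \<le> j + 1 \<longrightarrow> h j \<le> 8 * g j" if "\<tau> \<in> S" for \<tau>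
  proof (rule Suc.IH)
    have s\<tau>: "s \<le> \<tau>" using that \<sigma> by (auto simp: S_def)
    have fin: "finite (\<Union>h\<in>{h\<in>H. \<sigma> h \<le> \<tau>}. Ch h)" using Suc.prems finCh by auto
    then show "finite (H' \<tau>)" by (simp add: H'_def)
    have "card (H' \<tau>) \<le> card (\<Union>h\<in>{h\<in>H. \<sigma> h \<le> \<tau>}. Ch h)" unfolding H'_def by (rule card_image_le[OF fin])
    also have "\<dots> \<le> (\<Sum>h\<in>{h\<in>H. \<sigma> h \<le> \<tau>}. card (Ch h))" using Suc.prems by (intro card_UN_le) auto
    also have "\<dots> \<le> (\<Sum>h\<in>{h\<in>H. \<sigma> h \<le> \<tau>}. bpt N (Suc \<tau>) - 1)"
    proof (rule sum_mono)
      fix h assume "h \<in> {h\<in>H. \<sigma> h \<le> \<tau>}"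
      then show "card (Ch h) \<le> bpt N (Suc \<tau>) - 1"
        using cardCh[of h] bpt_mono[of "Suc (\<sigma> h)" "Suc \<tau>" N] by auto
    qed
    also have "\<dots> = card {h\<in>H. \<sigma> h \<le> \<tau>} * (bpt N (Suc \<tau>) - 1)" by simp
    also have "\<dots> \<le> (bpt N (Suc \<tau>) - 1) * (bpt N (Suc \<tau>) - 1)"
    proof (rule mult_le_mono1)
      have "card {h\<in>H. \<sigma> h \<le> \<tau>} \<le> card H" using Suc.prems by (intro card_mono) auto
      then show "card {h\<in>H. \<sigma> h \<le> \<tau>} \<le> bpt N (Suc \<tau>) - 1"
        using Suc.prems(2) bpt_mono[of "Suc s" "Suc \<tau>" N] s\<tau> by linarith
    qed
    also have "\<dots> < bpt N (Suc (Suc \<tau>))" by (rule bpt_square)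
    finally show "card (H' \<tau>) < bpt N (Suc (Suc \<tau>))" .
    show "H' \<tau> \<subseteq> tfun d"
    proof
      fix c' assume "c' \<in> H' \<tau>"
      then obtain h c where "h \<in> H" "c \<in> Ch h" "c' = R \<tau> c" by (auto simp: H'_def)
      then show "c' \<in> tfun d" using Chd tfun_restrict[of c d] unfolding R_def by blast
    qed
    show "h j = 0" if "h \<in> H' \<tau>" "j + 1 < bpt N (Suc \<tau>)" for h j
      using that by (auto simp: H'_def R_def)
  qed
  then obtain g where g: "\<And>\<tau>. \<tau> \<in> S \<Longrightarrow> g \<tau> \<in> tfuns"
    "\<And>\<tau> h j. \<tau> \<in> S \<Longrightarrow> h \<in> H' \<tau> \<Longrightarrow> bpt N (Suc \<tau> + 2) \<le> j + 1 \<Longrightarrow> h j \<le> 8 * g \<tau> j"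
    by metis
  \<comment> \<open>The latest start not after block r. The value 0 is a default for blocks before
    every start, where no tree of H has begun.\<close>
  define t where "t r = Max {\<tau> \<in> insert 0 S. \<tau> \<le> r}" for r
  have "t r \<in> {\<tau> \<in> insert 0 S. \<tau> \<le> r}" for r
    unfolding t_def by (rule Max_in) (use finS in auto)
  then have t_in: "t r \<in> insert 0 S" "t r \<le> r" for r by blast+
  have t_ge: "\<tau> \<le> t r" if "\<tau> \<in> S" "\<tau> \<le> r" for \<tau> r
    unfolding t_def using that finS by (intro Max_ge) auto
  have t_mono: "t r \<le> t r'" if "r \<le> r'" for r r'
    unfolding t_def using that finS by (intro Max_mono) auto
  \<comment> \<open>The quotient of the label by 4 is the latest start, the remainder the number of
    blocks passed since then, capped at 3. A new start raises the label by at least 4 in its first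
    part, so monotonicity survives the reset of the remainder.\<close>
  define lab where "lab r = 4 * t r + min (r - t r) 3" for r
  have lab_mono: "lab r \<le> lab r'" if "r \<le> r'" for r r'
  proof (cases "t r = t r'")
    case False
    then have "4 * t r + 4 \<le> 4 * t r'" using t_mono[OF that] by linarith
    then show ?thesis unfolding lab_def by linarith
  qed (use that in \<open>auto simp: lab_def\<close>)
  define C where "C = (\<lambda>(\<tau>, i). 4 * \<tau> + i) ` (S \<times> {..<4})"
  \<comment> \<open>Remainders 0, 1, 2 stand for the starting block and the next two, with the
    constant functional 1/4; remainder 3 stands for everything later, with the merged
    children.\<close>
  define f where "f c = (let \<tau> = c div 4; i = c mod 4 in if i = 3 then (if \<tau> \<in> S then g \<tau> else (\<lambda>_. 0)) else
      (\<lambda>j. if bpt N (\<tau> + i) \<le> j + 1 \<and> j + 1 < bpt N (\<tau> + i) * 2 ^ bpt N (\<tau> + i) then 1/4 else 0))" for c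
  define m where "m = bpt N (s + 2) - 1"
  define G where "G = (\<lambda>j. if m \<le> j \<and> lab (bidx N j) \<in> C then f (lab (bidx N j)) j / 2 else 0)"
  have "G \<in> tfuns"
    unfolding G_def
  proof (rule tfuns_labels[where \<kappa> = "\<lambda>j. lab (bidx N j)"])
    show "mono (\<lambda>j. lab (bidx N j))" using lab_mono bidx_mono by (intro monoI) (auto dest: monoD)
    show "finite C" using finS by (simp add: C_def)
    have "card C \<le> card (S \<times> {..<4::nat})" unfolding C_def using finS by (intro card_image_le) auto
    also have "\<dots> \<le> 4 * (bpt N (Suc s) - 1)" using cardS by (simp add: card_cartesian_product)
    also have "\<dots> \<le> bpt N (Suc (Suc s))" by (rule bpt_four)
    finally show "card C \<le> m + 1" by (simp add: m_def)
    show "f c \<in> tfuns" for c using g tfuns_zero block_tfuns[OF bpt_pos] by (simp add: f_def Let_def)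
  qed
  moreover have "h j \<le> 8 * G j" if h: "h \<in> H" and j: "bpt N (s + 2) \<le> j + 1" for h j
  proof (cases "h j = 0")
    case True
    have "0 \<le> G j" using tfuns_nonneg[OF \<open>G \<in> tfuns\<close>] .
    then show ?thesis using True by simp
  next
    case False
    define r where "r = bidx N j"
    have Nj: "N \<le> j" using j bpt_mono[of 0 "s+2" N] by simp
    have \<sigma>r: "\<sigma> h \<le> r" using start[OF h False] by (simp add: r_def)
    have \<sigma>S: "\<sigma> h \<in> S" using h by (simp add: S_def)
    have \<sigma>t: "\<sigma> h \<le> t r" by (rule t_ge[OF \<sigma>S \<sigma>r])
    have tS: "t r \<in> S" using t_in[of r] \<sigma>t \<sigma>S by (cases "t r = 0") auto
    have mj: "m \<le> j" using j by (simp add: m_def)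
    define i where "i = min (r - t r) 3"
    have i: "i < 4" "lab r = 4 * t r + i" by (auto simp: i_def lab_def)
    have "lab r \<in> C" unfolding C_def i(2) using tS i(1) by force
    then have G: "G j = f (lab r) j / 2" using mj by (simp add: G_def r_def)
    have dm: "lab r div 4 = t r" "lab r mod 4 = i" using i by auto
    have h1: "h j \<le> 1" using tfun_props Suc.prems(3) h by blast
    show ?thesis
    proof (cases "i = 3")
      case F: False
      then have "t r + i = r" using t_in(2)[of r] by (auto simp: i_def)
      then have "f (lab r) j = 1/4"
        using F bidx_ge[OF Nj, folded r_def] bidx_less[of j N, folded r_def] by (simp add: f_def dm Let_def)
      \<comment> \<open>Here \<open>G j\<close> is 1/8, half of the block functional, and
        \<open>h j\<close> is at most 1: this is the origin of the constant 8.\<close>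
      then show ?thesis using h1 G by simp
    next
      case T: True
      then have r3: "t r + 3 \<le> r" by (auto simp: i_def)
      then obtain c where c: "c \<in> Ch h" "h j = c j / 2" using child[OF h False] \<sigma>t by (auto simp: r_def)
      have br: "bpt N (Suc (t r) + 2) \<le> j + 1"
        using bpt_mono[of "Suc (t r) + 2" r N] r3 bidx_ge[OF Nj] by (simp add: r_def)
      moreover have "bpt N (Suc (t r)) \<le> bpt N (Suc (t r) + 2)" by (rule bpt_mono) simp
      ultimately have "bpt N (Suc (t r)) \<le> j + 1" by (rule order_trans[rotated])
      then have "R (t r) c j = c j" by (simp only: R_def mem_Collect_eq if_True)
      moreover have "R (t r) c \<in> H' (t r)" using c h \<sigma>t by (auto simp: H'_def)
      ultimately have "c j \<le> 8 * g (t r) j" using g(2)[OF tS _ br] by metis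
      \<comment> \<open>Both \<open>h j\<close> and \<open>G j\<close> carry a factor 1/2 relative
        to the child and to \<open>g (t r)\<close>, so the constant 8 of the induction hypothesis
        reproduces itself.\<close>
      then show ?thesis using T tS c G by (simp add: f_def dm Let_def)
    qed
  qed
  ultimately show ?case by blast
qed

section \<open>Norming sets of the 2-convexification\<close>

lemma tnorm_nonneg:
  assumes "\<And>j. L \<le> j \<Longrightarrow> x j = 0"
  shows "0 \<le> tnorm x"
  using tnorm_ge[OF tfuns_zero, of L x] assms by simp

lemma t2norm_nonneg:
  assumes "\<And>j. L \<le> j \<Longrightarrow> x j = 0"
  shows "0 \<le> t2norm x"
  using tnorm_nonneg[of L "\<lambda>j. (cmod (x j))\<^sup>2"] assms by (simp add: t2norm_def)

lemma t2norm_ge: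
  assumes "h \<in> tfuns" "\<And>j. L \<le> j \<Longrightarrow> x j = 0"
  shows "(\<Sum>j<L. h j * (cmod (x j))\<^sup>2) \<le> (t2norm x)\<^sup>2"
  using tnorm_ge[of h L "\<lambda>j. (cmod (x j))\<^sup>2"] tnorm_nonneg[of L "\<lambda>j. (cmod (x j))\<^sup>2"] assms
  by (simp add: t2norm_def)

lemma t2norm_le:
  assumes "\<And>j. L \<le> j \<Longrightarrow> x j = 0" "0 \<le> s" "\<And>h. h \<in> tfuns \<Longrightarrow> (\<Sum>j<L. h j * (cmod (x j))\<^sup>2) \<le> s\<^sup>2"
  shows "t2norm x \<le> s"
proof -
  have "tnorm (\<lambda>j. (cmod (x j))\<^sup>2) \<le> s\<^sup>2" by (rule tnorm_le[of L]) (use assms in auto)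
  then show ?thesis using assms(2) by (simp add: t2norm_def real_le_lsqrt)
qed

lemma trunc_ge: "L \<le> j \<Longrightarrow> trunc L x j = 0" by (simp add: trunc_def)

lemma t2norm_trunc_nonneg: "0 \<le> t2norm (trunc L x)"
  by (rule t2norm_nonneg[of L]) (rule trunc_ge)

lemma t2norm_coord: "j < L \<Longrightarrow> cmod (x j) \<le> t2norm (trunc L x)"
proof -
  assume j: "j < L"
  have "(\<Sum>i<L. (if i = j then 1 else 0) * (cmod (trunc L x i))\<^sup>2) = (\<Sum>i<L. if i = j then (cmod (x j))\<^sup>2 else 0)"
    by (rule sum.cong) (auto simp: trunc_def)
  then have "(cmod (x j))\<^sup>2 \<le> (t2norm (trunc L x))\<^sup>2"
    using t2norm_ge[OF tfuns_unit, of L "trunc L x" j] j by (simp add: trunc_ge)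
  then show ?thesis using t2norm_trunc_nonneg power2_le_imp_le by blast
qed

text \<open>The positive part of the dual unit ball of T, tested against squares. Unlike
  \<open>tfuns\<close> it is convex and closed under coordinatewise limits, and maximization over
  weights needs both.\<close>

definition wball :: "(nat \<Rightarrow> real) set" where
  "wball = {h. (\<forall>j. 0 \<le> h j) \<and> (\<forall>L x. (\<Sum>j<L. h j * (cmod (x j))\<^sup>2) \<le> (t2norm (trunc L x))\<^sup>2)}"

lemma wballD: "h \<in> wball \<Longrightarrow> 0 \<le> h j" "h \<in> wball \<Longrightarrow> (\<Sum>j<L. h j * (cmod (x j))\<^sup>2) \<le> (t2norm (trunc L x))\<^sup>2"
  by (auto simp: wball_def)

lemma tfuns_wball: "tfuns \<subseteq> wball"
proof
  fix h assume h: "h \<in> tfuns"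
  have "(\<Sum>j<L. h j * (cmod (x j))\<^sup>2) \<le> (t2norm (trunc L x))\<^sup>2" for L x
  proof -
    have "(\<Sum>j<L. h j * (cmod (x j))\<^sup>2) = (\<Sum>j<L. h j * (cmod (trunc L x j))\<^sup>2)"
      by (rule sum.cong) (auto simp: trunc_def)
    then show ?thesis using t2norm_ge[OF h, of L "trunc L x"] by (simp add: trunc_ge)
  qed
  then show "h \<in> wball" using tfuns_nonneg[OF h] by (auto simp: wball_def)
qed

lemma wball_le1: "h \<in> wball \<Longrightarrow> h j \<le> 1"
proof -
  assume h: "h \<in> wball"
  define x :: seq where "x = (\<lambda>i. if i = j then 1 else 0)"
  have "(\<Sum>i<Suc j. h i * (cmod (x i))\<^sup>2) = (\<Sum>i<Suc j. if i = j then h j else 0)"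
    by (rule sum.cong) (auto simp: x_def)
  then have "h j \<le> (t2norm (trunc (Suc j) x))\<^sup>2" using wballD(2)[OF h, of x "Suc j"] by simp
  also have "t2norm (trunc (Suc j) x) \<le> 1"
  proof (rule t2norm_le[of "Suc j"])
    fix g assume g: "g \<in> tfuns"
    have "(\<Sum>i<Suc j. g i * (cmod (trunc (Suc j) x i))\<^sup>2) = (\<Sum>i<Suc j. if i = j then g j else 0)"
      by (rule sum.cong) (auto simp: x_def trunc_def)
    then show "(\<Sum>i<Suc j. g i * (cmod (trunc (Suc j) x i))\<^sup>2) \<le> 1\<^sup>2" using tfuns_le1[OF g] by simp
  qed (auto simp: trunc_ge)
  then have "(t2norm (trunc (Suc j) x))\<^sup>2 \<le> 1" using t2norm_trunc_nonneg power_le_one by blast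
  finally show ?thesis .
qed

section \<open>Convexity and compactness of the weight ball\<close>

lemma wball_combine:
  assumes "finite I" "\<And>i. i \<in> I \<Longrightarrow> h i \<in> wball" "\<And>i. i \<in> I \<Longrightarrow> 0 \<le> c i" "sum c I \<le> 1"
  shows "(\<lambda>j. \<Sum>i\<in>I. c i * h i j) \<in> wball"
proof -
  have "(\<Sum>j<L. (\<Sum>i\<in>I. c i * h i j) * (cmod (x j))\<^sup>2) \<le> (t2norm (trunc L x))\<^sup>2" for L x
  proof -
    have "(\<Sum>j<L. (\<Sum>i\<in>I. c i * h i j) * (cmod (x j))\<^sup>2) = (\<Sum>i\<in>I. c i * (\<Sum>j<L. h i j * (cmod (x j))\<^sup>2))"
      by (simp add: sum_distrib_right sum_distrib_left mult.assoc sum.swap[of _ I])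
    also have "\<dots> \<le> (\<Sum>i\<in>I. c i * (t2norm (trunc L x))\<^sup>2)"
      by (intro sum_mono mult_left_mono wballD assms) auto
    also have "\<dots> = sum c I * (t2norm (trunc L x))\<^sup>2" by (simp add: sum_distrib_right)
    also have "\<dots> \<le> 1 * (t2norm (trunc L x))\<^sup>2" using assms by (intro mult_right_mono) auto
    finally show ?thesis by simp
  qed
  moreover have "0 \<le> (\<Sum>i\<in>I. c i * h i j)" for j using assms wballD(1) by (intro sum_nonneg) auto
  ultimately show ?thesis by (auto simp: wball_def)
qed

lemma wball_convex:
  assumes "h \<in> wball" "g \<in> wball" "0 \<le> t" "t \<le> 1"
  shows "(\<lambda>j. (1 - t) * h j + t * g j) \<in> wball"
  using wball_combine[of "{0,1::nat}" "\<lambda>i. if i = 0 then h else g" "\<lambda>i. if i = 0 then 1 - t else t"] assms by simp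

lemma wball_limit:
  assumes "\<And>n. h n \<in> wball" "\<And>j. (\<lambda>n. h n j) \<longlonglongrightarrow> g j"
  shows "g \<in> wball"
proof -
  have "0 \<le> g j" for j by (rule LIMSEQ_le_const[OF assms(2)]) (use wballD(1)[OF assms(1)] in auto)
  moreover have "(\<Sum>j<L. g j * (cmod (x j))\<^sup>2) \<le> (t2norm (trunc L x))\<^sup>2" for L x
    by (rule LIMSEQ_le_const2[where X = "\<lambda>n. \<Sum>j<L. h n j * (cmod (x j))\<^sup>2"])
       (use wballD(2)[OF assms(1)] in \<open>auto intro!: tendsto_sum tendsto_mult assms\<close>)
  ultimately show ?thesis by (auto simp: wball_def)
qed

text \<open>All entries lie in [0, 1], so a diagonal subsequence converges in every
  coordinate.\<close>

lemma wball_compact: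
  assumes "\<And>n::nat. h n \<in> wball"
  shows "\<exists>r g. strict_mono r \<and> g \<in> wball \<and> (\<forall>j. (\<lambda>n. h (r n) j) \<longlonglongrightarrow> g j)"
proof -
  obtain r where r: "strict_mono (r :: nat \<Rightarrow> nat)" "\<And>j. \<exists>l. (\<lambda>n. h (r n) j) \<longlonglongrightarrow> l"
    by (rule function_convergent_subsequence[of UNIV h 1])
       (use wballD(1)[OF assms] wball_le1[OF assms] in auto)
  then obtain g where g: "\<And>j. (\<lambda>n. h (r n) j) \<longlonglongrightarrow> g j" by metis
  have "g \<in> wball" by (rule wball_limit[of "\<lambda>n. h (r n)"]) (use assms g in auto)
  then show ?thesis using r(1) g by (intro exI[of _ r] exI[of _ g]) simp
qed

lemma wball_unit: "(\<lambda>i. if i = j then 1 else 0) \<in> wball"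
  using tfuns_unit tfuns_wball by blast

text \<open>Merging from s = 0 gives domination only from block 2 on; the blocks 0 and 1 are covered
  by their constant functionals 1/4.\<close>

lemma wball_dominates:
  assumes "finite H" "card H \<le> N + 1" "H \<subseteq> tfuns" "\<And>h j. h \<in> H \<Longrightarrow> j < N \<Longrightarrow> h j = 0"
  shows "\<exists>g\<in>wball. \<forall>h\<in>H. \<forall>j. h j \<le> 16 * g j"
proof -
  obtain d where d: "H \<subseteq> tfun d" using finite_subset_tfun[OF assms(1,3)] by blast
  have "(1::nat) < 2 ^ (N + 1)" by (rule one_less_power) auto
  then have "(N + 1) * 1 < (N + 1) * 2 ^ (N + 1)" by (intro mult_strict_left_mono) auto
  then have "card H < bpt N (Suc 0)" using assms(2) by simp
  then obtain g where g: "g \<in> tfuns" "\<And>h j. h \<in> H \<Longrightarrow> bpt N 2 \<le> j + 1 \<Longrightarrow> h j \<le> 8 * g j"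
    using tfun_merge[of H N 0 d] assms d by (auto simp: numeral_2_eq_2)
  define w where "w r = (\<lambda>j. if bpt N r \<le> j + 1 \<and> j + 1 < bpt N r * 2 ^ bpt N r then 1/4 else (0::real))" for r
  have w: "w r \<in> tfuns" for r unfolding w_def by (rule block_tfuns[OF bpt_pos])
  \<comment> \<open>A convex combination with weights 1/4, 1/4, 1/2: the factor 16 turns the first
    two into 4 times the value 1/4, and the last into the factor 8 of
    \<open>tfun_merge\<close>.\<close>
  define G where "G = (\<lambda>j. \<Sum>i<3. (if i = 2 then 1/2 else 1/4) * (if i = 2 then g else w i) j)"
  have "G \<in> wball"
    unfolding G_def
    by (rule wball_combine) (use g w tfuns_wball in \<open>auto simp: numeral_3_eq_3 numeral_2_eq_2\<close>)
  moreover have "h j \<le> 16 * G j" if h: "h \<in> H" for h j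
  proof -
    have G: "16 * G j = 4 * w 0 j + 4 * w 1 j + 8 * g j" by (simp add: G_def numeral_3_eq_3 numeral_2_eq_2)
    have w0: "0 \<le> w r j" for r by (simp add: w_def)
    have g0: "0 \<le> g j" using tfuns_nonneg[OF g(1)] .
    have h1: "h j \<le> 1" using tfuns_le1 assms h by blast
    consider "j < N" | "N \<le> j" "j + 1 < bpt N 1" | "bpt N 1 \<le> j + 1" "j + 1 < bpt N 2" | "bpt N 2 \<le> j + 1" by linarith
    then show ?thesis
    proof cases
      case 1 then show ?thesis using assms(4)[OF h 1] G w0[of 0] w0[of 1] g0 by linarith
    next
      case 2
      then have "w 0 j = 1/4" by (simp add: w_def)
      then show ?thesis using h1 G w0[of 1] g0 by linarith
    next
      case 3
      then have "w 1 j = 1/4" by (simp add: w_def numeral_2_eq_2)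
      then show ?thesis using h1 G w0[of 0] g0 by linarith
    next
      case 4 then show ?thesis using g(2)[OF h 4] G w0[of 0] w0[of 1] by linarith
    qed
  qed
  ultimately show ?thesis by blast
qed

text \<open>Lozanovskii factorization: the weight maximizing \<open>\<Prod>j. h j powr \<rho> j\<close> over the weight ball.\<close>
lemma lozanovskii_finite:
  assumes \<rho>: "\<And>j. 0 \<le> \<rho> j"
  shows "\<exists>h0\<in>wball. (\<forall>j<L. 0 < \<rho> j \<longrightarrow> 0 < h0 j) \<and>
           (\<forall>h\<in>wball. (\<Sum>j<L. \<rho> j * (h j / h0 j)) \<le> (\<Sum>j<L. \<rho> j))"
proof -
  \<comment> \<open>Since 0 powr 0 is 0 here, coordinates with \<open>\<rho> j = 0\<close> would
    make the product vanish wherever the weight does; they are left out.\<close>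
  define A where "A = {j. j < L \<and> 0 < \<rho> j}"
  have finA: "finite A" by (simp add: A_def)
  define \<Phi> where "\<Phi> h = (\<Prod>j\<in>A. h j powr \<rho> j)" for h
  define S where "S = Sup (\<Phi> ` wball)"
  have bdd: "bdd_above (\<Phi> ` wball)"
  proof (rule bdd_aboveI2)
    fix h assume h: "h \<in> wball"
    show "\<Phi> h \<le> 1"
      unfolding \<Phi>_def by (intro prod_le_1) (use wballD(1)[OF h] wball_le1[OF h] \<rho> powr_le1 in auto)
  qed
  have "\<exists>h\<in>wball. S - inverse (real (Suc n)) < \<Phi> h" for n
    using less_cSup_iff[OF _ bdd, of "S - inverse (real (Suc n))"] wball_unit unfolding S_def by auto
  then obtain h where h: "\<And>n. h n \<in> wball" "\<And>n. S - inverse (real (Suc n)) < \<Phi> (h n)" by metis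
  obtain r h0 where rr: "strict_mono r" "h0 \<in> wball" "\<forall>j. (\<lambda>n. h (r n) j) \<longlonglongrightarrow> h0 j"
    using wball_compact[of h, OF h(1)] by blast
  note r = rr(1,2) rr(3)[rule_format]
  have lim: "(\<lambda>n. \<Phi> (h (r n))) \<longlonglongrightarrow> \<Phi> h0"
    unfolding \<Phi>_def
    by (intro tendsto_prod tendsto_powr2 r tendsto_const) (use wballD(1)[OF h(1)] in \<open>auto simp: A_def\<close>)
  have "(\<lambda>n. S - inverse (real (Suc n))) \<longlonglongrightarrow> S - 0" by (intro tendsto_diff tendsto_const LIMSEQ_inverse_real_of_nat)
  then have "(\<lambda>n. S - inverse (real (Suc (r n)))) \<longlonglongrightarrow> S" using LIMSEQ_subseq_LIMSEQ[OF _ r(1)] by (simp add: o_def)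
  then have "S \<le> \<Phi> h0" by (rule LIMSEQ_le[OF _ lim]) (use h(2) in \<open>auto intro: less_imp_le\<close>)
  then have max: "\<Phi> g \<le> \<Phi> h0" if "g \<in> wball" for g
    using cSup_upper[OF _ bdd, of "\<Phi> g"] that unfolding S_def by auto
  \<comment> \<open>The average of the first L unit vectors lies in the ball and makes the product
    positive, so the maximum is positive.\<close>
  define u where "u = (\<lambda>j. \<Sum>i<L. (1 / real L) * (\<lambda>l. if l = i then 1 else 0) j)"
  have "u \<in> wball" unfolding u_def by (rule wball_combine) (auto simp: wball_unit)
  moreover have "0 < \<Phi> u"
    unfolding \<Phi>_def
  proof (rule prod_pos)
    fix j assume "j \<in> A"
    then have jL: "j < L" by (simp add: A_def)
    have "u j = (\<Sum>i<L. if i = j then 1 / real L else 0)"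
      unfolding u_def by (intro sum.cong) auto
    with jL have "u j = 1 / real L" "0 < L" by auto
    then show "0 < u j powr \<rho> j" by simp
  qed
  ultimately have "0 < \<Phi> h0" using max by fastforce
  then have "\<Phi> h0 \<noteq> 0" by simp
  then have pos: "0 < h0 j" if "j \<in> A" for j
    using that finA wballD(1)[OF r(2), of j] by (auto simp: \<Phi>_def less_le)
  have "(\<Sum>j<L. \<rho> j * (g j / h0 j)) \<le> (\<Sum>j<L. \<rho> j)" if g: "g \<in> wball" for g
  proof -
    define a where "a j = g j / h0 j - 1" for j
    \<comment> \<open>The logarithm of the product along the segment from \<open>h0\<close> to g,
      relative to its value at \<open>h0\<close>. It is at most 0 for t in [0, 1) and vanishes at 0,
      so its derivative at 0 cannot be positive; this is the asserted trace inequality.\<close>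
    define f where "f t = (\<Sum>j\<in>A. \<rho> j * ln (1 + t * a j))" for t
    have f_le: "f t \<le> 0" if t: "0 \<le> t" "t < 1" for t
    proof -
      have p: "0 < 1 + t * a j" and eq: "(1 - t) * h0 j + t * g j = h0 j * (1 + t * a j)" if "j \<in> A" for j
      proof -
        have "0 < h0 j" by (rule pos[OF that])
        then show eq: "(1 - t) * h0 j + t * g j = h0 j * (1 + t * a j)" by (simp add: a_def field_simps)
        have "0 < (1 - t) * h0 j + t * g j" using \<open>0 < h0 j\<close> t wballD(1)[OF g, of j] by (intro add_pos_nonneg) auto
        then show "0 < 1 + t * a j" using eq \<open>0 < h0 j\<close> by (simp add: zero_less_mult_iff)
      qed
      have "\<Phi> (\<lambda>j. (1 - t) * h0 j + t * g j) \<le> \<Phi> h0" using t by (intro max wball_convex r g) auto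
      also have "\<Phi> (\<lambda>j. (1 - t) * h0 j + t * g j) = \<Phi> h0 * (\<Prod>j\<in>A. (1 + t * a j) powr \<rho> j)"
        unfolding \<Phi>_def prod.distrib[symmetric]
        by (rule prod.cong) (use eq p pos in \<open>auto simp: powr_mult less_imp_le\<close>)
      finally have "(\<Prod>j\<in>A. (1 + t * a j) powr \<rho> j) \<le> 1" using \<open>0 < \<Phi> h0\<close> by simp
      moreover have "(\<Prod>j\<in>A. (1 + t * a j) powr \<rho> j) = exp (f t)"
        unfolding f_def exp_sum[OF finA]
      proof (rule prod.cong)
        fix j assume "j \<in> A"
        then show "(1 + t * a j) powr \<rho> j = exp (\<rho> j * ln (1 + t * a j))" using p[of j] by (simp add: powr_def)
      qed simp
      ultimately show ?thesis by simp
    qed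
    have "(f has_real_derivative (\<Sum>j\<in>A. \<rho> j * a j)) (at 0)"
      unfolding f_def by (auto intro!: derivative_eq_intros sum.cong)
    then have "\<not> 0 < (\<Sum>j\<in>A. \<rho> j * a j)"
    proof (intro notI)
      assume D: "(f has_real_derivative (\<Sum>j\<in>A. \<rho> j * a j)) (at 0)" "0 < (\<Sum>j\<in>A. \<rho> j * a j)"
      obtain e where e: "0 < e" "\<And>t. 0 < t \<Longrightarrow> t < e \<Longrightarrow> f 0 < f (0 + t)"
        using DERIV_pos_inc_right[OF D] by blast
      have "f 0 = 0" by (simp add: f_def)
      moreover have "0 < min (e/2) (1/2)" "min (e/2) (1/2) < e" "min (e/2) (1/2) < 1" using e(1) by linarith+
      ultimately show False using e(2)[of "min (e/2) (1/2)"] f_le[of "min (e/2) (1/2)"] by simp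
    qed
    then have "(\<Sum>j\<in>A. \<rho> j * (g j / h0 j)) \<le> (\<Sum>j\<in>A. \<rho> j)"
      by (simp add: a_def algebra_simps sum_subtractf)
    moreover have "(\<Sum>j<L. \<rho> j * (g j / h0 j)) = (\<Sum>j\<in>A. \<rho> j * (g j / h0 j))" "(\<Sum>j<L. \<rho> j) = (\<Sum>j\<in>A. \<rho> j)"
      using \<rho> by (auto intro!: sum.mono_neutral_right simp: A_def less_le)
    ultimately show ?thesis by simp
  qed
  then show ?thesis using r(2) pos by (auto simp: A_def)
qed

text \<open>A coordinatewise limit of the maximizers for finitely many coordinates. The trace
  inequality itself keeps the maximizers away from 0 at each coordinate, uniformly, so the quotients
  pass to the limit.\<close>

lemma lozanovskii:
  assumes \<rho>: "\<And>j. 0 \<le> \<rho> j" "summable \<rho>"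
  obtains h0 where "h0 \<in> wball" "\<And>j. 0 < \<rho> j \<Longrightarrow> 0 < h0 j"
    "\<And>h L. h \<in> wball \<Longrightarrow> (\<Sum>j<L. \<rho> j * (h j / h0 j)) \<le> suminf \<rho>"
proof -
  have "\<forall>L. \<exists>h0\<in>wball. (\<forall>j<L. 0 < \<rho> j \<longrightarrow> 0 < h0 j) \<and>
           (\<forall>h\<in>wball. (\<Sum>j<L. \<rho> j * (h j / h0 j)) \<le> (\<Sum>j<L. \<rho> j))"
    using lozanovskii_finite[of \<rho>] \<rho> by blast
  then obtain k where k: "\<And>L. k L \<in> wball" "\<And>L j. j < L \<Longrightarrow> 0 < \<rho> j \<Longrightarrow> 0 < k L j"
    "\<And>L h. h \<in> wball \<Longrightarrow> (\<Sum>j<L. \<rho> j * (h j / k L j)) \<le> (\<Sum>j<L. \<rho> j)" by metis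
  obtain r h0 where rr: "strict_mono r" "h0 \<in> wball" "\<forall>j. (\<lambda>n. k (r n) j) \<longlonglongrightarrow> h0 j"
    using wball_compact[of k, OF k(1)] by blast
  note r = rr(1,2) rr(3)[rule_format]
  have le: "(\<Sum>j<L. \<rho> j * (h j / k M j)) \<le> suminf \<rho>" if "L \<le> M" "h \<in> wball" for L M h
  proof -
    have "(\<Sum>j<L. \<rho> j * (h j / k M j)) \<le> (\<Sum>j<M. \<rho> j * (h j / k M j))"
      using that \<rho> wballD(1)[OF k(1)] wballD(1)[OF that(2)] by (intro sum_mono2) auto
    also have "\<dots> \<le> (\<Sum>j<M. \<rho> j)" by (rule k(3)[OF that(2)])
    also have "\<dots> \<le> suminf \<rho>" using \<rho> by (intro sum_le_suminf) auto
    finally show ?thesis .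
  qed
  \<comment> \<open>Testing the trace inequality with a unit vector bounds \<open>k M j\<close>
    below independently of M.\<close>
  have low: "\<rho> j / suminf \<rho> \<le> k M j" if "j < M" "0 < \<rho> j" for j M
  proof -
    have "\<rho> j * (1 / k M j) = (\<Sum>i<Suc j. if i = j then \<rho> j * (1 / k M j) else 0)" by simp
    also have "\<dots> = (\<Sum>i<Suc j. \<rho> i * ((if i = j then 1 else 0) / k M i))" by (rule sum.cong) auto
    also have "\<dots> \<le> suminf \<rho>" using le[of "Suc j" M "\<lambda>i. if i = j then 1 else 0"] that wball_unit by simp
    finally have "\<rho> j \<le> suminf \<rho> * k M j" using k(2)[OF that] by (simp add: field_simps)
    moreover have "0 < suminf \<rho>" using suminf_pos_iff[OF \<rho>(2)] \<rho> that by auto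
    ultimately show ?thesis by (simp add: field_simps)
  qed
  have pos: "0 < h0 j" if "0 < \<rho> j" for j
  proof -
    have "0 < suminf \<rho>" using suminf_pos_iff[OF \<rho>(2)] \<rho> that by auto
    moreover have "\<rho> j / suminf \<rho> \<le> h0 j"
    proof (rule LIMSEQ_le_const[OF r(3)], intro exI allI impI)
      fix n assume "Suc j \<le> n"
      also have "n \<le> r n" using seq_suble[OF r(1)] .
      finally show "\<rho> j / suminf \<rho> \<le> k (r n) j" using low[of j "r n"] that by simp
    qed
    moreover have "0 < \<rho> j / suminf \<rho>" using that calculation by simp
    ultimately show ?thesis by linarith
  qed
  have "(\<Sum>j<L. \<rho> j * (h j / h0 j)) \<le> suminf \<rho>" if h: "h \<in> wball" for h L
  proof (rule LIMSEQ_le_const2)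
    show "(\<lambda>n. \<Sum>j<L. \<rho> j * (h j / k (r n) j)) \<longlonglongrightarrow> (\<Sum>j<L. \<rho> j * (h j / h0 j))"
    proof (rule tendsto_sum)
      fix j
      show "(\<lambda>n. \<rho> j * (h j / k (r n) j)) \<longlonglongrightarrow> \<rho> j * (h j / h0 j)"
      proof (cases "0 < \<rho> j")
        case True
        then show ?thesis using pos[OF True] by (intro tendsto_intros r) auto
      next
        case False
        then have "\<rho> j = 0" using \<rho>(1)[of j] by simp
        then show ?thesis by simp
      qed
    qed
    show "\<exists>N. \<forall>n\<ge>N. (\<Sum>j<L. \<rho> j * (h j / k (r n) j)) \<le> suminf \<rho>"
    proof (intro exI allI impI)
      fix n assume "L \<le> n"
      also have "n \<le> r n" using seq_suble[OF r(1)] .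
      finally show "(\<Sum>j<L. \<rho> j * (h j / k (r n) j)) \<le> suminf \<rho>" using le h by blast
    qed
  qed
  then show ?thesis using that r(2) pos by blast
qed

section \<open>Sequence spaces\<close>

lemma t2norm_trunc_le:
  assumes "0 \<le> s" "\<And>h. h \<in> tfuns \<Longrightarrow> (\<Sum>j<L. h j * (cmod (x j))\<^sup>2) \<le> s\<^sup>2"
  shows "t2norm (trunc L x) \<le> s"
proof (rule t2norm_le[of L])
  fix h assume "h \<in> tfuns"
  moreover have "(\<Sum>j<L. h j * (cmod (trunc L x j))\<^sup>2) = (\<Sum>j<L. h j * (cmod (x j))\<^sup>2)"
    by (rule sum.cong) (auto simp: trunc_def)
  ultimately show "(\<Sum>j<L. h j * (cmod (trunc L x j))\<^sup>2) \<le> s\<^sup>2" using assms(2) by simp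
qed (use assms in \<open>auto simp: trunc_ge\<close>)

lemma t2norm_trunc_ge:
  assumes "h \<in> tfuns"
  shows "(\<Sum>j<L. h j * (cmod (x j))\<^sup>2) \<le> (t2norm (trunc L x))\<^sup>2"
  using assms tfuns_wball wballD(2) by blast

lemma t2norm_trunc_mono:
  assumes "\<And>j. j < L \<Longrightarrow> cmod (y j) \<le> B * cmod (x j)" "0 \<le> B" "L \<le> L'"
  shows "t2norm (trunc L y) \<le> B * t2norm (trunc L' x)"
proof (rule t2norm_trunc_le)
  show "0 \<le> B * t2norm (trunc L' x)" using assms t2norm_trunc_nonneg by simp
next
  fix h assume h: "h \<in> tfuns"
  have "(\<Sum>j<L. h j * (cmod (y j))\<^sup>2) \<le> (\<Sum>j<L. h j * (B * cmod (x j))\<^sup>2)"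
    using assms tfuns_nonneg[OF h] by (intro sum_mono mult_left_mono power_mono) auto
  also have "\<dots> = B\<^sup>2 * (\<Sum>j<L. h j * (cmod (x j))\<^sup>2)"
    by (simp add: sum_distrib_left power_mult_distrib mult_ac)
  also have "\<dots> \<le> B\<^sup>2 * (\<Sum>j<L'. h j * (cmod (x j))\<^sup>2)"
    using assms tfuns_nonneg[OF h] by (intro mult_left_mono sum_mono2) auto
  also have "\<dots> \<le> B\<^sup>2 * (t2norm (trunc L' x))\<^sup>2" by (intro mult_left_mono t2norm_trunc_ge h) auto
  finally show "(\<Sum>j<L. h j * (cmod (y j))\<^sup>2) \<le> (B * t2norm (trunc L' x))\<^sup>2" by (simp add: power_mult_distrib)
qed

lemma t2norm_trunc_triangle:
  "t2norm (trunc L (\<lambda>j. x j + y j)) \<le> t2norm (trunc L x) + t2norm (trunc L y)"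
proof (rule t2norm_trunc_le)
  show "0 \<le> t2norm (trunc L x) + t2norm (trunc L y)" by (simp add: t2norm_trunc_nonneg)
next
  fix h assume h: "h \<in> tfuns"
  have L2: "L2_set (\<lambda>j. sqrt (h j) * cmod (z j)) {..<L} \<le> t2norm (trunc L z)" for z
  proof -
    have "L2_set (\<lambda>j. sqrt (h j) * cmod (z j)) {..<L} = sqrt (\<Sum>j<L. h j * (cmod (z j))\<^sup>2)"
      using tfuns_nonneg[OF h] by (simp add: L2_set_def power_mult_distrib)
    then show ?thesis using t2norm_trunc_ge[OF h, of z L] t2norm_trunc_nonneg[of L z] by (simp add: real_le_lsqrt)
  qed
  have "sqrt (\<Sum>j<L. h j * (cmod (x j + y j))\<^sup>2) = L2_set (\<lambda>j. sqrt (h j) * cmod (x j + y j)) {..<L}"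
    using tfuns_nonneg[OF h] by (simp add: L2_set_def power_mult_distrib)
  also have "\<dots> \<le> L2_set (\<lambda>j. sqrt (h j) * cmod (x j) + sqrt (h j) * cmod (y j)) {..<L}"
    using tfuns_nonneg[OF h] by (intro L2_set_mono) (auto simp: norm_triangle_ineq mult_left_mono simp flip: distrib_left)
  also have "\<dots> \<le> L2_set (\<lambda>j. sqrt (h j) * cmod (x j)) {..<L} + L2_set (\<lambda>j. sqrt (h j) * cmod (y j)) {..<L}"
    by (rule L2_set_triangle_ineq)
  also have "\<dots> \<le> t2norm (trunc L x) + t2norm (trunc L y)" by (intro add_mono L2)
  finally show "(\<Sum>j<L. h j * (cmod (x j + y j))\<^sup>2) \<le> (t2norm (trunc L x) + t2norm (trunc L y))\<^sup>2"
    by (rule sqrt_le_D)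
qed

lemma t2norm_interval:
  assumes "m \<le> n"
  shows "t2norm (\<lambda>j. trunc m x j - trunc n x j) = t2norm (trunc n (\<lambda>j. if m \<le> j then x j else 0))"
    "t2norm (\<lambda>j. trunc n x j - trunc m x j) = t2norm (trunc n (\<lambda>j. if m \<le> j then x j else 0))"
  unfolding t2norm_def using assms
  by (auto intro!: arg_cong[where f = sqrt] arg_cong[where f = tnorm] simp: trunc_def fun_eq_iff)

text \<open>The unit vectors form a boundedly complete basis: otherwise there are arbitrarily many
  consecutive blocks of norm at least \<open>e\<close>, and admissible families of them have unbounded sums.\<close>
lemma T2_I:
  assumes M: "\<And>L. t2norm (trunc L x) \<le> M"
  shows "x \<in> T2"
proof (rule ccontr)
  assume "x \<notin> T2"
  then obtain e where e: "0 < e" and ex: "\<And>N. \<exists>m\<ge>N. \<exists>n\<ge>N. e \<le> t2norm (\<lambda>j. trunc m x j - trunc n x j)"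
    unfolding T2_def by (auto simp: not_less)
  have "\<exists>E>N. \<exists>h\<in>tfuns. e\<^sup>2 / 2 \<le> (\<Sum>j\<in>{N..<E}. h j * (cmod (x j))\<^sup>2)" for N
  proof -
    obtain m n where mn: "N \<le> m" "m \<le> n" "e \<le> t2norm (trunc n (\<lambda>j. if m \<le> j then x j else 0))"
      using ex[of N] t2norm_interval by (metis nat_le_linear)
    have "\<exists>h\<in>tfuns. e\<^sup>2 / 2 < (\<Sum>j<n. h j * (cmod (if m \<le> j then x j else 0))\<^sup>2)"
    proof (rule ccontr)
      assume "\<not> ?thesis"
      then have "t2norm (trunc n (\<lambda>j. if m \<le> j then x j else 0)) \<le> sqrt (e\<^sup>2 / 2)"
        by (intro t2norm_trunc_le) (auto simp: not_less)
      also have "\<dots> < sqrt (e\<^sup>2)" using e by (intro real_sqrt_less_mono) simp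
      finally show False using mn e by simp
    qed
    then obtain h where h: "h \<in> tfuns" "e\<^sup>2 / 2 < (\<Sum>j<n. h j * (cmod (if m \<le> j then x j else 0))\<^sup>2)" by blast
    have "(\<Sum>j<n. h j * (cmod (if m \<le> j then x j else 0))\<^sup>2) = (\<Sum>j\<in>{m..<n}. h j * (cmod (x j))\<^sup>2)"
      by (rule sum.mono_neutral_cong_right) auto
    also have "\<dots> \<le> (\<Sum>j\<in>{N..<n}. h j * (cmod (x j))\<^sup>2)"
      using mn tfuns_nonneg[OF h(1)] by (intro sum_mono2) auto
    finally have *: "e\<^sup>2 / 2 \<le> (\<Sum>j\<in>{N..<n}. h j * (cmod (x j))\<^sup>2)" using h(2) by simp
    have "N < n"
    proof (rule ccontr)
      assume "\<not> N < n"
      then show False using * e by simp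
    qed
    then show ?thesis using * h(1) by blast
  qed
  then obtain E g where E: "\<And>N. N < E N" and g: "\<And>N. g N \<in> tfuns"
    and big: "\<And>N. e\<^sup>2 / 2 \<le> (\<Sum>j\<in>{N..<E N}. g N j * (cmod (x j))\<^sup>2)" by metis
  have "real k * (e\<^sup>2 / 4) \<le> M\<^sup>2" for k
  proof -
    \<comment> \<open>The chain of blocks begins at coordinate k, so that k consecutive blocks are
      admissible.\<close>
    define s where "s i = (E ^^ i) k" for i
    have s_Suc: "s (Suc i) = E (s i)" for i by (simp add: s_def)
    have s_less: "s i < s (Suc i)" for i using E by (simp add: s_Suc)
    define f where "f i = (\<lambda>j. if j \<in> {s i..<s (Suc i)} then g (s i) j else 0)" for i
    have "(\<lambda>j. (\<Sum>i<k. f i j) / 2) \<in> tfuns"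
    proof (rule tfuns_node[where A = "\<lambda>i. {s i..<s (Suc i)}"])
      have Min: "Min {s i..<s (Suc i)} = s i" for i using s_less[of i] by (intro Min_eqI) auto
      have "Max {s i..<s (Suc i)} < s (Suc i)" for i using s_less[of i] Max_in[of "{s i..<s (Suc i)}"] by auto
      then show "admissible k (\<lambda>i. {s i..<s (Suc i)})"
        unfolding admissible_def Min using s_less by (auto simp: s_def)
      show "f i \<in> tfuns" for i unfolding f_def by (rule tfuns_restrict) (rule g)
    qed (auto simp: f_def)
    from t2norm_trunc_ge[OF this, of x "s k"]
    have "(\<Sum>j<s k. (\<Sum>i<k. f i j) / 2 * (cmod (x j))\<^sup>2) \<le> (t2norm (trunc (s k) x))\<^sup>2" .
    also have "\<dots> \<le> M\<^sup>2" using M t2norm_trunc_nonneg by (intro power_mono) auto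
    also have "(\<Sum>j<s k. (\<Sum>i<k. f i j) / 2 * (cmod (x j))\<^sup>2) = (\<Sum>i<k. (\<Sum>j<s k. f i j * (cmod (x j))\<^sup>2)) / 2"
      by (simp add: sum_distrib_right sum_divide_distrib sum.swap[of _ "{..<k}"])
    finally have "(\<Sum>i<k. (\<Sum>j<s k. f i j * (cmod (x j))\<^sup>2)) \<le> 2 * M\<^sup>2" by simp
    moreover have "e\<^sup>2 / 2 \<le> (\<Sum>j<s k. f i j * (cmod (x j))\<^sup>2)" if "i < k" for i
    proof -
      have "s (Suc i) \<le> s k" using lift_Suc_mono_le[of s "Suc i" k] s_less that by (simp add: less_imp_le)
      then have "(\<Sum>j<s k. f i j * (cmod (x j))\<^sup>2) = (\<Sum>j\<in>{s i..<E (s i)}. g (s i) j * (cmod (x j))\<^sup>2)"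
        by (intro sum.mono_neutral_cong_right) (auto simp: f_def s_Suc)
      then show ?thesis using big by simp
    qed
    then have "(\<Sum>i<k. e\<^sup>2 / 2) \<le> (\<Sum>i<k. (\<Sum>j<s k. f i j * (cmod (x j))\<^sup>2))" by (intro sum_mono) auto
    ultimately show ?thesis by simp
  qed
  moreover obtain k :: nat where "M\<^sup>2 / (e\<^sup>2 / 4) < real k" using reals_Archimedean2 by blast
  then have "M\<^sup>2 < real k * (e\<^sup>2 / 4)" using e by (simp add: field_simps)
  ultimately show False by (meson not_less)
qed

lemma T2_bounded:
  assumes "x \<in> T2"
  shows "\<exists>M. \<forall>L. t2norm (trunc L x) \<le> M"
proof -
  obtain N where N': "\<forall>m\<ge>N. \<forall>n\<ge>N. t2norm (\<lambda>j. trunc m x j - trunc n x j) < 1"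
    using assms unfolding T2_def mem_Collect_eq by (elim allE[of _ 1]) auto
  note N = N'[rule_format]
  have "t2norm (trunc L x) \<le> t2norm (trunc N x) + 1" for L
  proof (cases "L \<le> N")
    case True
    then show ?thesis using t2norm_trunc_mono[of L x 1 x N] by simp
  next
    case False
    have "trunc L x = trunc L (\<lambda>j. trunc N x j + (if N \<le> j then x j else 0))" by (auto simp: trunc_def)
    then have "t2norm (trunc L x) \<le> t2norm (trunc L (trunc N x)) + t2norm (trunc L (\<lambda>j. if N \<le> j then x j else 0))"
      using t2norm_trunc_triangle[of L "trunc N x" "\<lambda>j. if N \<le> j then x j else 0"] by simp
    moreover have "trunc L (trunc N x) = trunc N x" using False by (auto simp: trunc_def)
    ultimately show ?thesis using N[of L N] t2norm_interval(2)[of N L x] False by simp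
  qed
  then show ?thesis by blast
qed

lemma T2N_LIMSEQ:
  assumes "x \<in> T2"
  shows "(\<lambda>L. t2norm (trunc L x)) \<longlonglongrightarrow> T2N x" "t2norm (trunc L x) \<le> T2N x"
proof -
  obtain M where M: "\<And>L. t2norm (trunc L x) \<le> M" using T2_bounded[OF assms] by blast
  have inc: "incseq (\<lambda>L. t2norm (trunc L x))"
    by (rule incseq_SucI) (use t2norm_trunc_mono[of _ x 1 x] in simp)
  have "convergent (\<lambda>L. t2norm (trunc L x))"
    using incseq_convergent[OF inc, of M] M by (metis convergent_def)
  then show lim: "(\<lambda>L. t2norm (trunc L x)) \<longlonglongrightarrow> T2N x" by (simp add: convergent_LIMSEQ_iff T2N_def)
  show "t2norm (trunc L x) \<le> T2N x" by (rule incseq_le[OF inc lim])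
qed

lemma T2N_le:
  assumes "\<And>L. t2norm (trunc L x) \<le> M"
  shows "x \<in> T2" "T2N x \<le> M"
proof -
  show x: "x \<in> T2" by (rule T2_I) (rule assms)
  show "T2N x \<le> M" by (rule LIMSEQ_le_const2[OF T2N_LIMSEQ(1)[OF x]]) (use assms in auto)
qed

lemma T2N_ge:
  assumes "x \<in> T2" "h \<in> wball"
  shows "(\<Sum>j<L. h j * (cmod (x j))\<^sup>2) \<le> (T2N x)\<^sup>2"
  using wballD(2)[OF assms(2), of x L] power_mono[OF T2N_LIMSEQ(2)[OF assms(1), of L] t2norm_trunc_nonneg, of 2]
  by linarith

lemma T2N_weights:
  assumes "0 \<le> M" "\<And>L h. h \<in> tfuns \<Longrightarrow> (\<Sum>j<L. h j * (cmod (x j))\<^sup>2) \<le> M\<^sup>2"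
  shows "x \<in> T2" "T2N x \<le> M"
  using T2N_le[of x M] t2norm_trunc_le[of M] assms by auto

lemma T2_tail:
  assumes "x \<in> T2"
  shows "(\<lambda>n. T2N (\<lambda>j. if n \<le> j then x j else 0)) \<longlonglongrightarrow> 0"
proof (rule LIMSEQ_I)
  fix e :: real assume e: "0 < e"
  obtain N where N': "\<forall>m\<ge>N. \<forall>n\<ge>N. t2norm (\<lambda>j. trunc m x j - trunc n x j) < e / 2"
    using assms e unfolding T2_def mem_Collect_eq by (elim allE[of _ "e / 2"]) auto
  note N = N'[rule_format]
  have "norm (T2N (\<lambda>j. if n \<le> j then x j else 0) - 0) < e" if "N \<le> n" for n
  proof -
    have le: "t2norm (trunc L (\<lambda>j. if n \<le> j then x j else 0)) \<le> e / 2" for L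
    proof -
      have "t2norm (trunc L (\<lambda>j. if n \<le> j then x j else 0)) \<le> 1 * t2norm (trunc (max L n) (\<lambda>j. if n \<le> j then x j else 0))"
        by (rule t2norm_trunc_mono) auto
      also have "\<dots> \<le> e / 2" using N[of "max L n" n] t2norm_interval(2)[of n "max L n" x] that by linarith
      finally show ?thesis .
    qed
    have mem: "(\<lambda>j. if n \<le> j then x j else 0) \<in> T2" by (rule T2N_le(1)) (rule le)
    have "0 \<le> T2N (\<lambda>j. if n \<le> j then x j else 0)"
      using T2N_LIMSEQ(2)[OF mem, of 0] t2norm_trunc_nonneg[of 0] by (meson order_trans)
    then show ?thesis using T2N_le(2)[OF le] e by simp
  qed
  then show "\<exists>N. \<forall>n\<ge>N. norm (T2N (\<lambda>j. if n \<le> j then x j else 0) - 0) < e" by blast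
qed

section \<open>The dual norm and the common axioms of the two spaces\<close>

lemma T2D_ge:
  assumes "y \<in> T2D"
  shows "cmod (\<Sum>j<n. x j * y j) \<le> T2DN y * t2norm (trunc n x)"
proof (cases "t2norm (trunc n x) = 0")
  case True
  then have "x j = 0" if "j < n" for j using t2norm_coord[OF that, of x] by simp
  then show ?thesis using True by simp
next
  case False
  define t where "t = t2norm (trunc n x)"
  have t: "0 < t" using False t2norm_trunc_nonneg[of n x] by (simp add: t_def)
  define z where "z = trunc n (\<lambda>j. x j / of_real t)"
  have "t2norm z \<le> inverse t * t2norm (trunc n x)"
    unfolding z_def by (rule t2norm_trunc_mono) (use t in \<open>auto simp: norm_divide field_simps\<close>)
  then have "t2norm z \<le> 1" using t by (simp add: t_def)
  moreover have "\<forall>j\<ge>n. z j = 0" by (simp add: z_def trunc_def)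
  ultimately have "cmod (\<Sum>j<n. z j * y j) \<in> dual_vals y"
    unfolding dual_vals_def mem_Collect_eq by (intro exI[of _ z] exI[of _ n]) simp
  then have "cmod (\<Sum>j<n. z j * y j) \<le> T2DN y"
    using assms unfolding T2DN_def T2D_def by (auto intro: cSup_upper)
  moreover have "(\<Sum>j<n. z j * y j) = (\<Sum>j<n. x j * y j) / of_real t"
    unfolding sum_divide_distrib by (rule sum.cong) (auto simp: z_def trunc_def)
  ultimately show ?thesis using t by (simp add: norm_divide t_def field_simps)
qed

lemma T2D_le:
  assumes "0 \<le> M" "\<And>n x. cmod (\<Sum>j<n. x j * y j) \<le> M * t2norm (trunc n x)"
  shows "y \<in> T2D" "T2DN y \<le> M"
proof -
  have le: "v \<le> M" if "v \<in> dual_vals y" for v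
  proof -
    have "\<exists>x n. v = cmod (\<Sum>j<n. x j * y j) \<and> (\<forall>j\<ge>n. x j = 0) \<and> t2norm x \<le> 1"
      using that by (simp only: dual_vals_def mem_Collect_eq)
    then obtain x n where x: "v = cmod (\<Sum>j<n. x j * y j)" "\<forall>j\<ge>n. x j = 0" "t2norm x \<le> 1"
      by (elim exE conjE)
    have "trunc n x = x" using x(2) by (auto simp: trunc_def)
    then have "v \<le> M * t2norm x" using assms(2)[where x = x and n = n] x(1) by simp
    also have "\<dots> \<le> M" using x(3) assms(1) mult_left_le by blast
    finally show ?thesis .
  qed
  then show "y \<in> T2D" unfolding T2D_def by (auto intro!: bdd_aboveI)
  have "t2norm (\<lambda>_. 0) \<le> 1" by (rule t2norm_le[of 0]) auto
  then have "cmod (\<Sum>j<0. 0 * y j) \<in> dual_vals y"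
    unfolding dual_vals_def mem_Collect_eq by (intro exI[of _ "\<lambda>_. 0"] exI[of _ "0::nat"]) simp
  then show "T2DN y \<le> M" unfolding T2DN_def using le by (intro cSup_least) auto
qed

text \<open>What the interpolation argument needs from T2 and from its dual alike. The Fatou
  property takes the place of completeness: coordinatewise limits stay in the space with the same
  bound. For T2 it rests on bounded completeness of the basis.\<close>

locale seqspace =
  fixes X :: "seq set" and N :: "seq \<Rightarrow> real"
  assumes zero: "(\<lambda>_. 0) \<in> X"
    and coord: "x \<in> X \<Longrightarrow> cmod (x j) \<le> N x"
    and add: "x \<in> X \<Longrightarrow> y \<in> X \<Longrightarrow> (\<lambda>j. x j + y j) \<in> X \<and> N (\<lambda>j. x j + y j) \<le> N x + N y"
    and solid: "x \<in> X \<Longrightarrow> 0 \<le> B \<Longrightarrow> (\<And>j. cmod (y j) \<le> B * cmod (x j)) \<Longrightarrow> y \<in> X \<and> N y \<le> B * N x"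
    and fatou: "(\<And>n::nat. xs n \<in> X) \<Longrightarrow> (\<And>n. N (xs n) \<le> M) \<Longrightarrow> (\<And>j. (\<lambda>n. xs n j) \<longlonglongrightarrow> y j) \<Longrightarrow> y \<in> X \<and> N y \<le> M"
begin

lemma nonneg: "x \<in> X \<Longrightarrow> 0 \<le> N x"
  using coord[of x 0] norm_ge_zero[of "x 0"] by linarith

lemma N_zero: "N (\<lambda>_. 0) = 0"
  using solid[OF zero, of 0 "\<lambda>_. 0"] nonneg[OF zero] by simp

lemma scale: "x \<in> X \<Longrightarrow> (\<lambda>j. c * x j) \<in> X \<and> N (\<lambda>j. c * x j) \<le> cmod c * N x"
  by (rule solid) (auto simp: norm_mult)

lemma diff: "x \<in> X \<Longrightarrow> y \<in> X \<Longrightarrow> (\<lambda>j. x j - y j) \<in> X \<and> N (\<lambda>j. x j - y j) \<le> N x + N y"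
  using scale[of y "-1"] add[of x "\<lambda>j. - y j"] by simp

end

interpretation T2: seqspace T2 T2N
proof
  show "(\<lambda>_. 0) \<in> T2" by (rule T2N_weights(1)[of 0]) auto
next
  fix x j assume "x \<in> T2"
  then show "cmod (x j) \<le> T2N x" using t2norm_coord[of j "Suc j" x] T2N_LIMSEQ(2)[of x "Suc j"] by simp
next
  fix x y assume xy: "x \<in> T2" "y \<in> T2"
  have "t2norm (trunc L (\<lambda>j. x j + y j)) \<le> T2N x + T2N y" for L
    using t2norm_trunc_triangle[of L x y] T2N_LIMSEQ(2)[OF xy(1), of L] T2N_LIMSEQ(2)[OF xy(2), of L] by linarith
  then show "(\<lambda>j. x j + y j) \<in> T2 \<and> T2N (\<lambda>j. x j + y j) \<le> T2N x + T2N y" using T2N_le by blast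
next
  fix x y and B :: real assume x: "x \<in> T2" and B: "0 \<le> B" "\<And>j. cmod (y j) \<le> B * cmod (x j)"
  have "t2norm (trunc L y) \<le> B * T2N x" for L
    using t2norm_trunc_mono[of L y B x L, OF B(2) B(1) order_refl] mult_left_mono[OF T2N_LIMSEQ(2)[OF x, of L] B(1)]
    by linarith
  then show "y \<in> T2 \<and> T2N y \<le> B * T2N x" using T2N_le by blast
next
  fix x y and M :: real
  assume x: "\<And>n::nat. x n \<in> T2" "\<And>n. T2N (x n) \<le> M" "\<And>j. (\<lambda>n. x n j) \<longlonglongrightarrow> y j"
  have M: "0 \<le> M" using x(2)[of 0] T2N_LIMSEQ(2)[OF x(1)[of 0], of 0] t2norm_trunc_nonneg[of 0 "x 0"] by linarith
  have "(\<Sum>j<L. h j * (cmod (y j))\<^sup>2) \<le> M\<^sup>2" if h: "h \<in> tfuns" for L h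
  proof (rule LIMSEQ_le_const2[where X = "\<lambda>n. \<Sum>j<L. h j * (cmod (x n j))\<^sup>2"])
    show "(\<lambda>n. \<Sum>j<L. h j * (cmod (x n j))\<^sup>2) \<longlonglongrightarrow> (\<Sum>j<L. h j * (cmod (y j))\<^sup>2)"
      by (intro tendsto_intros x)
    have "(\<Sum>j<L. h j * (cmod (x n j))\<^sup>2) \<le> M\<^sup>2" for n
    proof -
      have "(\<Sum>j<L. h j * (cmod (x n j))\<^sup>2) \<le> (T2N (x n))\<^sup>2" using T2N_ge[OF x(1)] h tfuns_wball by blast
      moreover have "0 \<le> T2N (x n)"
        using T2N_LIMSEQ(2)[OF x(1)[of n], of 0] t2norm_trunc_nonneg[of 0 "x n"] by linarith
      ultimately show ?thesis using x(2)[of n] by (meson order_trans power_mono)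
    qed
    then show "\<exists>N. \<forall>n\<ge>N. (\<Sum>j<L. h j * (cmod (x n j))\<^sup>2) \<le> M\<^sup>2" by blast
  qed
  then show "y \<in> T2 \<and> T2N y \<le> M" using T2N_weights[OF M] by blast
qed

interpretation T2D: seqspace T2D T2DN
proof
  have nonneg: "0 \<le> T2DN y" if "y \<in> T2D" for y
  proof -
    have "cmod (\<Sum>j<1. (1::complex) * y j) \<le> T2DN y * t2norm (trunc 1 (\<lambda>_. 1))" by (rule T2D_ge[OF that])
    moreover have "0 < t2norm (trunc 1 (\<lambda>_. 1))" using t2norm_coord[of 0 1 "\<lambda>_. 1"] by simp
    ultimately show ?thesis by (metis norm_ge_zero order_trans zero_le_mult_iff linorder_not_less)
  qed
  {
    show "(\<lambda>_. 0) \<in> T2D" by (rule T2D_le(1)[of 0]) auto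
  next
    fix y j assume y: "y \<in> T2D"
    define e where "e = (\<lambda>i::nat. if i = j then 1 else (0::complex))"
    have "(\<Sum>i<Suc j. e i * y i) = (\<Sum>i<Suc j. if i = j then y j else 0)"
      by (rule sum.cong) (auto simp: e_def)
    then have "cmod (y j) \<le> T2DN y * t2norm (trunc (Suc j) e)" using T2D_ge[OF y, of e "Suc j"] by simp
    also have "t2norm (trunc (Suc j) e) \<le> 1"
    proof (rule t2norm_trunc_le)
      fix h assume h: "h \<in> tfuns"
      have "(\<Sum>i<Suc j. h i * (cmod (e i))\<^sup>2) = (\<Sum>i<Suc j. if i = j then h j else 0)"
        by (rule sum.cong) (auto simp: e_def)
      then show "(\<Sum>i<Suc j. h i * (cmod (e i))\<^sup>2) \<le> 1\<^sup>2" using tfuns_le1[OF h] by simp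
    qed simp
    then have "T2DN y * t2norm (trunc (Suc j) e) \<le> T2DN y" using nonneg[OF y] by (simp add: mult_left_le)
    finally show "cmod (y j) \<le> T2DN y" .
  next
    fix x y assume xy: "x \<in> T2D" "y \<in> T2D"
    have "cmod (\<Sum>j<n. z j * (x j + y j)) \<le> (T2DN x + T2DN y) * t2norm (trunc n z)" for n z
      using norm_triangle_ineq[of "\<Sum>j<n. z j * x j" "\<Sum>j<n. z j * y j"]
        T2D_ge[OF xy(1), of z n] T2D_ge[OF xy(2), of z n]
      by (simp add: distrib_left distrib_right sum.distrib)
    then show "(\<lambda>j. x j + y j) \<in> T2D \<and> T2DN (\<lambda>j. x j + y j) \<le> T2DN x + T2DN y"
      using T2D_le[of "T2DN x + T2DN y" "\<lambda>j. x j + y j"] nonneg xy by fastforce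
  next
    fix x y and B :: real assume x: "x \<in> T2D" and B: "0 \<le> B" "\<And>j. cmod (y j) \<le> B * cmod (x j)"
    have "cmod (\<Sum>j<n. z j * y j) \<le> B * T2DN x * t2norm (trunc n z)" for n z
    proof -
      \<comment> \<open>The quotient y / x, bounded by B, is moved onto the test vector, where
        solidity of the norm of T2 absorbs it.\<close>
      define w where "w j = (if x j = 0 then 0 else z j * y j / x j)" for j
      have "(\<Sum>j<n. z j * y j) = (\<Sum>j<n. w j * x j)"
      proof (rule sum.cong)
        fix j
        show "z j * y j = w j * x j" using B(2)[of j] by (cases "x j = 0") (auto simp: w_def)
      qed simp
      also have "cmod \<dots> \<le> T2DN x * t2norm (trunc n w)" by (rule T2D_ge[OF x])
      also have "\<dots> \<le> T2DN x * (B * t2norm (trunc n z))"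
      proof (intro mult_left_mono t2norm_trunc_mono nonneg x B order_refl)
        fix j
        show "cmod (w j) \<le> B * cmod (z j)"
        proof (cases "x j = 0")
          case False
          then have "cmod (z j) * cmod (y j) \<le> cmod (z j) * (B * cmod (x j))" using B(2) by (intro mult_left_mono) auto
          then show ?thesis using False by (simp add: w_def norm_mult norm_divide field_simps)
        qed (use B in \<open>simp add: w_def\<close>)
      qed
      finally show ?thesis by (simp add: mult_ac)
    qed
    then show "y \<in> T2D \<and> T2DN y \<le> B * T2DN x"
      using T2D_le[of "B * T2DN x" y] nonneg[OF x] B(1) by simp
  next
    fix x y and M :: real
    assume x: "\<And>n::nat. x n \<in> T2D" "\<And>n. T2DN (x n) \<le> M" "\<And>j. (\<lambda>n. x n j) \<longlonglongrightarrow> y j"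
    have M: "0 \<le> M" using x(2)[of 0] nonneg[OF x(1)[of 0]] by simp
    have "cmod (\<Sum>j<n. z j * y j) \<le> M * t2norm (trunc n z)" for n z
    proof (rule LIMSEQ_le_const2[where X = "\<lambda>k. cmod (\<Sum>j<n. z j * x k j)"])
      show "(\<lambda>k. cmod (\<Sum>j<n. z j * x k j)) \<longlonglongrightarrow> cmod (\<Sum>j<n. z j * y j)" by (intro tendsto_intros x)
      have "cmod (\<Sum>j<n. z j * x k j) \<le> M * t2norm (trunc n z)" for k
        using T2D_ge[OF x(1), of z k n] mult_right_mono[OF x(2)[of k] t2norm_trunc_nonneg[of n z]] by linarith
      then show "\<exists>N. \<forall>k\<ge>N. cmod (\<Sum>j<n. z j * x k j) \<le> M * t2norm (trunc n z)" by blast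
    qed
    then show "y \<in> T2D \<and> T2DN y \<le> M" using T2D_le[OF M] by blast
  }
qed

text \<open>Cauchy-Schwarz: a test vector multiplied by sqrt h has l_2 norm at most its norm in T2,
  because h is in the weight ball.\<close>

lemma T2D_weight:
  assumes h: "h \<in> wball" and v: "\<And>L. (\<Sum>j<L. (cmod (v j))\<^sup>2) \<le> M\<^sup>2" and M: "0 \<le> M"
  shows "(\<lambda>j. v j * of_real (sqrt (h j))) \<in> T2D" "T2DN (\<lambda>j. v j * of_real (sqrt (h j))) \<le> M"
proof -
  have "cmod (\<Sum>j<n. x j * (v j * of_real (sqrt (h j)))) \<le> M * t2norm (trunc n x)" for n x
  proof -
    have "cmod (\<Sum>j<n. x j * (v j * of_real (sqrt (h j)))) \<le> (\<Sum>j<n. cmod (v j) * (sqrt (h j) * cmod (x j)))"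
      by (rule sum_norm_le) (use wballD(1)[OF h] in \<open>auto simp: norm_mult\<close>)
    also have "\<dots> \<le> L2_set (\<lambda>j. cmod (v j)) {..<n} * L2_set (\<lambda>j. sqrt (h j) * cmod (x j)) {..<n}"
      using L2_set_mult_ineq[of "\<lambda>j. cmod (v j)" "\<lambda>j. sqrt (h j) * cmod (x j)" "{..<n}"] wballD(1)[OF h]
      by (simp add: abs_mult)
    also have "\<dots> \<le> M * t2norm (trunc n x)"
    proof (intro mult_mono)
      show "L2_set (\<lambda>j. cmod (v j)) {..<n} \<le> M" unfolding L2_set_def using v M by (intro real_le_lsqrt) (auto simp: sum_nonneg)
      have "L2_set (\<lambda>j. sqrt (h j) * cmod (x j)) {..<n} = sqrt (\<Sum>j<n. h j * (cmod (x j))\<^sup>2)"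
        using wballD(1)[OF h] by (simp add: L2_set_def power_mult_distrib)
      then show "L2_set (\<lambda>j. sqrt (h j) * cmod (x j)) {..<n} \<le> t2norm (trunc n x)"
        using wballD(2)[OF h, of x n] t2norm_trunc_nonneg[of n x] by (simp add: real_le_lsqrt)
    qed (use M in \<open>auto simp: L2_set_def sum_nonneg\<close>)
    finally show ?thesis .
  qed
  then show "(\<lambda>j. v j * of_real (sqrt (h j))) \<in> T2D" "T2DN (\<lambda>j. v j * of_real (sqrt (h j))) \<le> M"
    by (rule T2D_le[OF M])+
qed

section \<open>Analytic functions on the strip\<close>

abbreviation ostrip :: "complex set" where
  "ostrip \<equiv> {z. 0 < Re z \<and> Re z < 1}"

lemma open_ostrip: "open ostrip"
  using open_halfspace_Re_gt[of 0] open_halfspace_Re_lt[of 1] by (simp add: Collect_conj_eq open_Int)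

lemma ostrip_strip: "ostrip \<subseteq> strip" by (auto simp: strip_def)

lemma half_ostrip: "1/2 \<in> ostrip" by simp

lemma cball_half: "cball (1/2) (1/2) \<subseteq> strip" "ball (1/2) (1/2) \<subseteq> ostrip"
proof -
  have *: "\<bar>Re z - 1/2\<bar> \<le> dist (1/2) z" for z
    using abs_Re_le_cmod[of "z - 1/2"] by (simp add: dist_norm norm_minus_commute)
  show "cball (1/2) (1/2) \<subseteq> strip"
  proof
    fix z :: complex assume "z \<in> cball (1/2) (1/2)"
    then show "z \<in> strip" using *[of z] unfolding strip_def mem_cball mem_Collect_eq by linarith
  qed
  show "ball (1/2) (1/2) \<subseteq> ostrip"
  proof
    fix z :: complex assume "z \<in> ball (1/2) (1/2)"
    then show "z \<in> ostrip" using *[of z] unfolding mem_ball mem_Collect_eq by linarith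
  qed
qed

text \<open>Phragmen-Lindelof: exp (\<epsilon> (w^2 - 1)) has modulus at most 1 on the strip and
  decays with |Im w|, so the maximum principle applies on a tall rectangle; then \<epsilon> tends to
  0.\<close>

lemma three_lines:
  assumes cont: "continuous_on strip \<phi>" and bdd: "bounded (\<phi> ` strip)" and hol: "\<phi> holomorphic_on ostrip"
    and M0: "\<And>t. cmod (\<phi> (\<i> * of_real t)) \<le> M" and M1: "\<And>t. cmod (\<phi> (1 + \<i> * of_real t)) \<le> M"
    and z: "z \<in> strip"
  shows "cmod (\<phi> z) \<le> M"
proof -
  have M: "0 \<le> M" using M0[of 0] norm_ge_zero order_trans by blast
  obtain B where B: "0 < B" "\<And>z. z \<in> strip \<Longrightarrow> cmod (\<phi> z) \<le> B"
    using bdd unfolding bounded_pos by auto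
  have key: "cmod (\<phi> z) \<le> (M + \<epsilon>) * exp (\<epsilon> * (1 + (Im z)\<^sup>2))" if \<epsilon>: "0 < \<epsilon>" for \<epsilon>
  proof -
    define \<psi> where "\<psi> w = \<phi> w * exp (of_real \<epsilon> * (w\<^sup>2 - 1))" for w
    have mod: "cmod (exp (of_real \<epsilon> * (w\<^sup>2 - 1))) = exp (\<epsilon> * ((Re w)\<^sup>2 - (Im w)\<^sup>2 - 1))" for w
      by (simp add: norm_exp_eq_Re power2_eq_square)
    have mod_le: "cmod (exp (of_real \<epsilon> * (w\<^sup>2 - 1))) \<le> exp (- \<epsilon> * (Im w)\<^sup>2)" if "w \<in> strip" for w
    proof -
      have "(Re w)\<^sup>2 \<le> 1" using that by (intro power_le_one) (auto simp: strip_def)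
      then have "\<epsilon> * ((Re w)\<^sup>2 - (Im w)\<^sup>2 - 1) \<le> \<epsilon> * (- (Im w)\<^sup>2)" using \<epsilon> by (intro mult_left_mono) auto
      then show ?thesis unfolding mod by simp
    qed
    \<comment> \<open>The height is chosen so that B exp (- \<epsilon> R^2) \<le> \<epsilon>, by way
      of x \<le> exp x, which controls the two horizontal sides.\<close>
    define R where "R = max (\<bar>Im z\<bar>) (sqrt (B / \<epsilon>\<^sup>2))"
    have R: "\<bar>Im z\<bar> \<le> R" "0 < R" "B / \<epsilon>\<^sup>2 \<le> R\<^sup>2"
      using B \<epsilon> real_sqrt_gt_zero[of "B / \<epsilon>\<^sup>2"] by (auto simp: R_def less_max_iff_disj intro: sqrt_le_D)
    have far: "B * exp (- \<epsilon> * R\<^sup>2) \<le> \<epsilon>"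
    proof -
      have "B \<le> \<epsilon> * (\<epsilon> * R\<^sup>2)" using R(3) \<epsilon> by (simp add: field_simps power2_eq_square)
      also have "\<dots> \<le> \<epsilon> * exp (\<epsilon> * R\<^sup>2)"
        using exp_ge_add_one_self[of "\<epsilon> * R\<^sup>2"] \<epsilon> by (intro mult_left_mono) linarith+
      finally show ?thesis by (simp add: exp_minus field_simps)
    qed
    define S where "S = cbox (Complex 0 (- R)) (Complex 1 R)"
    have S: "w \<in> S \<longleftrightarrow> 0 \<le> Re w \<and> Re w \<le> 1 \<and> - R \<le> Im w \<and> Im w \<le> R" for w
      by (auto simp: S_def in_cbox_complex_iff)
    have int: "interior S = box (Complex 0 (- R)) (Complex 1 R)" by (simp add: S_def interior_cbox)
    have "cmod (\<psi> z) \<le> M + \<epsilon>"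
    proof (rule maximum_modulus_frontier[of \<psi> S])
      show "\<psi> holomorphic_on interior S"
        unfolding \<psi>_def using hol
        by (auto intro!: holomorphic_intros elim: holomorphic_on_subset simp: int in_box_complex_iff)
      have "closure S = S" by (simp add: S_def)
      moreover have "continuous_on S \<phi>" by (rule continuous_on_subset[OF cont]) (auto simp: S strip_def)
      ultimately show "continuous_on (closure S) \<psi>"
        unfolding \<psi>_def by (auto intro!: continuous_intros)
      show "bounded S" by (simp add: S_def bounded_cbox)
      show "z \<in> S" using z R by (auto simp: S strip_def)
      fix w assume w: "w \<in> frontier S"
      then have wS: "w \<in> S" "w \<notin> interior S" by (auto simp: frontier_def S_def)
      then have ws: "w \<in> strip" by (auto simp: S strip_def)
      have le1: "exp (- \<epsilon> * (Im w)\<^sup>2) \<le> 1" using \<epsilon> by simp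
      consider "Re w = 0" | "Re w = 1" | "\<bar>Im w\<bar> = R"
        using wS S[of w] by (auto simp: int in_box_complex_iff)
      then show "cmod (\<psi> w) \<le> M + \<epsilon>"
      proof cases
        case 1
        then have "w = \<i> * of_real (Im w)" by (simp add: complex_eq_iff)
        then have "cmod (\<phi> w) \<le> M" using M0 by metis
        then have "cmod (\<phi> w) * cmod (exp (of_real \<epsilon> * (w\<^sup>2 - 1))) \<le> M * 1"
          using mod_le[OF ws] le1 M by (intro mult_mono) auto
        then show ?thesis using \<epsilon> by (simp add: \<psi>_def norm_mult)
      next
        case 2
        then have "w = 1 + \<i> * of_real (Im w)" by (simp add: complex_eq_iff)
        then have "cmod (\<phi> w) \<le> M" using M1 by metis
        then have "cmod (\<phi> w) * cmod (exp (of_real \<epsilon> * (w\<^sup>2 - 1))) \<le> M * 1"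
          using mod_le[OF ws] le1 M by (intro mult_mono) auto
        then show ?thesis using \<epsilon> by (simp add: \<psi>_def norm_mult)
      next
        case 3
        then have "(Im w)\<^sup>2 = R\<^sup>2" by (metis power2_abs)
        then have "cmod (\<phi> w) * cmod (exp (of_real \<epsilon> * (w\<^sup>2 - 1))) \<le> B * exp (- \<epsilon> * R\<^sup>2)"
          using mod_le[OF ws] B(2)[OF ws] B(1) by (intro mult_mono) auto
        then show ?thesis using far M by (simp add: \<psi>_def norm_mult)
      qed
    qed
    have "\<phi> z = \<psi> z * exp (- (of_real \<epsilon> * (z\<^sup>2 - 1)))" by (simp add: \<psi>_def exp_minus)
    then have "cmod (\<phi> z) = cmod (\<psi> z) * exp (- (\<epsilon> * ((Re z)\<^sup>2 - (Im z)\<^sup>2 - 1)))"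
      by (simp add: norm_mult norm_exp_eq_Re power2_eq_square)
    also have "\<dots> \<le> (M + \<epsilon>) * exp (\<epsilon> * (1 + (Im z)\<^sup>2))"
    proof (intro mult_mono)
      have "0 \<le> (Re z)\<^sup>2" by simp
      then have "- ((Re z)\<^sup>2 - (Im z)\<^sup>2 - 1) \<le> 1 + (Im z)\<^sup>2" by linarith
      then have "\<epsilon> * - ((Re z)\<^sup>2 - (Im z)\<^sup>2 - 1) \<le> \<epsilon> * (1 + (Im z)\<^sup>2)" using \<epsilon> by (intro mult_left_mono) auto
      then show "exp (- (\<epsilon> * ((Re z)\<^sup>2 - (Im z)\<^sup>2 - 1))) \<le> exp (\<epsilon> * (1 + (Im z)\<^sup>2))"
        by (simp only: exp_le_cancel_iff mult_minus_right)
    qed (use \<open>cmod (\<psi> z) \<le> M + \<epsilon>\<close> M \<epsilon> in auto)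
    finally show ?thesis .
  qed
  have "((\<lambda>\<epsilon>. (M + \<epsilon>) * exp (\<epsilon> * (1 + (Im z)\<^sup>2))) \<longlongrightarrow> (M + 0) * exp (0 * (1 + (Im z)\<^sup>2))) (at_right 0)"
    by (intro tendsto_intros)
  then have "((\<lambda>\<epsilon>. (M + \<epsilon>) * exp (\<epsilon> * (1 + (Im z)\<^sup>2))) \<longlongrightarrow> M) (at_right 0)" by simp
  then show ?thesis
    by (rule tendsto_lowerbound) (auto intro!: eventually_at_rightI[of 0 1] key)
qed

text \<open>Cauchy's estimate on the disc of radius 1/2 about 1/2, the largest that fits in the
  strip; hence the factor 2.\<close>

lemma strip_deriv:
  assumes cont: "continuous_on strip \<phi>" and hol: "\<phi> holomorphic_on ostrip"
    and M: "\<And>z. z \<in> strip \<Longrightarrow> cmod (\<phi> z) \<le> M"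
  shows "cmod (deriv \<phi> (1/2)) \<le> 2 * M"
proof -
  have "norm ((deriv ^^ 1) \<phi> (1/2)) \<le> fact 1 * M / (1/2)^1"
  proof (rule Cauchy_inequality)
    show "\<phi> holomorphic_on ball (1/2) (1/2)" using hol cball_half(2) holomorphic_on_subset by blast
    show "continuous_on (cball (1/2) (1/2)) \<phi>" using cont cball_half(1) continuous_on_subset by blast
    fix x :: complex assume "cmod (1/2 - x) = 1/2"
    then have "x \<in> cball (1/2) (1/2)" by (simp add: dist_norm)
    then show "cmod (\<phi> x) \<le> M" using cball_half(1) M by blast
  qed simp
  then show ?thesis by simp
qed

section \<open>Boundary functions\<close>

context seqspace
begin

lemma boundary_bound:
  assumes "boundary_ok X N g"
  shows "bdd_above (range (\<lambda>t. N (g t)))" "N (g t) \<le> (SUP t. N (g t))"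
proof -
  show "bdd_above (range (\<lambda>t. N (g t)))" using assms unfolding boundary_ok_def by (auto intro: bdd_aboveI2)
  then show "N (g t) \<le> (SUP t. N (g t))" by (rule cSUP_upper2) auto
qed

lemma boundary_lincomb:
  assumes f: "boundary_ok X N f" and g: "boundary_ok X N g"
  shows "boundary_ok X N (\<lambda>t j. a * f t j + b * g t j)"
  unfolding boundary_ok_def
proof (intro conjI allI impI)
  have fX: "f t \<in> X" and gX: "g t \<in> X" for t using f g by (auto simp: boundary_ok_def)
  have le: "(\<lambda>j. a * x j + b * y j) \<in> X \<and> N (\<lambda>j. a * x j + b * y j) \<le> cmod a * N x + cmod b * N y"
    if "x \<in> X" "y \<in> X" for x y
    using add[of "\<lambda>j. a * x j" "\<lambda>j. b * y j"] scale[OF that(1), of a] scale[OF that(2), of b] by auto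
  show "(\<lambda>j. a * f t j + b * g t j) \<in> X" for t using le fX gX by blast
  obtain Mf Mg where M: "\<And>t. N (f t) \<le> Mf" "\<And>t. N (g t) \<le> Mg" using f g by (auto simp: boundary_ok_def)
  have "N (\<lambda>j. a * f t j + b * g t j) \<le> cmod a * Mf + cmod b * Mg" for t
    using le[OF fX gX, of t t] mult_left_mono[OF M(1), of "cmod a" t] mult_left_mono[OF M(2), of "cmod b" t] by fastforce
  then show "\<exists>M. \<forall>t. N (\<lambda>j. a * f t j + b * g t j) \<le> M" by blast
  show "((\<lambda>t. N (\<lambda>j. a * f t j + b * g t j)) \<longlongrightarrow> 0) at_infinity"
  proof (rule Lim_null_comparison)
    show "eventually (\<lambda>t. norm (N (\<lambda>j. a * f t j + b * g t j)) \<le> cmod a * N (f t) + cmod b * N (g t)) at_infinity"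
      using le[OF fX gX] nonneg by (intro always_eventually) auto
    have "((\<lambda>t. cmod a * N (f t) + cmod b * N (g t)) \<longlongrightarrow> cmod a * 0 + cmod b * 0) at_infinity"
      using f g by (intro tendsto_intros) (auto simp: boundary_ok_def)
    then show "((\<lambda>t. cmod a * N (f t) + cmod b * N (g t)) \<longlongrightarrow> 0) at_infinity" by simp
  qed
  fix t e :: real assume e: "0 < e"
  define e' where "e' = e / (cmod a + cmod b + 1)"
  have e': "0 < e'" using e by (simp add: e'_def add_nonneg_pos)
  obtain d1 where d1: "0 < d1" "\<And>s. \<bar>s - t\<bar> < d1 \<Longrightarrow> N (\<lambda>j. f s j - f t j) < e'"
    using f e' unfolding boundary_ok_def by blast
  obtain d2 where d2: "0 < d2" "\<And>s. \<bar>s - t\<bar> < d2 \<Longrightarrow> N (\<lambda>j. g s j - g t j) < e'"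
    using g e' unfolding boundary_ok_def by blast
  show "\<exists>d>0. \<forall>s. \<bar>s - t\<bar> < d \<longrightarrow> N (\<lambda>j. (a * f s j + b * g s j) - (a * f t j + b * g t j)) < e"
  proof (intro exI[of _ "min d1 d2"] conjI allI impI)
    fix s assume s: "\<bar>s - t\<bar> < min d1 d2"
    have "N (\<lambda>j. a * (f s j - f t j) + b * (g s j - g t j)) \<le> cmod a * N (\<lambda>j. f s j - f t j) + cmod b * N (\<lambda>j. g s j - g t j)"
      using le[of "\<lambda>j. f s j - f t j" "\<lambda>j. g s j - g t j"] diff fX gX by blast
    also have "\<dots> \<le> cmod a * e' + cmod b * e'"
      using d1(2)[of s] d2(2)[of s] s by (intro add_mono mult_left_mono) auto
    also have "\<dots> < (cmod a + cmod b + 1) * e'" using e' by (simp add: distrib_right)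
    also have "\<dots> = e" by (simp add: e'_def add_nonneg_pos less_imp_neq[symmetric])
    finally show "N (\<lambda>j. (a * f s j + b * g s j) - (a * f t j + b * g t j)) < e"
      by (simp add: algebra_simps)
  qed (use d1 d2 in simp)
qed

text \<open>The boundary conditions pass to uniform limits in norm, by approximation with one
  sufficiently close \<open>f k\<close>.\<close>

lemma boundary_limit:
  assumes f: "\<And>k::nat. boundary_ok X N (f k)" and close: "\<And>k t. (\<lambda>j. g t j - f k t j) \<in> X \<and> N (\<lambda>j. g t j - f k t j) \<le> \<epsilon> k"
    and \<epsilon>: "\<epsilon> \<longlonglongrightarrow> (0::real)"
  shows "boundary_ok X N g"
proof -
  have fX: "f k t \<in> X" for k t using f by (auto simp: boundary_ok_def)
  have gX: "g t \<in> X" and Ng: "N (g t) \<le> \<epsilon> k + N (f k t)" for t k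
    using add[of "\<lambda>j. g t j - f k t j" "f k t"] close[of t k] fX[of k t] by auto
  have small: "\<exists>k. \<epsilon> k < e" if "0 < e" for e
    using LIMSEQ_D[OF \<epsilon> that] by (metis abs_less_iff diff_zero order_refl real_norm_def)
  show ?thesis
    unfolding boundary_ok_def
  proof (intro conjI allI impI gX)
    obtain M where "\<And>t. N (f 0 t) \<le> M" using f[of 0] by (auto simp: boundary_ok_def)
    then have "N (g t) \<le> \<epsilon> 0 + M" for t using Ng[of t 0] by (meson add_left_mono order_trans)
    then show "\<exists>M. \<forall>t. N (g t) \<le> M" by blast
    show "((\<lambda>t. N (g t)) \<longlongrightarrow> 0) at_infinity"
    proof (rule tendstoI)
      fix e :: real assume e: "0 < e"
      obtain k where k: "\<epsilon> k < e / 2" using small[of "e / 2"] e by auto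
      have "((\<lambda>t. N (f k t)) \<longlongrightarrow> 0) at_infinity" using f[of k] by (simp add: boundary_ok_def)
      then have "eventually (\<lambda>t. dist (N (f k t)) 0 < e / 2) at_infinity" by (rule tendstoD) (use e in simp)
      then show "eventually (\<lambda>t. dist (N (g t)) 0 < e) at_infinity"
      proof (rule eventually_mono)
        fix t assume "dist (N (f k t)) 0 < e / 2"
        then show "dist (N (g t)) 0 < e" using Ng[of t k] k nonneg[OF gX, of t] nonneg[OF fX, of k t] by simp
      qed
    qed
    fix t e :: real assume e: "0 < e"
    obtain k where k: "\<epsilon> k < e / 3" using small[of "e / 3"] e by auto
    obtain d where d: "0 < d" "\<And>s. \<bar>s - t\<bar> < d \<Longrightarrow> N (\<lambda>j. f k s j - f k t j) < e / 3"
      using f[of k] e unfolding boundary_ok_def by (metis divide_pos_pos zero_less_numeral)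
    show "\<exists>d>0. \<forall>s. \<bar>s - t\<bar> < d \<longrightarrow> N (\<lambda>j. g s j - g t j) < e"
    proof (intro exI[of _ d] conjI allI impI)
      fix s assume s: "\<bar>s - t\<bar> < d"
      have "N (\<lambda>j. (g s j - f k s j) - (g t j - f k t j) + (f k s j - f k t j))
        \<le> N (\<lambda>j. g s j - f k s j) + N (\<lambda>j. g t j - f k t j) + N (\<lambda>j. f k s j - f k t j)"
        using add[of "\<lambda>j. (g s j - f k s j) - (g t j - f k t j)" "\<lambda>j. f k s j - f k t j"]
          diff[of "\<lambda>j. g s j - f k s j" "\<lambda>j. g t j - f k t j"] diff[OF fX fX, of k s k t] close by fastforce
      also have "\<dots> < e" using close[of s k] close[of t k] d(2)[OF s] k by linarith
      finally show "N (\<lambda>j. g s j - g t j) < e" by (simp add: algebra_simps)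
    qed (use d in simp)
  qed
qed

text \<open>Powers such as h^(it) are continuous in t at each coordinate, but not uniformly in the
  coordinate. Vanishing tails of a restore continuity in norm: finitely many coordinates are handled
  by continuity, the rest by smallness of the tail.\<close>

lemma boundary_mult:
  assumes a: "a \<in> X" and tail: "(\<lambda>n. N (\<lambda>j. if n \<le> j then a j else 0)) \<longlonglongrightarrow> 0"
    and \<omega>: "\<And>t j. cmod (\<omega> t j) \<le> b t" and b: "\<And>t. b t \<le> B" "(b \<longlongrightarrow> 0) at_infinity"
    and cont: "\<And>j t. isCont (\<lambda>t::real. \<omega> t j) t"
  shows "boundary_ok X N (\<lambda>t j. \<omega> t j * a j)" "N (\<lambda>j. \<omega> t j * a j) \<le> b t * N a"
proof -
  have b0: "0 \<le> b t" for t using \<omega>[of t 0] norm_ge_zero order_trans by blast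
  have B0: "0 \<le> B" using b0[of 0] b(1)[of 0] by linarith
  have le: "(\<lambda>j. \<omega> t j * a j) \<in> X \<and> N (\<lambda>j. \<omega> t j * a j) \<le> b t * N a" for t
    by (rule solid[OF a b0]) (use \<omega> in \<open>simp add: norm_mult mult_right_mono\<close>)
  then show "N (\<lambda>j. \<omega> t j * a j) \<le> b t * N a" by blast
  show "boundary_ok X N (\<lambda>t j. \<omega> t j * a j)"
    unfolding boundary_ok_def
  proof (intro conjI allI impI)
    show "(\<lambda>j. \<omega> t j * a j) \<in> X" for t using le by blast
    have "N (\<lambda>j. \<omega> t j * a j) \<le> B * N a" for t
      using le[of t] mult_right_mono[OF b(1)[of t] nonneg[OF a]] by linarith
    then show "\<exists>M. \<forall>t. N (\<lambda>j. \<omega> t j * a j) \<le> M" by blast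
    show "((\<lambda>t. N (\<lambda>j. \<omega> t j * a j)) \<longlongrightarrow> 0) at_infinity"
    proof (rule Lim_null_comparison)
      show "eventually (\<lambda>t. norm (N (\<lambda>j. \<omega> t j * a j)) \<le> b t * N a) at_infinity"
        using le nonneg by (intro always_eventually) auto
      show "((\<lambda>t. b t * N a) \<longlongrightarrow> 0) at_infinity" using b(2) by (rule tendsto_mult_left_zero)
    qed
    fix t e :: real assume e: "0 < e"
    \<comment> \<open>With multipliers differing by at most 2 B, such a tail contributes less than e
      / 2; below, the head is treated alike with e / (2 * N a + 1).\<close>
    have "0 < e / (4 * B + 1)" using e B0 by simp
    from LIMSEQ_D[OF tail this] obtain n where "norm (N (\<lambda>j. if n \<le> j then a j else 0) - 0) < e / (4 * B + 1)" by blast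
    then have n: "N (\<lambda>j. if n \<le> j then a j else 0) < e / (4 * B + 1)" by simp
    define T where "T = N (\<lambda>j. if n \<le> j then a j else 0)"
    have Ta: "(\<lambda>j. if n \<le> j then a j else 0) \<in> X" using solid[OF a, of 1] by auto
    have T0: "0 \<le> T" unfolding T_def by (rule nonneg[OF Ta])
    define D where "D s = (\<Sum>j<n. cmod (\<omega> s j - \<omega> t j))" for s
    have "isCont D t" unfolding D_def by (intro continuous_intros cont)
    moreover have "D t = 0" by (simp add: D_def)
    moreover have "0 < e / (2 * N a + 1)" using e nonneg[OF a] by simp
    ultimately obtain d where d: "0 < d" "\<And>s. \<bar>s - t\<bar> < d \<Longrightarrow> \<bar>D s\<bar> < e / (2 * N a + 1)"
      unfolding continuous_at_eps_delta by (metis diff_zero dist_real_def)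
    show "\<exists>d>0. \<forall>s. \<bar>s - t\<bar> < d \<longrightarrow> N (\<lambda>j. \<omega> s j * a j - \<omega> t j * a j) < e"
    proof (intro exI[of _ d] conjI allI impI)
      fix s assume s: "\<bar>s - t\<bar> < d"
      define h where "h = (\<lambda>j. if j < n then (\<omega> s j - \<omega> t j) * a j else 0)"
      define l where "l = (\<lambda>j. if n \<le> j then (\<omega> s j - \<omega> t j) * a j else 0)"
      have D0: "0 \<le> D s" by (simp add: D_def sum_nonneg)
      have h: "h \<in> X \<and> N h \<le> D s * N a"
      proof (rule solid[OF a D0])
        fix j
        show "cmod (h j) \<le> D s * cmod (a j)"
        proof (cases "j < n")
          case True
          then have "cmod (\<omega> s j - \<omega> t j) \<le> D s" unfolding D_def by (intro member_le_sum) auto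
          then show ?thesis using True by (simp add: h_def norm_mult mult_right_mono)
        qed (use D0 in \<open>simp add: h_def\<close>)
      qed
      have l: "l \<in> X \<and> N l \<le> (2 * B) * T"
        unfolding T_def
      proof (rule solid[OF Ta])
        fix j
        have "cmod (\<omega> s j - \<omega> t j) \<le> 2 * B"
          using norm_triangle_ineq4[of "\<omega> s j" "\<omega> t j"] \<omega>[of s j] \<omega>[of t j] b(1)[of s] b(1)[of t] by linarith
        then show "cmod (l j) \<le> 2 * B * cmod (if n \<le> j then a j else 0)"
          by (simp add: l_def norm_mult mult_right_mono)
      qed (use B0 in simp)
      have "(\<lambda>j. \<omega> s j * a j - \<omega> t j * a j) = (\<lambda>j. h j + l j)" by (auto simp: h_def l_def algebra_simps)
      then have "N (\<lambda>j. \<omega> s j * a j - \<omega> t j * a j) \<le> D s * N a + 2 * B * T"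
        using add[of h l] h l by simp
      moreover have "D s * (2 * N a + 1) < e" using d(2)[OF s] nonneg[OF a] D0 by (simp add: field_simps)
      moreover have "T * (4 * B + 1) < e" using n B0 by (simp add: T_def field_simps)
      moreover have "0 \<le> T" "0 \<le> D s" by fact+
      ultimately show "N (\<lambda>j. \<omega> s j * a j - \<omega> t j * a j) < e" by (simp add: algebra_simps)
    qed (use d in simp)
  qed
qed

end

section \<open>Completeness of derived spaces\<close>

locale couple = E0: seqspace X0 N0 + E1: seqspace X1 N1 for X0 N0 X1 N1
begin

abbreviation FC where "FC \<equiv> Fclass X0 N0 X1 N1"
abbreviation FN where "FN \<equiv> Fnorm N0 N1"
abbreviation Z where "Z \<equiv> derived X0 N0 X1 N1 (1/2)"
abbreviation ZN where "ZN \<equiv> derived_norm X0 N0 X1 N1 (1/2)"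

lemma FCD:
  assumes "F \<in> FC"
  shows "continuous_on strip (\<lambda>z. F z j)" "bounded ((\<lambda>z. F z j) ` strip)" "(\<lambda>z. F z j) holomorphic_on ostrip"
    "boundary_ok X0 N0 (\<lambda>t. F (\<i> * of_real t))" "boundary_ok X1 N1 (\<lambda>t. F (1 + \<i> * of_real t))"
    "F (\<i> * of_real t) \<in> X0" "F (1 + \<i> * of_real t) \<in> X1"
  using assms by (auto simp: Fclass_def boundary_ok_def)

lemma FN_bound:
  assumes "F \<in> FC"
  shows "N0 (F (\<i> * of_real t)) \<le> FN F" "N1 (F (1 + \<i> * of_real t)) \<le> FN F"
  using E0.boundary_bound(2)[OF FCD(4)[OF assms], of t] E1.boundary_bound(2)[OF FCD(5)[OF assms], of t]
  unfolding Fnorm_def by linarith+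

lemma FN_le:
  assumes "\<And>t. N0 (F (\<i> * of_real t)) \<le> M" "\<And>t. N1 (F (1 + \<i> * of_real t)) \<le> M"
  shows "FN F \<le> M"
  unfolding Fnorm_def using assms by (auto intro: cSUP_least)

lemma FN_nonneg: "F \<in> FC \<Longrightarrow> 0 \<le> FN F"
  using FN_bound(1)[of F 0] E0.nonneg[OF FCD(6)[of F 0]] by linarith

text \<open>Both norms dominate every coordinate, so the boundary norms control each coordinate
  function on the two lines, and the maximum principle carries this inside.\<close>

lemma FC_coord:
  assumes "F \<in> FC"
  shows "z \<in> strip \<Longrightarrow> cmod (F z j) \<le> FN F" "cmod (deriv (\<lambda>z. F z j) (1/2)) \<le> 2 * FN F"
proof -
  show *: "cmod (F z j) \<le> FN F" if "z \<in> strip" for z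
  proof (rule three_lines[of "\<lambda>z. F z j"])
    show "cmod (F (\<i> * of_real t) j) \<le> FN F" for t
      using E0.coord[OF FCD(6)[OF assms], of t j] FN_bound(1)[OF assms, of t] by linarith
    show "cmod (F (1 + \<i> * of_real t) j) \<le> FN F" for t
      using E1.coord[OF FCD(7)[OF assms], of t j] FN_bound(2)[OF assms, of t] by linarith
  qed (use that FCD[OF assms] in auto)
  show "cmod (deriv (\<lambda>z. F z j) (1/2)) \<le> 2 * FN F"
    by (rule strip_deriv) (use FCD[OF assms] * in auto)
qed

lemma FC_field_differentiable: "F \<in> FC \<Longrightarrow> (\<lambda>z. F z j) field_differentiable at (1/2)"
  using FCD(3)[of F j] open_ostrip half_ostrip holomorphic_on_imp_differentiable_at by blast

lemma FC_lincomb: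
  assumes F: "F \<in> FC" and G: "G \<in> FC"
  shows "(\<lambda>z j. a * F z j + b * G z j) \<in> FC" "FN (\<lambda>z j. a * F z j + b * G z j) \<le> cmod a * FN F + cmod b * FN G"
    "deriv (\<lambda>z. a * F z j + b * G z j) (1/2) = a * deriv (\<lambda>z. F z j) (1/2) + b * deriv (\<lambda>z. G z j) (1/2)"
proof -
  show "(\<lambda>z j. a * F z j + b * G z j) \<in> FC"
    unfolding Fclass_def mem_Collect_eq
  proof (intro conjI allI)
    fix j
    show "continuous_on strip (\<lambda>z. a * F z j + b * G z j)" by (intro continuous_intros FCD F G)
    show "(\<lambda>z. a * F z j + b * G z j) holomorphic_on ostrip" by (intro holomorphic_intros FCD F G)
    show "bounded ((\<lambda>z. a * F z j + b * G z j) ` strip)"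
    proof (rule boundedI)
      fix w assume "w \<in> (\<lambda>z. a * F z j + b * G z j) ` strip"
      then obtain z where z: "z \<in> strip" "w = a * F z j + b * G z j" by blast
      have "cmod w \<le> cmod a * cmod (F z j) + cmod b * cmod (G z j)"
        unfolding z(2) by (metis norm_mult norm_triangle_ineq)
      also have "\<dots> \<le> cmod a * FN F + cmod b * FN G"
        by (intro add_mono mult_left_mono FC_coord F G z) auto
      finally show "cmod w \<le> cmod a * FN F + cmod b * FN G" .
    qed
  qed (use E0.boundary_lincomb[OF FCD(4)[OF F] FCD(4)[OF G], of a b]
      E1.boundary_lincomb[OF FCD(5)[OF F] FCD(5)[OF G], of a b] in auto)
  have le: "cmod a * x + cmod b * y \<le> cmod a * FN F + cmod b * FN G" if "x \<le> FN F" "y \<le> FN G" for x y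
    using that by (intro add_mono mult_left_mono) auto
  show "FN (\<lambda>z j. a * F z j + b * G z j) \<le> cmod a * FN F + cmod b * FN G"
  proof (rule FN_le)
    fix t
    have m: "F (\<i> * of_real t) \<in> X0" "G (\<i> * of_real t) \<in> X0" "F (1 + \<i> * of_real t) \<in> X1" "G (1 + \<i> * of_real t) \<in> X1"
      using FCD F G by auto
    have "N0 (\<lambda>j. a * F (\<i> * of_real t) j + b * G (\<i> * of_real t) j)
        \<le> cmod a * N0 (F (\<i> * of_real t)) + cmod b * N0 (G (\<i> * of_real t))"
      using E0.add[OF conjunct1[OF E0.scale[OF m(1), of a]] conjunct1[OF E0.scale[OF m(2), of b]]]
        E0.scale[OF m(1), of a] E0.scale[OF m(2), of b] by linarith
    also have "\<dots> \<le> cmod a * FN F + cmod b * FN G" by (intro le FN_bound F G)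
    finally show "N0 (\<lambda>j. a * F (\<i> * of_real t) j + b * G (\<i> * of_real t) j) \<le> cmod a * FN F + cmod b * FN G" .
    have "N1 (\<lambda>j. a * F (1 + \<i> * of_real t) j + b * G (1 + \<i> * of_real t) j)
        \<le> cmod a * N1 (F (1 + \<i> * of_real t)) + cmod b * N1 (G (1 + \<i> * of_real t))"
      using E1.add[OF conjunct1[OF E1.scale[OF m(3), of a]] conjunct1[OF E1.scale[OF m(4), of b]]]
        E1.scale[OF m(3), of a] E1.scale[OF m(4), of b] by linarith
    also have "\<dots> \<le> cmod a * FN F + cmod b * FN G" by (intro le FN_bound F G)
    finally show "N1 (\<lambda>j. a * F (1 + \<i> * of_real t) j + b * G (1 + \<i> * of_real t) j) \<le> cmod a * FN F + cmod b * FN G" .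
  qed
  show "deriv (\<lambda>z. a * F z j + b * G z j) (1/2) = a * deriv (\<lambda>z. F z j) (1/2) + b * deriv (\<lambda>z. G z j) (1/2)"
    using FC_field_differentiable[OF F, of j] FC_field_differentiable[OF G, of j]
    by (simp add: field_differentiable_mult)
qed

lemma FC_zero: "(\<lambda>_ _. 0) \<in> FC" "FN (\<lambda>_ _. 0) = 0"
  by (auto simp: Fclass_def boundary_ok_def E0.zero E1.zero E0.N_zero E1.N_zero Fnorm_def bounded_def
      intro!: exI[of _ 0])

text \<open>Coordinates converge uniformly on the strip, which preserves continuity and analyticity.
  The norms on the two lines are not limits of coordinates and are recovered by the Fatou
  property.\<close>

lemma FC_limit:
  assumes S: "\<And>k::nat. S k \<in> FC" and close: "\<And>k m. k \<le> m \<Longrightarrow> FN (\<lambda>z j. S m z j - S k z j) \<le> \<epsilon> k"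
    and \<epsilon>: "\<epsilon> \<longlonglongrightarrow> (0::real)"
  obtains G where "G \<in> FC" "\<And>k. FN (\<lambda>z j. G z j - S k z j) \<le> \<epsilon> k"
proof -
  have D: "(\<lambda>z j. S m z j - S k z j) \<in> FC" for m k
    using FC_lincomb(1)[OF S S, of 1 m "-1" k] by simp
  have co: "cmod (S m z j - S k z j) \<le> \<epsilon> k" if "z \<in> strip" "k \<le> m" for z j k m
    using FC_coord(1)[OF D[of m k] that(1), of j] close[OF that(2)] by linarith
  have small: "\<exists>k. \<epsilon> k < e" if "0 < e" for e
    using LIMSEQ_D[OF \<epsilon> that] by (metis abs_less_iff diff_zero order_refl real_norm_def)
  have Cau: "Cauchy (\<lambda>k. S k z j)" if z: "z \<in> strip" for z j
  proof (rule metric_CauchyI)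
    fix e :: real assume e: "0 < e"
    obtain k where k: "\<epsilon> k < e / 2" using small[of "e / 2"] e by auto
    have "dist (S m z j) (S n z j) < e" if "k \<le> m" "k \<le> n" for m n
    proof -
      have "dist (S m z j) (S n z j) \<le> dist (S m z j) (S k z j) + dist (S n z j) (S k z j)" by (rule dist_triangle2)
      then show ?thesis using co[OF z that(1), of j] co[OF z that(2), of j] k by (simp add: dist_norm)
    qed
    then show "\<exists>M. \<forall>m\<ge>M. \<forall>n\<ge>M. dist (S m z j) (S n z j) < e" by blast
  qed
  define G where "G z j = lim (\<lambda>k. S k z j)" for z j
  have lim: "(\<lambda>k. S k z j) \<longlonglongrightarrow> G z j" if "z \<in> strip" for z j
    using Cau[OF that, of j] unfolding G_def by (simp add: Cauchy_convergent convergent_LIMSEQ_iff[symmetric])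
  have Gco: "cmod (G z j - S k z j) \<le> \<epsilon> k" if z: "z \<in> strip" for z j k
  proof (rule LIMSEQ_le_const2)
    show "(\<lambda>m. cmod (S m z j - S k z j)) \<longlonglongrightarrow> cmod (G z j - S k z j)" by (intro tendsto_intros lim z)
    show "\<exists>N. \<forall>m\<ge>N. cmod (S m z j - S k z j) \<le> \<epsilon> k" using co[OF z] by blast
  qed
  have unif: "uniform_limit strip (\<lambda>k z. S k z j) (\<lambda>z. G z j) sequentially" for j
  proof (rule uniform_limitI)
    fix e :: real assume "0 < e"
    then have "eventually (\<lambda>k. dist (\<epsilon> k) 0 < e) sequentially" by (rule tendstoD[OF \<epsilon>])
    then show "eventually (\<lambda>k. \<forall>z\<in>strip. dist (S k z j) (G z j) < e) sequentially"
    proof (rule eventually_mono)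
      fix k assume "dist (\<epsilon> k) 0 < e"
      then show "\<forall>z\<in>strip. dist (S k z j) (G z j) < e" using Gco[of _ j k] by (force simp: dist_norm norm_minus_commute)
    qed
  qed
  have b0: "(\<lambda>j. G (\<i> * of_real t) j - S k (\<i> * of_real t) j) \<in> X0 \<and> N0 (\<lambda>j. G (\<i> * of_real t) j - S k (\<i> * of_real t) j) \<le> \<epsilon> k" for k t
  \<comment> \<open>Indices start at k, so the Cauchy estimate \<open>close\<close> holds along the
    whole sequence.\<close>
  proof (rule E0.fatou[where xs = "\<lambda>m j. S (k + m) (\<i> * of_real t) j - S k (\<i> * of_real t) j"])
    show "(\<lambda>j. S (k + m) (\<i> * of_real t) j - S k (\<i> * of_real t) j) \<in> X0" for m using FCD(6)[OF D] .
    show "N0 (\<lambda>j. S (k + m) (\<i> * of_real t) j - S k (\<i> * of_real t) j) \<le> \<epsilon> k" for m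
      using FN_bound(1)[OF D[of "k + m" k], of t] close[of k "k + m"] by simp
    show "(\<lambda>m. S (k + m) (\<i> * of_real t) j - S k (\<i> * of_real t) j) \<longlonglongrightarrow> G (\<i> * of_real t) j - S k (\<i> * of_real t) j" for j
      using LIMSEQ_ignore_initial_segment[OF lim, of "\<i> * of_real t" k j]
      by (intro tendsto_intros) (simp add: strip_def add.commute)
  qed
  have b1: "(\<lambda>j. G (1 + \<i> * of_real t) j - S k (1 + \<i> * of_real t) j) \<in> X1 \<and> N1 (\<lambda>j. G (1 + \<i> * of_real t) j - S k (1 + \<i> * of_real t) j) \<le> \<epsilon> k" for k t
  proof (rule E1.fatou[where xs = "\<lambda>m j. S (k + m) (1 + \<i> * of_real t) j - S k (1 + \<i> * of_real t) j"])
    show "(\<lambda>j. S (k + m) (1 + \<i> * of_real t) j - S k (1 + \<i> * of_real t) j) \<in> X1" for m using FCD(7)[OF D] .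
    show "N1 (\<lambda>j. S (k + m) (1 + \<i> * of_real t) j - S k (1 + \<i> * of_real t) j) \<le> \<epsilon> k" for m
      using FN_bound(2)[OF D[of "k + m" k], of t] close[of k "k + m"] by simp
    show "(\<lambda>m. S (k + m) (1 + \<i> * of_real t) j - S k (1 + \<i> * of_real t) j) \<longlonglongrightarrow> G (1 + \<i> * of_real t) j - S k (1 + \<i> * of_real t) j" for j
      using LIMSEQ_ignore_initial_segment[OF lim, of "1 + \<i> * of_real t" k j]
      by (intro tendsto_intros) (simp add: strip_def add.commute)
  qed
  have "G \<in> FC"
    unfolding Fclass_def mem_Collect_eq
  proof (intro conjI allI)
    fix j
    show "continuous_on strip (\<lambda>z. G z j)"
      by (rule uniform_limit_theorem[OF _ unif]) (use FCD(1)[OF S] in \<open>auto intro: always_eventually\<close>)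
    show "bounded ((\<lambda>z. G z j) ` strip)"
    proof (rule boundedI)
      fix w assume "w \<in> (\<lambda>z. G z j) ` strip"
      then obtain z where z: "z \<in> strip" "w = G z j" by blast
      have "cmod (G z j) \<le> cmod (G z j - S 0 z j) + cmod (S 0 z j)" using norm_triangle_ineq[of "G z j - S 0 z j" "S 0 z j"] by simp
      then show "cmod w \<le> \<epsilon> 0 + FN (S 0)" using Gco[OF z(1), of j 0] FC_coord(1)[OF S z(1), of 0 j] unfolding z(2) by linarith
    qed
    show "(\<lambda>z. G z j) holomorphic_on ostrip"
    proof (rule holomorphic_uniform_sequence[OF open_ostrip, where f = "\<lambda>k z. S k z j"])
      show "(\<lambda>z. S k z j) holomorphic_on ostrip" for k by (rule FCD[OF S])
      fix x assume "x \<in> ostrip"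
      then obtain d where d: "0 < d" "cball x d \<subseteq> ostrip" using open_ostrip open_contains_cball by blast
      moreover have "uniform_limit (cball x d) (\<lambda>k z. S k z j) (\<lambda>z. G z j) sequentially"
        by (rule uniform_limit_on_subset[OF unif]) (use d ostrip_strip in blast)
      ultimately show "\<exists>d. 0 < d \<and> cball x d \<subseteq> ostrip \<and> uniform_limit (cball x d) (\<lambda>k z. S k z j) (\<lambda>z. G z j) sequentially"
        by blast
    qed
  qed (use E0.boundary_limit[OF FCD(4)[OF S] b0 \<epsilon>] E1.boundary_limit[OF FCD(5)[OF S] b1 \<epsilon>] in auto)
  moreover have "FN (\<lambda>z j. G z j - S k z j) \<le> \<epsilon> k" for k
    by (rule FN_le) (use b0 b1 in auto)
  ultimately show ?thesis by (rule that)
qed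

section \<open>Norm and completeness of the derived space\<close>

lemma ZI: "F \<in> FC \<Longrightarrow> represents (of_real (1/2)) F p \<Longrightarrow> p \<in> Z \<and> ZN p \<le> FN F"
  unfolding derived_def derived_norm_def using FN_nonneg by (auto intro!: cInf_lower bdd_belowI[of _ 0])

lemma ZE:
  assumes "p \<in> Z" "0 < e"
  obtains F where "F \<in> FC" "represents (of_real (1/2)) F p" "FN F < ZN p + e"
proof -
  have "{FN F | F. F \<in> FC \<and> represents (of_real (1/2)) F p} \<noteq> {}"
    using assms(1) unfolding derived_def by blast
  moreover have "bdd_below {FN F | F. F \<in> FC \<and> represents (of_real (1/2)) F p}"
    using FN_nonneg by (auto intro!: bdd_belowI[of _ 0])
  moreover have "ZN p < ZN p + e" using assms(2) by simp
  ultimately obtain x where "x \<in> {FN F | F. F \<in> FC \<and> represents (of_real (1/2)) F p}" "x < ZN p + e"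
    unfolding derived_norm_def using cInf_less_iff by meson
  then show ?thesis using that by blast
qed

lemma represents_iff:
  "represents (of_real (1/2)) F p \<longleftrightarrow> p = (\<lambda>j. deriv (\<lambda>z. F z j) (1/2), F (1/2))"
  "represents (1/2) F p \<longleftrightarrow> p = (\<lambda>j. deriv (\<lambda>z. F z j) (1/2), F (1/2))"
  unfolding represents_def by (cases p; auto)+

lemma Z_nonneg: "p \<in> Z \<Longrightarrow> 0 \<le> ZN p"
proof (rule field_le_epsilon)
  fix e :: real assume p: "p \<in> Z" and "0 < e"
  then obtain F where "F \<in> FC" "FN F < ZN p + e" by (rule ZE)
  then show "0 \<le> ZN p + e" using FN_nonneg[of F] by linarith
qed

lemma Z_coord:
  assumes p: "p \<in> Z"
  shows "cmod (fst p j) \<le> 2 * ZN p" "cmod (snd p j) \<le> ZN p"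
proof -
  have "cmod (fst p j) \<le> 2 * (ZN p + e) \<and> cmod (snd p j) \<le> ZN p + e" if e: "0 < e" for e
  proof -
    obtain F where F: "F \<in> FC" "represents (of_real (1/2)) F p" "FN F < ZN p + e" by (rule ZE[OF p e])
    have "1/2 \<in> strip" by (simp add: strip_def)
    then have "cmod (F (1/2) j) \<le> FN F" by (rule FC_coord(1)[OF F(1)])
    then show ?thesis using FC_coord(2)[OF F(1), of j] F(2,3) by (auto simp: represents_iff)
  qed
  then have *: "cmod (fst p j) \<le> 2 * ZN p + e" "cmod (snd p j) \<le> ZN p + e" if "0 < e" for e
    using that by (metis distrib_left half_gt_zero mult_2 field_sum_of_halves)+
  show "cmod (fst p j) \<le> 2 * ZN p" "cmod (snd p j) \<le> ZN p"
    by (rule field_le_epsilon, rule *, assumption)+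
qed

lemma Z_lincomb:
  assumes p: "p \<in> Z" and q: "q \<in> Z"
  shows "(\<lambda>j. a * fst p j + b * fst q j, \<lambda>j. a * snd p j + b * snd q j) \<in> Z \<and>
    ZN (\<lambda>j. a * fst p j + b * fst q j, \<lambda>j. a * snd p j + b * snd q j) \<le> cmod a * ZN p + cmod b * ZN q"
proof -
  let ?r = "(\<lambda>j. a * fst p j + b * fst q j, \<lambda>j. a * snd p j + b * snd q j)"
  have *: "?r \<in> Z \<and> ZN ?r \<le> cmod a * (ZN p + e) + cmod b * (ZN q + e)" if e: "0 < e" for e
  proof -
    obtain F where F: "F \<in> FC" "represents (of_real (1/2)) F p" "FN F < ZN p + e" by (rule ZE[OF p e])
    obtain G where G: "G \<in> FC" "represents (of_real (1/2)) G q" "FN G < ZN q + e" by (rule ZE[OF q e])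
    have "represents (of_real (1/2)) (\<lambda>z j. a * F z j + b * G z j) ?r"
      using F(2) G(2) by (simp add: represents_iff FC_lincomb(3)[OF F(1) G(1)])
    then have "?r \<in> Z \<and> ZN ?r \<le> FN (\<lambda>z j. a * F z j + b * G z j)" by (rule ZI[OF FC_lincomb(1)[OF F(1) G(1)]])
    moreover have "cmod a * FN F + cmod b * FN G \<le> cmod a * (ZN p + e) + cmod b * (ZN q + e)"
      using F(3) G(3) by (intro add_mono mult_left_mono) auto
    ultimately show ?thesis using FC_lincomb(2)[OF F(1) G(1), of a b] by linarith
  qed
  have "((\<lambda>e. cmod a * (ZN p + e) + cmod b * (ZN q + e)) \<longlongrightarrow> cmod a * (ZN p + 0) + cmod b * (ZN q + 0)) (at_right 0)"
    by (intro tendsto_intros)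
  then have "ZN ?r \<le> cmod a * (ZN p + 0) + cmod b * (ZN q + 0)"
    by (rule tendsto_lowerbound) (use * in \<open>auto intro!: eventually_at_rightI[of 0 1]\<close>)
  then show ?thesis using *[of 1] by simp
qed

lemma Z_zero: "pzero \<in> Z" "ZN pzero = 0"
proof -
  have "pzero \<in> Z \<and> ZN pzero \<le> FN (\<lambda>_ _. 0)"
    by (rule ZI[OF FC_zero(1)]) (simp add: represents_iff pzero_def)
  then show "pzero \<in> Z" "ZN pzero = 0" using Z_nonneg[of pzero] FC_zero(2) by linarith+
qed

lemma Z_padd: "p \<in> Z \<Longrightarrow> q \<in> Z \<Longrightarrow> padd p q \<in> Z \<and> ZN (padd p q) \<le> ZN p + ZN q"
  using Z_lincomb[of p q 1 1] by (simp add: padd_def)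

lemma Z_pdiff: "p \<in> Z \<Longrightarrow> q \<in> Z \<Longrightarrow> pdiff p q \<in> Z \<and> ZN (pdiff p q) \<le> ZN p + ZN q"
  using Z_lincomb[of p q 1 "-1"] by (simp add: pdiff_def)

lemma Z_pscale: "p \<in> Z \<Longrightarrow> pscale c p \<in> Z \<and> ZN (pscale c p) = cmod c * ZN p"
proof -
  have le: "pscale c p \<in> Z \<and> ZN (pscale c p) \<le> cmod c * ZN p" if "p \<in> Z" for c p
    using Z_lincomb[OF that that, of c 0] by (simp add: pscale_def)
  assume p: "p \<in> Z"
  show ?thesis
  proof (cases "c = 0")
    case True
    then have "pscale c p = pzero" by (simp add: pscale_def pzero_def)
    then show ?thesis using True Z_zero by simp
  next
    case False
    have "pscale (inverse c) (pscale c p) = p" using False by (cases p) (simp add: pscale_def mult.assoc[symmetric])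
    then have "ZN p \<le> cmod (inverse c) * ZN (pscale c p)" using le[of "pscale c p" "inverse c"] le[OF p, of c] by simp
    then have "cmod c * ZN p \<le> cmod c * (cmod (inverse c) * ZN (pscale c p))" by (intro mult_left_mono) auto
    moreover have "cmod c * cmod (inverse c) = 1" using False by (simp flip: norm_mult)
    ultimately have "cmod c * ZN p \<le> ZN (pscale c p)" by (simp only: mult.assoc[symmetric] mult_1)
    then show ?thesis using le[OF p, of c] by simp
  qed
qed

text \<open>The steps of a fast subsequence are lifted to analytic families of summable norm. The
  partial sums of the lifts converge among the families, and the limit family represents the
  limit.\<close>

lemma Z_complete:
  assumes u: "\<And>k. u k \<in> Z" and Cau: "\<forall>e>0. \<exists>K. \<forall>m\<ge>K. \<forall>k\<ge>K. ZN (pdiff (u m) (u k)) < e"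
  shows "\<exists>x\<in>Z. (\<lambda>k. ZN (pdiff (u k) x)) \<longlonglongrightarrow> 0"
proof -
  have "\<exists>K. \<forall>n. (\<forall>m\<ge>K n. \<forall>k\<ge>K n. ZN (pdiff (u m) (u k)) < (1/2)^n)"
    using Cau by (intro choice) simp
  then obtain K0 where K0: "\<And>n m k. K0 n \<le> m \<Longrightarrow> K0 n \<le> k \<Longrightarrow> ZN (pdiff (u m) (u k)) < (1/2)^n" by blast
  \<comment> \<open>Summing the thresholds makes \<open>K m\<close> at least every
    \<open>K0 n\<close> with n \<le> m, so successive terms satisfy all earlier estimates.\<close>
  define K where "K n = (\<Sum>i\<le>n. K0 i)" for n
  have K_ge: "K0 n \<le> K m" if "n \<le> m" for n m unfolding K_def using that by (intro member_le_sum) auto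
  define v where "v n = u (K n)" for n
  have vZ: "v n \<in> Z" for n by (simp add: v_def u)
  have step: "\<exists>F. F \<in> FC \<and> represents (of_real (1/2)) F (pdiff (v (Suc n)) (v n)) \<and> FN F \<le> (1/2)^n" for n
  proof -
    have d: "pdiff (v (Suc n)) (v n) \<in> Z" using Z_pdiff vZ by blast
    have "ZN (pdiff (v (Suc n)) (v n)) < (1/2)^n" unfolding v_def by (intro K0 K_ge) auto
    then have "0 < (1/2)^n - ZN (pdiff (v (Suc n)) (v n))" by simp
    from ZE[OF d this] show ?thesis by (metis add_diff_cancel_left' diff_add_cancel less_imp_le add.commute)
  qed
  then obtain F where F: "\<And>n. F n \<in> FC" "\<And>n. represents (of_real (1/2)) (F n) (pdiff (v (Suc n)) (v n))"
    "\<And>n. FN (F n) \<le> (1/2)^n" by metis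
  obtain F0 where F0: "F0 \<in> FC" "represents (of_real (1/2)) F0 (v 0)" by (rule ZE[OF vZ zero_less_one])
  define S where "S n = (\<lambda>z j. F0 z j + (\<Sum>i<n. F i z j))" for n
  have S_Suc: "S (Suc n) = (\<lambda>z j. 1 * S n z j + 1 * F n z j)" for n by (simp add: S_def add_ac)
  have S: "S n \<in> FC \<and> represents (of_real (1/2)) (S n) (v n)" for n
  proof (induction n)
    case 0
    have "S 0 = F0" by (simp add: S_def)
    then show ?case using F0 by simp
  next
    case (Suc n)
    have "S (Suc n) \<in> FC" unfolding S_Suc using Suc F by (intro FC_lincomb) auto
    moreover have "represents (of_real (1/2)) (S (Suc n)) (v (Suc n))"
      using Suc F(2)[of n] FC_lincomb(3)[of "S n" "F n", where a = 1 and b = 1] F(1)[of n]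
      unfolding S_Suc represents_def pdiff_def by (auto simp: fun_eq_iff)
    ultimately show ?case by blast
  qed
  \<comment> \<open>The subtracted term is the unspent part of the geometric series; keeping it lets
    the induction on m close.\<close>
  have close: "FN (\<lambda>z j. S m z j - S k z j) \<le> 2 * (1/2)^k - 2 * (1/2)^m" if "k \<le> m" for k m
    using that
  proof (induction m rule: dec_induct)
    case base
    then show ?case using FC_zero(2) by simp
  next
    case (step m)
    have "(\<lambda>z j. S m z j - S k z j) \<in> FC" using FC_lincomb(1)[of "S m" "S k" 1 "-1"] S by simp
    then have "FN (\<lambda>z j. 1 * (S m z j - S k z j) + 1 * F m z j) \<le> FN (\<lambda>z j. S m z j - S k z j) + FN (F m)"
      using FC_lincomb(2)[of _ "F m" 1 1] F(1) by simp
    also have "\<dots> \<le> 2 * (1/2)^k - 2 * (1/2)^m + (1/2)^m" using step F(3)[of m] by linarith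
    finally show ?case by (simp add: S_Suc algebra_simps)
  qed
  have close': "FN (\<lambda>z j. S m z j - S k z j) \<le> 2 * (1/2)^k" if "k \<le> m" for k m
  proof -
    have "0 \<le> (1/2::real)^m" by simp
    then show ?thesis using close[OF that] by linarith
  qed
  have eps: "(\<lambda>k. 2 * (1/2::real)^k) \<longlonglongrightarrow> 0"
    using tendsto_mult[OF tendsto_const[of 2] LIMSEQ_power_zero[of "1/2::real"]] by simp
  obtain G where G: "G \<in> FC" "\<And>k. FN (\<lambda>z j. G z j - S k z j) \<le> 2 * (1/2)^k"
    by (rule FC_limit[of S "\<lambda>k. 2 * (1/2)^k"]) (use S close' eps in auto)
  define x where "x = (\<lambda>j. deriv (\<lambda>z. G z j) (1/2), G (1/2))"
  have x: "x \<in> Z" using ZI[OF G(1), of x] by (simp add: represents_iff x_def)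
  have vx: "ZN (pdiff x (v k)) \<le> 2 * (1/2)^k" for k
  proof -
    have "represents (of_real (1/2)) (\<lambda>z j. 1 * G z j + (-1) * S k z j) (pdiff x (v k))"
      using S[of k] FC_lincomb(3)[OF G(1), of "S k", where a = 1 and b = "-1"]
      unfolding represents_def pdiff_def x_def by (auto simp: fun_eq_iff)
    then have "ZN (pdiff x (v k)) \<le> FN (\<lambda>z j. 1 * G z j + (-1) * S k z j)"
      using ZI FC_lincomb(1)[OF G(1), of "S k"] S by blast
    then show ?thesis using G(2)[of k] by simp
  qed
  have "(\<lambda>k. ZN (pdiff (u k) x)) \<longlonglongrightarrow> 0"
  proof (rule LIMSEQ_I)
    fix e :: real assume e: "0 < e"
    obtain n where n: "2 * (1/2::real)^n < e / 3" using LIMSEQ_D[OF eps, of "e / 3"] e by auto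
    have "norm (ZN (pdiff (u k) x) - 0) < e" if k: "K n \<le> k" for k
    proof -
      have uv: "ZN (pdiff (u k) (v n)) < (1/2)^n" unfolding v_def by (rule K0) (use K_ge[of n n] k in auto)
      have "pdiff (u k) x = pdiff (pdiff (u k) (v n)) (pdiff x (v n))" by (simp add: pdiff_def)
      then have "ZN (pdiff (u k) x) \<le> ZN (pdiff (u k) (v n)) + ZN (pdiff x (v n))"
        using Z_pdiff u vZ x by metis
      moreover have "0 < (1/2::real)^n" by simp
      ultimately show ?thesis using uv vx[of n] n e Z_nonneg[of "pdiff (u k) x"] Z_pdiff[OF u x, of k] by simp
    qed
    then show "\<exists>N. \<forall>k\<ge>N. norm (ZN (pdiff (u k) x) - 0) < e" by blast
  qed
  then show ?thesis using x by blast
qed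

lemma Z_csubspace: "csubspace Z"
  unfolding csubspace_def using Z_zero(1) Z_padd Z_pscale by simp

lemma Z_banach: "banach_on Z ZN"
  unfolding banach_on_def
proof (intro conjI ballI allI impI)
  show "csubspace Z" by (rule Z_csubspace)
  fix x assume x: "x \<in> Z"
  show "0 \<le> ZN x" by (rule Z_nonneg[OF x])
  show "ZN x = 0 \<longleftrightarrow> x = pzero"
  proof
    assume "ZN x = 0"
    then show "x = pzero" using Z_coord[OF x] by (cases x) (simp add: pzero_def fun_eq_iff)
  qed (simp add: Z_zero)
  show "ZN (padd x y) \<le> ZN x + ZN y" if "y \<in> Z" for y using Z_padd[OF x that] by blast
  show "ZN (pscale c x) = cmod c * ZN x" for c using Z_pscale[OF x, of c] by blast
next
  fix u :: "nat \<Rightarrow> pseq" assume "(\<forall>k. u k \<in> Z) \<and> (\<forall>e>0. \<exists>K. \<forall>m\<ge>K. \<forall>k\<ge>K. ZN (pdiff (u m) (u k)) < e)"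
  then show "\<exists>x\<in>Z. (\<lambda>k. ZN (pdiff (u k) x)) \<longlonglongrightarrow> 0" by (intro Z_complete) auto
qed

end

section \<open>Weights and elements of \<open>Z(T\<^sup>2)\<close>\<close>

interpretation ZT: couple T2 T2N T2D T2DN by unfold_locales

lemma ZT2_eq: "ZT2 = ZT.Z" "ZT2N = ZT.ZN"
  by (simp_all add: ZT2_def ZT2N_def)

text \<open>The last condition says that \<open>v / sqrt h\<close> has norm at most \<open>M\<close> in \<open>T\<^sup>2\<close>; the second last one bounds
  \<open>v sqrt h\<close> in the dual.\<close>
definition good :: "(nat \<Rightarrow> real) \<Rightarrow> real \<Rightarrow> seq \<Rightarrow> bool" where
  "good h M v \<longleftrightarrow> h \<in> wball \<and> 0 \<le> M \<and> (\<forall>j. v j \<noteq> 0 \<longrightarrow> 0 < h j) \<and>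
     (\<forall>L. (\<Sum>j<L. (cmod (v j))\<^sup>2) \<le> M\<^sup>2) \<and>
     (\<forall>g\<in>tfuns. \<forall>L. (\<Sum>j<L. g j / h j * (cmod (v j))\<^sup>2) \<le> M\<^sup>2)"

lemma good_solid:
  assumes "good h M v" "\<And>j. cmod (w j) \<le> cmod (v j)"
  shows "good h M w"
proof -
  have h: "h \<in> wball" "\<And>j. 0 \<le> h j" using assms(1) wballD(1) by (auto simp: good_def)
  have "(\<Sum>j<L. (cmod (w j))\<^sup>2) \<le> (\<Sum>j<L. (cmod (v j))\<^sup>2)" for L
    by (intro sum_mono power_mono assms) auto
  moreover have "(\<Sum>j<L. g j / h j * (cmod (w j))\<^sup>2) \<le> (\<Sum>j<L. g j / h j * (cmod (v j))\<^sup>2)" if "g \<in> tfuns" for g L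
    using tfuns_nonneg[OF that] h(2) by (intro sum_mono mult_left_mono power_mono assms) auto
  moreover have "w j \<noteq> 0 \<Longrightarrow> v j \<noteq> 0" for j using assms(2)[of j] by auto
  ultimately show ?thesis using assms(1) unfolding good_def by (meson order_trans)
qed

text \<open>Up to unimodular factors these are the boundary values of v h^(z - 1/2) on the lines Re
  z = 0 and Re z = 1.\<close>

lemma good_factors:
  assumes "good h M v"
  shows "(\<lambda>j. v j / of_real (sqrt (h j))) \<in> T2" "T2N (\<lambda>j. v j / of_real (sqrt (h j))) \<le> M"
    "(\<lambda>j. v j * of_real (sqrt (h j))) \<in> T2D" "T2DN (\<lambda>j. v j * of_real (sqrt (h j))) \<le> M"
proof -
  have h: "h \<in> wball" "\<And>j. 0 \<le> h j" "0 \<le> M" using assms wballD(1) by (auto simp: good_def)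
  have W: "(\<Sum>j<L. g j * (cmod (v j / of_real (sqrt (h j))))\<^sup>2) \<le> M\<^sup>2" if "g \<in> tfuns" for g L
  proof -
    have "(\<Sum>j<L. g j * (cmod (v j / of_real (sqrt (h j))))\<^sup>2) = (\<Sum>j<L. g j / h j * (cmod (v j))\<^sup>2)"
      using h by (intro sum.cong) (auto simp: norm_divide power_divide)
    then show ?thesis using assms that by (simp add: good_def)
  qed
  show "(\<lambda>j. v j / of_real (sqrt (h j))) \<in> T2" by (rule T2N_weights(1)[OF h(3)]) (rule W)
  show "T2N (\<lambda>j. v j / of_real (sqrt (h j))) \<le> M" by (rule T2N_weights(2)[OF h(3)]) (rule W)
  show "(\<lambda>j. v j * of_real (sqrt (h j))) \<in> T2D" "T2DN (\<lambda>j. v j * of_real (sqrt (h j))) \<le> M"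
    by (rule T2D_weight[OF h(1) _ h(3)], use assms in \<open>simp add: good_def\<close>)+
qed

text \<open>In T2 every element has vanishing tails. In the dual no such general fact is invoked:
  the factor sqrt h reduces the question to the square-summable tails of v.\<close>

lemma good_tails:
  assumes "good h M v"
  shows "(\<lambda>n. T2N (\<lambda>j. if n \<le> j then v j / of_real (sqrt (h j)) else 0)) \<longlonglongrightarrow> 0"
    "(\<lambda>n. T2DN (\<lambda>j. if n \<le> j then v j * of_real (sqrt (h j)) else 0)) \<longlonglongrightarrow> 0"
proof -
  show "(\<lambda>n. T2N (\<lambda>j. if n \<le> j then v j / of_real (sqrt (h j)) else 0)) \<longlonglongrightarrow> 0"
    by (rule T2_tail) (rule good_factors[OF assms])
  have h: "h \<in> wball" and b: "\<And>L. (\<Sum>j<L. (cmod (v j))\<^sup>2) \<le> M\<^sup>2" using assms by (auto simp: good_def)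
  have summ: "summable (\<lambda>j. (cmod (v j))\<^sup>2)"
    by (rule bounded_imp_summable[of _ "M\<^sup>2"]) (use b[of "Suc _"] in \<open>auto simp: lessThan_Suc_atMost\<close>)
  define r where "r n = (\<Sum>j. (cmod (v (j + n)))\<^sup>2)" for n
  have r0: "r \<longlonglongrightarrow> 0" unfolding r_def using suminf_exist_split2[OF summ] by simp
  have summ': "summable (\<lambda>j. (cmod (v (j + n)))\<^sup>2)" for n using summable_ignore_initial_segment[OF summ] by simp
  have le: "(\<lambda>j. if n \<le> j then v j * of_real (sqrt (h j)) else 0) \<in> T2D \<and>
      T2DN (\<lambda>j. if n \<le> j then v j * of_real (sqrt (h j)) else 0) \<le> sqrt (r n)" for n
  proof -
    define w where "w j = (if n \<le> j then v j else 0)" for j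
    have "(\<Sum>j<L. (cmod (w j))\<^sup>2) \<le> (sqrt (r n))\<^sup>2" for L
    proof -
      have "(\<Sum>j<L. (cmod (w j))\<^sup>2) \<le> (\<Sum>j<n + L. (cmod (w j))\<^sup>2)" by (intro sum_mono2) auto
      also have "\<dots> = (\<Sum>j\<in>{n..<n + L}. (cmod (v j))\<^sup>2)" by (intro sum.mono_neutral_cong_right) (auto simp: w_def)
      also have "\<dots> = (\<Sum>j<L. (cmod (v (j + n)))\<^sup>2)"
        by (rule sum.reindex_bij_witness[of _ "\<lambda>j. j + n" "\<lambda>j. j - n"]) auto
      also have "\<dots> \<le> r n" unfolding r_def by (rule sum_le_suminf[OF summ']) auto
      also have "r n = (sqrt (r n))\<^sup>2" unfolding r_def using suminf_nonneg[OF summ'] by simp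
      finally show ?thesis .
    qed
    moreover have "0 \<le> sqrt (r n)" unfolding r_def using suminf_nonneg[OF summ'] by simp
    ultimately have "(\<lambda>j. w j * of_real (sqrt (h j))) \<in> T2D" "T2DN (\<lambda>j. w j * of_real (sqrt (h j))) \<le> sqrt (r n)"
      using T2D_weight[OF h] by blast+
    moreover have "(\<lambda>j. w j * of_real (sqrt (h j))) = (\<lambda>j. if n \<le> j then v j * of_real (sqrt (h j)) else 0)"
      by (auto simp: w_def)
    ultimately show ?thesis by simp
  qed
  show "(\<lambda>n. T2DN (\<lambda>j. if n \<le> j then v j * of_real (sqrt (h j)) else 0)) \<longlonglongrightarrow> 0"
  proof (rule Lim_null_comparison)
    show "eventually (\<lambda>n. norm (T2DN (\<lambda>j. if n \<le> j then v j * of_real (sqrt (h j)) else 0)) \<le> sqrt (r n)) sequentially"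
      using le T2D.nonneg by (intro always_eventually) simp
    show "(\<lambda>n. sqrt (r n)) \<longlonglongrightarrow> 0" using tendsto_real_sqrt[OF r0] by simp
  qed
qed

text \<open>A damping factor with value 1 and derivative 0 at 1/2. It gives the decay at infinity
  that boundary functions must have without disturbing the represented pair.\<close>

definition damp :: "complex \<Rightarrow> complex" where
  "damp z = exp ((z - 1/2)\<^sup>2)"

text \<open>One decaying bound serves both multipliers: |p| is at most sqrt (1 + t^2), while the
  Gaussian is at most 2 / (1 + t^2), the 2 bounding exp (1/4).\<close>

lemma damp_bound:
  assumes z: "z \<in> strip" and p: "p = 1 \<or> p = z - 1/2"
  shows "cmod (p * damp z) \<le> 2 / sqrt (1 + (Im z)\<^sup>2)"
proof -
  define t where "t = Im z"
  have x: "(Re z - 1/2)\<^sup>2 \<le> (1/2)\<^sup>2"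
  proof -
    have "\<bar>Re z - 1/2\<bar> \<le> 1/2" using z unfolding strip_def mem_Collect_eq by linarith
    then have "\<bar>Re z - 1/2\<bar>\<^sup>2 \<le> (1/2)\<^sup>2" by (rule power_mono) simp
    then show ?thesis by (simp only: power2_abs)
  qed
  have "cmod (damp z) = exp ((Re z - 1/2)\<^sup>2 - t\<^sup>2)"
    by (simp add: damp_def norm_exp_eq_Re power2_eq_square t_def)
  also have "\<dots> \<le> exp (1/4 - t\<^sup>2)" using x by (simp add: power2_eq_square)
  also have "\<dots> = exp (1/4) * inverse (exp (t\<^sup>2))" by (simp only: exp_diff divide_inverse)
  also have "\<dots> \<le> 2 * inverse (1 + t\<^sup>2)"
  proof (intro mult_mono)
    show "exp (1/4) \<le> (2::real)" using exp_bound_half[of "1/4::real"] by simp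
    show "inverse (exp (t\<^sup>2)) \<le> inverse (1 + t\<^sup>2)"
      by (rule le_imp_inverse_le[OF exp_ge_add_one_self]) (simp add: add_pos_nonneg)
  qed auto
  finally have d: "cmod (damp z) \<le> 2 / (1 + t\<^sup>2)" by (simp only: divide_inverse)
  have "(cmod p)\<^sup>2 \<le> 1 + t\<^sup>2"
    using p
  proof
    assume "p = z - 1/2"
    then have "(cmod p)\<^sup>2 = (Re z - 1/2)\<^sup>2 + t\<^sup>2" by (simp add: cmod_power2 t_def)
    then show ?thesis using x by (simp add: power2_eq_square)
  qed simp
  then have "cmod p \<le> sqrt (1 + t\<^sup>2)" by (rule real_le_rsqrt)
  then have "cmod p * cmod (damp z) \<le> sqrt (1 + t\<^sup>2) * (2 / (1 + t\<^sup>2))"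
    using d by (intro mult_mono) auto
  also have "\<dots> = 2 / sqrt (1 + t\<^sup>2)"
  proof -
    define s where "s = sqrt (1 + t\<^sup>2)"
    have "0 < s" "1 + t\<^sup>2 = s * s" by (simp_all add: s_def add_pos_nonneg)
    then show ?thesis unfolding s_def[symmetric] by (simp only: \<open>1 + t\<^sup>2 = s * s\<close>) (simp add: field_simps)
  qed
  finally show ?thesis by (simp add: norm_mult t_def)
qed

lemma damp_decay: "((\<lambda>t. 2 / sqrt (1 + t\<^sup>2)) \<longlongrightarrow> 0) at_infinity"
proof (rule Lim_null_comparison)
  have "norm (2 / sqrt (1 + t\<^sup>2)) \<le> 2 * norm (inverse t)" if "1 \<le> norm t" for t :: real
  proof -
    have "\<bar>t\<bar> = sqrt (t\<^sup>2)" by simp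
    also have "\<dots> \<le> sqrt (1 + t\<^sup>2)" by (intro real_sqrt_le_mono) simp
    finally have "inverse (sqrt (1 + t\<^sup>2)) \<le> inverse \<bar>t\<bar>" using that by (intro le_imp_inverse_le) auto
    then show ?thesis by (simp add: divide_inverse)
  qed
  then show "eventually (\<lambda>t::real. norm (2 / sqrt (1 + t\<^sup>2)) \<le> 2 * norm (inverse t)) at_infinity"
    unfolding eventually_at_infinity by blast
  have "((\<lambda>t::real. 2 * norm (inverse t)) \<longlongrightarrow> 2 * norm (0::real)) at_infinity"
    by (intro tendsto_intros tendsto_inverse_0)
  then show "((\<lambda>t::real. 2 * norm (inverse t)) \<longlongrightarrow> 0) at_infinity" by simp
qed

lemma exp_ln_half:
  assumes "0 < x"
  shows "exp ((\<i> * of_real t - 1/2) * of_real (ln x)) = exp (\<i> * of_real (t * ln x)) / of_real (sqrt x)"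
    "exp ((1 + \<i> * of_real t - 1/2) * of_real (ln x)) = exp (\<i> * of_real (t * ln x)) * of_real (sqrt x)"
    "exp ((1/2 - \<i> * of_real t) * of_real (ln x)) = exp (- \<i> * of_real (t * ln x)) * of_real (sqrt x)"
    "exp ((1/2 - (1 + \<i> * of_real t)) * of_real (ln x)) = exp (- \<i> * of_real (t * ln x)) / of_real (sqrt x)"
proof -
  have s: "exp (of_real (ln x / 2)) = complex_of_real (sqrt x)"
  proof -
    have "exp (ln x / 2) = sqrt x"
    proof (rule real_sqrt_unique[symmetric])
      have "(exp (ln x / 2))\<^sup>2 = exp (ln x / 2 + ln x / 2)" by (simp add: power2_eq_square exp_add[symmetric])
      then show "(exp (ln x / 2))\<^sup>2 = x" using assms by simp
    qed simp
    then show ?thesis by (simp only: exp_of_real)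
  qed
  have 1: "(\<i> * of_real t - 1/2) * of_real (ln x) = \<i> * of_real (t * ln x) - of_real (ln x / 2)"
    "(1 + \<i> * of_real t - 1/2) * of_real (ln x) = \<i> * of_real (t * ln x) + of_real (ln x / 2)"
    "(1/2 - \<i> * of_real t) * of_real (ln x) = - \<i> * of_real (t * ln x) + of_real (ln x / 2)"
    "(1/2 - (1 + \<i> * of_real t)) * of_real (ln x) = - \<i> * of_real (t * ln x) - of_real (ln x / 2)"
    by (simp_all add: algebra_simps)
  show "exp ((\<i> * of_real t - 1/2) * of_real (ln x)) = exp (\<i> * of_real (t * ln x)) / of_real (sqrt x)"
    "exp ((1 + \<i> * of_real t - 1/2) * of_real (ln x)) = exp (\<i> * of_real (t * ln x)) * of_real (sqrt x)"
    "exp ((1/2 - \<i> * of_real t) * of_real (ln x)) = exp (- \<i> * of_real (t * ln x)) * of_real (sqrt x)"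
    "exp ((1/2 - (1 + \<i> * of_real t)) * of_real (ln x)) = exp (- \<i> * of_real (t * ln x)) / of_real (sqrt x)"
    unfolding 1 exp_add exp_diff s by simp_all
qed

lemma strip_exp_bound:
  assumes "z \<in> strip"
  shows "cmod (exp ((z - 1/2) * of_real x)) \<le> exp (\<bar>x\<bar>)" "cmod (exp ((1/2 - z) * of_real x)) \<le> exp (\<bar>x\<bar>)"
proof -
  have a: "\<bar>Re z - 1/2\<bar> \<le> 1" "\<bar>1/2 - Re z\<bar> \<le> 1" using assms by (auto simp: strip_def abs_le_iff)
  have "\<bar>(Re z - 1/2) * x\<bar> \<le> 1 * \<bar>x\<bar>" "\<bar>(1/2 - Re z) * x\<bar> \<le> 1 * \<bar>x\<bar>"
    unfolding abs_mult by (intro mult_right_mono a abs_ge_zero)+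
  then show "cmod (exp ((z - 1/2) * of_real x)) \<le> exp (\<bar>x\<bar>)" "cmod (exp ((1/2 - z) * of_real x)) \<le> exp (\<bar>x\<bar>)"
    by (simp_all add: norm_exp_eq_Re)
qed

text \<open>On either line the family is the corresponding vector of \<open>good_factors\<close>
  times bounded, coordinatewise continuous multipliers, so \<open>boundary_mult\<close> applies. The
  factor 2 is that of \<open>damp_bound\<close>.\<close>

lemma chart_FC:
  assumes v: "good h M v" and q: "q = (\<lambda>z. damp z) \<or> q = (\<lambda>z. (z - 1/2) * damp z)"
  defines "F \<equiv> \<lambda>z j. q z * (v j * exp ((z - 1/2) * of_real (ln (h j))))"
  shows "F \<in> ZT.FC" "ZT.FN F \<le> 2 * M"
proof -
  have q_le: "cmod (q z) \<le> 2 / sqrt (1 + (Im z)\<^sup>2)" if "z \<in> strip" for z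
    using damp_bound[OF that, of 1] damp_bound[OF that, of "z - 1/2"] q by auto
  have le2: "2 / sqrt (1 + t\<^sup>2) \<le> (2::real)" for t :: real by (simp add: field_simps add_pos_nonneg)
  have q2: "cmod (q z) \<le> 2" if "z \<in> strip" for z using q_le[OF that] le2 order_trans by blast
  have qhol: "q holomorphic_on A" for A using q by (auto simp: damp_def[abs_def] intro!: holomorphic_intros)
  have qcont: "continuous_on A q" for A using holomorphic_on_imp_continuous_on[OF qhol] .
  have pos: "0 < h j" if "v j \<noteq> 0" for j using v that by (simp add: good_def)
  have M: "0 \<le> M" using v by (simp add: good_def)
  have F0: "F (\<i> * of_real t) = (\<lambda>j. (q (\<i> * of_real t) * exp (\<i> * of_real (t * ln (h j)))) * (v j / of_real (sqrt (h j))))" for t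
  proof
    fix j show "F (\<i> * of_real t) j = (q (\<i> * of_real t) * exp (\<i> * of_real (t * ln (h j)))) * (v j / of_real (sqrt (h j)))"
    proof (cases "v j = 0")
      case False
      show ?thesis unfolding F_def exp_ln_half(1)[OF pos[OF False]] by simp
    qed (simp add: F_def)
  qed
  have F1: "F (1 + \<i> * of_real t) = (\<lambda>j. (q (1 + \<i> * of_real t) * exp (\<i> * of_real (t * ln (h j)))) * (v j * of_real (sqrt (h j))))" for t
  proof
    fix j show "F (1 + \<i> * of_real t) j = (q (1 + \<i> * of_real t) * exp (\<i> * of_real (t * ln (h j)))) * (v j * of_real (sqrt (h j)))"
    proof (cases "v j = 0")
      case False
      show ?thesis unfolding F_def exp_ln_half(2)[OF pos[OF False]] by simp
    qed (simp add: F_def)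
  qed
  have qi: "cmod (q (\<i> * of_real t) * exp (\<i> * of_real (t * ln (h j)))) \<le> 2 / sqrt (1 + t\<^sup>2)" for t j
    using q_le[of "\<i> * of_real t"] by (simp add: norm_mult strip_def)
  have q1: "cmod (q (1 + \<i> * of_real t) * exp (\<i> * of_real (t * ln (h j)))) \<le> 2 / sqrt (1 + t\<^sup>2)" for t j
    using q_le[of "1 + \<i> * of_real t"] by (simp add: norm_mult strip_def)
  have qc: "continuous_on UNIV (\<lambda>t. q (\<i> * of_real t))" "continuous_on UNIV (\<lambda>t. q (1 + \<i> * of_real t))"
    by (rule continuous_on_compose2[OF qcont[of UNIV]]; auto intro!: continuous_intros)+
  have c0: "isCont (\<lambda>t. q (\<i> * of_real t) * exp (\<i> * of_real (t * ln (h j)))) t"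
    and c1: "isCont (\<lambda>t. q (1 + \<i> * of_real t) * exp (\<i> * of_real (t * ln (h j)))) t" for j t
    using qc by (auto intro!: continuous_intros simp: continuous_on_eq_continuous_at)
  note m0 = T2.boundary_mult[OF good_factors(1)[OF v] good_tails(1)[OF v] qi le2 damp_decay c0]
  note m1 = T2D.boundary_mult[OF good_factors(3)[OF v] good_tails(2)[OF v] q1 le2 damp_decay c1]
  show "F \<in> ZT.FC"
    unfolding Fclass_def mem_Collect_eq
  proof (intro conjI allI)
    fix j
    show "continuous_on strip (\<lambda>z. F z j)" unfolding F_def by (intro continuous_intros qcont)
    show "(\<lambda>z. F z j) holomorphic_on ostrip" unfolding F_def by (intro holomorphic_intros qhol)
    show "bounded ((\<lambda>z. F z j) ` strip)"
    proof (rule boundedI)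
      fix w assume "w \<in> (\<lambda>z. F z j) ` strip"
      then obtain z where z: "z \<in> strip" "w = F z j" by blast
      show "cmod w \<le> 2 * (cmod (v j) * exp (\<bar>ln (h j)\<bar>))"
        unfolding z(2) F_def norm_mult by (intro mult_mono q2 strip_exp_bound z) auto
    qed
  next
    show "boundary_ok T2 T2N (\<lambda>t. F (\<i> * of_real t))" unfolding F0 by (rule m0(1))
    show "boundary_ok T2D T2DN (\<lambda>t. F (1 + \<i> * of_real t))" unfolding F1 by (rule m1(1))
  qed
  show "ZT.FN F \<le> 2 * M"
  proof (rule ZT.FN_le)
    fix t
    have "T2N (F (\<i> * of_real t)) \<le> 2 / sqrt (1 + t\<^sup>2) * T2N (\<lambda>j. v j / of_real (sqrt (h j)))" unfolding F0 by (rule m0(2))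
    also have "\<dots> \<le> 2 * M" using le2 good_factors[OF v] T2.nonneg by (intro mult_mono) auto
    finally show "T2N (F (\<i> * of_real t)) \<le> 2 * M" .
    have "T2DN (F (1 + \<i> * of_real t)) \<le> 2 / sqrt (1 + t\<^sup>2) * T2DN (\<lambda>j. v j * of_real (sqrt (h j)))" unfolding F1 by (rule m1(2))
    also have "\<dots> \<le> 2 * M" using le2 good_factors[OF v] T2D.nonneg by (intro mult_mono) auto
    finally show "T2DN (F (1 + \<i> * of_real t)) \<le> 2 * M" .
  qed
qed

text \<open>The family v h^(z - 1/2) has value v and derivative v ln h at 1/2. The extra factor z -
  1/2 turns these into 0 and v, so the subspace and the quotient of the twisted sum are both
  reached.\<close>

lemma chart:
  assumes v: "good h M v"
  shows "(\<lambda>j. v j * of_real (ln (h j)), v) \<in> ZT2 \<and> ZT2N (\<lambda>j. v j * of_real (ln (h j)), v) \<le> 2 * M"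
    "(v, \<lambda>_. 0) \<in> ZT2 \<and> ZT2N (v, \<lambda>_. 0) \<le> 2 * M"
proof -
  have d: "((\<lambda>z. damp z * (v j * exp ((z - 1/2) * of_real (ln (h j))))) has_field_derivative v j * of_real (ln (h j))) (at (1/2))" for j
    unfolding damp_def by (auto intro!: derivative_eq_intros)
  have "represents (of_real (1/2)) (\<lambda>z j. damp z * (v j * exp ((z - 1/2) * of_real (ln (h j))))) (\<lambda>j. v j * of_real (ln (h j)), v)"
    unfolding ZT.represents_iff using DERIV_imp_deriv[OF d] by (simp add: damp_def)
  then show "(\<lambda>j. v j * of_real (ln (h j)), v) \<in> ZT2 \<and> ZT2N (\<lambda>j. v j * of_real (ln (h j)), v) \<le> 2 * M"
    using ZT.ZI chart_FC[OF v, of damp] unfolding ZT2_eq by (meson order_trans)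
  have d: "((\<lambda>z. ((z - 1/2) * damp z) * (v j * exp ((z - 1/2) * of_real (ln (h j))))) has_field_derivative v j) (at (1/2))" for j
    unfolding damp_def by (auto intro!: derivative_eq_intros)
  have "represents (of_real (1/2)) (\<lambda>z j. ((z - 1/2) * damp z) * (v j * exp ((z - 1/2) * of_real (ln (h j))))) (v, \<lambda>_. 0)"
    unfolding ZT.represents_iff using DERIV_imp_deriv[OF d] by simp
  then show "(v, \<lambda>_. 0) \<in> ZT2 \<and> ZT2N (v, \<lambda>_. 0) \<le> 2 * M"
    using ZT.ZI chart_FC[OF v, of "\<lambda>z. (z - 1/2) * damp z"] unfolding ZT2_eq by (meson order_trans)
qed

text \<open>Pairing an analytic family through an element of \<open>Z(T\<^sup>2)\<close> with \<open>z \<mapsto> v h\<^sup>1\<^sup>/\<^sup>2\<^sup>-\<^sup>z\<close> gives a scalar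
  function that is bounded on the strip; its value and derivative at \<open>1/2\<close> are estimated.\<close>
lemma pairing:
  assumes p: "p \<in> ZT2" and v: "good h M v"
  shows "cmod (\<Sum>j<L. v j * snd p j) \<le> M * ZT2N p"
    "cmod (\<Sum>j<L. v j * (fst p j - snd p j * of_real (ln (h j)))) \<le> 2 * M * ZT2N p"
proof -
  have M: "0 \<le> M" using v by (simp add: good_def)
  have pos: "0 < h j" if "v j \<noteq> 0" for j using v that by (simp add: good_def)
  have *: "cmod (\<Sum>j<L. v j * snd p j) \<le> M * (ZT2N p + e) \<and>
     cmod (\<Sum>j<L. v j * (fst p j - snd p j * of_real (ln (h j)))) \<le> 2 * (M * (ZT2N p + e))" if e: "0 < e" for e
  proof -
    obtain F where F: "F \<in> ZT.FC" "represents (of_real (1/2)) F p" "ZT.FN F < ZT2N p + e"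
      using ZT.ZE[OF _ e] p unfolding ZT2_eq by blast
    \<comment> \<open>The exponent is reflected so that H lies in the dual where F lies in T2 and
      conversely; on both lines the pairing is then bounded by M times the norm of F.\<close>
    define H where "H z j = v j * exp ((1/2 - z) * of_real (ln (h j)))" for z j
    define \<phi> where "\<phi> z = (\<Sum>j<L. F z j * H z j)" for z
    have mid: "1/2 \<in> strip" by (simp add: strip_def)
    have cont: "continuous_on strip \<phi>" unfolding \<phi>_def H_def by (intro continuous_intros ZT.FCD[OF F(1)])
    have hol: "\<phi> holomorphic_on ostrip" unfolding \<phi>_def H_def by (intro holomorphic_intros ZT.FCD[OF F(1)])
    have bdd: "bounded (\<phi> ` strip)"
    proof (rule boundedI)
      fix w assume "w \<in> \<phi> ` strip"
      then obtain z where z: "z \<in> strip" "w = \<phi> z" by blast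
      show "cmod w \<le> (\<Sum>j<L. ZT.FN F * (cmod (v j) * exp (\<bar>ln (h j)\<bar>)))"
        unfolding z(2) \<phi>_def H_def
      proof (rule sum_norm_le)
        fix j
        show "cmod (F z j * (v j * exp ((1/2 - z) * of_real (ln (h j))))) \<le> ZT.FN F * (cmod (v j) * exp (\<bar>ln (h j)\<bar>))"
          unfolding norm_mult
          by (intro mult_mono ZT.FC_coord F strip_exp_bound z) (auto simp: ZT.FN_nonneg F)
      qed
    qed
    have H0: "cmod (H (\<i> * of_real t) j) \<le> 1 * cmod (v j * of_real (sqrt (h j)))" for t j
    proof (cases "v j = 0")
      case False
      show ?thesis unfolding H_def exp_ln_half(3)[OF pos[OF False]] by (simp add: norm_mult)
    qed (simp add: H_def)
    have H1: "cmod (H (1 + \<i> * of_real t) j) \<le> 1 * cmod (v j / of_real (sqrt (h j)))" for t j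
    proof (cases "v j = 0")
      case False
      show ?thesis unfolding H_def exp_ln_half(4)[OF pos[OF False]] by (simp add: norm_mult norm_divide)
    qed (simp add: H_def)
    have "cmod (\<phi> (\<i> * of_real t)) \<le> M * ZT.FN F" for t
    proof -
      have HD: "H (\<i> * of_real t) \<in> T2D" "T2DN (H (\<i> * of_real t)) \<le> M"
        using T2D.solid[OF good_factors(3)[OF v] zero_le_one H0[of t]] good_factors(4)[OF v] by linarith+
      have FT: "F (\<i> * of_real t) \<in> T2" by (rule ZT.FCD[OF F(1)])
      have "cmod (\<phi> (\<i> * of_real t)) \<le> T2DN (H (\<i> * of_real t)) * t2norm (trunc L (F (\<i> * of_real t)))"
        unfolding \<phi>_def by (rule T2D_ge[OF HD(1)])
      also have "\<dots> \<le> M * ZT.FN F"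
        using HD M T2N_LIMSEQ(2)[OF FT, of L] ZT.FN_bound(1)[OF F(1), of t] t2norm_trunc_nonneg
        by (intro mult_mono) linarith+
      finally show ?thesis .
    qed
    moreover have "cmod (\<phi> (1 + \<i> * of_real t)) \<le> M * ZT.FN F" for t
    proof -
      have HT: "H (1 + \<i> * of_real t) \<in> T2" "T2N (H (1 + \<i> * of_real t)) \<le> M"
        using T2.solid[OF good_factors(1)[OF v] zero_le_one H1[of t]] good_factors(2)[OF v] by linarith+
      have FD: "F (1 + \<i> * of_real t) \<in> T2D" by (rule ZT.FCD[OF F(1)])
      have "cmod (\<phi> (1 + \<i> * of_real t)) = cmod (\<Sum>j<L. H (1 + \<i> * of_real t) j * F (1 + \<i> * of_real t) j)"
        by (simp add: \<phi>_def mult.commute)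
      also have "\<dots> \<le> T2DN (F (1 + \<i> * of_real t)) * t2norm (trunc L (H (1 + \<i> * of_real t)))"
        by (rule T2D_ge[OF FD])
      also have "\<dots> \<le> ZT.FN F * M"
        using HT M T2N_LIMSEQ(2)[OF HT(1), of L] ZT.FN_bound(2)[OF F(1), of t] t2norm_trunc_nonneg ZT.FN_nonneg[OF F(1)]
        by (intro mult_mono) linarith+
      finally show ?thesis by (simp add: mult.commute)
    qed
    ultimately have le: "cmod (\<phi> z) \<le> M * ZT.FN F" if "z \<in> strip" for z
      using three_lines[OF cont bdd hol] that by blast
    have MF: "M * ZT.FN F \<le> M * (ZT2N p + e)" using F(3) M by (intro mult_left_mono) auto
    have pF: "fst p = (\<lambda>j. deriv (\<lambda>z. F z j) (1/2))" "snd p = F (1/2)"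
      using F(2) unfolding ZT.represents_iff by simp_all
    have Fd: "((\<lambda>z. F z j) has_field_derivative fst p j) (at (1/2))" for j
      unfolding pF by (intro field_differentiable_derivI ZT.FC_field_differentiable F)
    have Fv: "F (1/2) j = snd p j" for j by (simp add: pF)
    have v1: "\<phi> (1/2) = (\<Sum>j<L. v j * snd p j)" by (simp add: \<phi>_def H_def Fv mult.commute)
    have "(\<phi> has_field_derivative (\<Sum>j<L. v j * (fst p j - snd p j * of_real (ln (h j))))) (at (1/2))"
      unfolding \<phi>_def H_def
      by (rule DERIV_sum) (auto intro!: derivative_eq_intros Fd simp: Fv algebra_simps)
    then have d1: "deriv \<phi> (1/2) = (\<Sum>j<L. v j * (fst p j - snd p j * of_real (ln (h j))))" by (rule DERIV_imp_deriv)
    have "cmod (\<phi> (1/2)) \<le> M * (ZT2N p + e)" using le[OF mid] MF by linarith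
    moreover have "cmod (deriv \<phi> (1/2)) \<le> 2 * (M * ZT.FN F)" by (rule strip_deriv[OF cont hol le])
    then have "cmod (deriv \<phi> (1/2)) \<le> 2 * (M * (ZT2N p + e))" using MF by linarith
    ultimately show ?thesis unfolding v1 d1 by (rule conjI)
  qed
  have **: "((\<lambda>e. c * (ZT2N p + e)) \<longlongrightarrow> c * ZT2N p) (at_right 0)" for c
  proof -
    have "((\<lambda>e. c * (ZT2N p + e)) \<longlongrightarrow> c * (ZT2N p + 0)) (at_right 0)" by (intro tendsto_intros)
    then show ?thesis by simp
  qed
  show "cmod (\<Sum>j<L. v j * snd p j) \<le> M * ZT2N p"
    by (rule tendsto_lowerbound[OF **[of M]]) (use * in \<open>auto intro!: eventually_at_rightI[of 0 1]\<close>)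
  show "cmod (\<Sum>j<L. v j * (fst p j - snd p j * of_real (ln (h j)))) \<le> 2 * M * ZT2N p"
    by (rule tendsto_lowerbound[OF **[of "2 * M"]]) (use * in \<open>auto intro!: eventually_at_rightI[of 0 1] simp: mult.assoc\<close>)
qed

text \<open>Goodness depends only on the moduli of v, so v may be given phases that make every term
  of the pairing nonnegative. The absolute bound yields convergence of the infinite pairings used
  later.\<close>

lemma pairing_abs:
  assumes p: "p \<in> ZT2" and v: "good h M v"
  shows "(\<Sum>j<L. cmod (v j * (fst p j - snd p j * of_real (ln (h j))))) \<le> 2 * M * ZT2N p"
proof -
  define d where "d j = v j * (fst p j - snd p j * of_real (ln (h j)))" for j
  define w where "w j = cnj (sgn (d j)) * v j" for j
  have "good h M w"
    by (rule good_solid[OF v]) (auto simp: w_def norm_mult norm_sgn)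
  from pairing(2)[OF p this, of L]
  have "cmod (\<Sum>j<L. cnj (sgn (d j)) * d j) \<le> 2 * M * ZT2N p" by (simp add: w_def d_def mult.assoc)
  moreover have "cnj (sgn (d j)) * d j = of_real (cmod (d j))" for j
  proof (cases "d j = 0")
    case False
    have "cnj (sgn (d j)) * d j = d j * cnj (d j) / of_real (cmod (d j))" by (simp add: sgn_eq)
    also have "\<dots> = of_real ((cmod (d j))\<^sup>2) / of_real (cmod (d j))" by (simp only: complex_norm_square)
    finally show ?thesis using False by (simp add: power2_eq_square)
  qed simp
  ultimately have "cmod (of_real (\<Sum>j<L. cmod (d j))) \<le> 2 * M * ZT2N p" by simp
  then show ?thesis by (simp add: d_def sum_nonneg del: of_real_sum)
qed

text \<open>Lozanovskii's theorem for \<rho> = |v|^2: every finitely supported vector is good for a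
  weight of its own, with constant equal to its l_2 norm.\<close>

lemma good_trunc:
  obtains h where "good h (sqrt (\<Sum>j<L. (cmod (v j))\<^sup>2)) (trunc L v)"
proof -
  define \<rho> where "\<rho> j = (cmod (trunc L v j))\<^sup>2" for j
  have fin: "\<rho> j = 0" if "j \<notin> {..<L}" for j using that by (simp add: \<rho>_def trunc_def)
  have \<rho>: "\<And>j. 0 \<le> \<rho> j" "summable \<rho>" using summable_finite[of "{..<L}" \<rho>] fin by (auto simp: \<rho>_def)
  have "suminf \<rho> = (\<Sum>j<L. \<rho> j)" using fin by (intro suminf_finite) auto
  also have "\<dots> = (\<Sum>j<L. (cmod (v j))\<^sup>2)" by (rule sum.cong) (auto simp: \<rho>_def trunc_def)
  finally have s: "suminf \<rho> = (\<Sum>j<L. (cmod (v j))\<^sup>2)" .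
  obtain h where h: "h \<in> wball" "\<And>j. 0 < \<rho> j \<Longrightarrow> 0 < h j"
    "\<And>g L. g \<in> wball \<Longrightarrow> (\<Sum>j<L. \<rho> j * (g j / h j)) \<le> suminf \<rho>" using lozanovskii[OF \<rho>] by metis
  have "(\<Sum>j<L'. g j / h j * (cmod (trunc L v j))\<^sup>2) \<le> suminf \<rho>" if "g \<in> tfuns" for g L'
    using h(3)[of g L'] that tfuns_wball by (auto simp: \<rho>_def mult.commute)
  moreover have "(\<Sum>j<L'. (cmod (trunc L v j))\<^sup>2) \<le> suminf \<rho>" for L'
    unfolding \<rho>_def[symmetric] by (rule sum_le_suminf[OF \<rho>(2)]) (auto simp: \<rho>)
  ultimately have "good h (sqrt (suminf \<rho>)) (trunc L v)"
    unfolding good_def using h(1,2) suminf_nonneg[OF \<rho>(2)] \<rho>(1) by (auto simp: \<rho>_def)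
  then show ?thesis using that s by simp
qed

section \<open>Square-summability of components\<close>

lemma ZT2_nonneg: "p \<in> ZT2 \<Longrightarrow> 0 \<le> ZT2N p"
  unfolding ZT2_eq by (rule ZT.Z_nonneg)

text \<open>The element is paired with the conjugate of a truncation of its own second component. If
  S is the partial sum, this gives S \<le> sqrt S times the norm.\<close>

lemma ZT2_snd_l2:
  assumes p: "p \<in> ZT2"
  shows "(\<Sum>j<L. (cmod (snd p j))\<^sup>2) \<le> (ZT2N p)\<^sup>2"
proof -
  define S where "S = (\<Sum>j<L. (cmod (snd p j))\<^sup>2)"
  have S0: "0 \<le> S" by (simp add: S_def sum_nonneg)
  obtain h where h: "good h (sqrt (\<Sum>j<L. (cmod (cnj (snd p j)))\<^sup>2)) (trunc L (\<lambda>j. cnj (snd p j)))"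
    by (rule good_trunc)
  have eq: "(\<Sum>j<L. trunc L (\<lambda>j. cnj (snd p j)) j * snd p j) = of_real S"
    unfolding S_def of_real_sum
    by (rule sum.cong) (auto simp: trunc_def mult.commute complex_norm_square simp del: of_real_power)
  have "S \<le> sqrt S * ZT2N p" using pairing(1)[OF p h, of L] S0
    unfolding eq complex_mod_cnj S_def[symmetric] by simp
  then have "sqrt S * sqrt S \<le> sqrt S * ZT2N p" using S0 by simp
  then have "sqrt S \<le> ZT2N p"
  proof (cases "S = 0")
    case False
    then have "0 < sqrt S" using S0 by simp
    then show ?thesis using \<open>sqrt S * sqrt S \<le> _\<close> by (simp only: mult_le_cancel_left_pos)
  qed (use ZT2_nonneg[OF p] in simp)
  then show ?thesis unfolding S_def[symmetric] by (rule sqrt_le_D)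
qed

text \<open>When the second component is 0, the logarithm drops out of the derivative of the
  pairing, and the same test works; the factor 2 is that of \<open>pairing\<close>.\<close>

lemma ZT2_fst_l2:
  assumes p: "(u, \<lambda>_. 0) \<in> ZT2"
  shows "(\<Sum>j<L. (cmod (u j))\<^sup>2) \<le> (2 * ZT2N (u, \<lambda>_. 0))\<^sup>2"
proof -
  define S where "S = (\<Sum>j<L. (cmod (u j))\<^sup>2)"
  have S0: "0 \<le> S" by (simp add: S_def sum_nonneg)
  obtain h where h: "good h (sqrt (\<Sum>j<L. (cmod (cnj (u j)))\<^sup>2)) (trunc L (\<lambda>j. cnj (u j)))"
    by (rule good_trunc)
  have eq: "(\<Sum>j<L. trunc L (\<lambda>j. cnj (u j)) j * u j) = of_real S"
    unfolding S_def of_real_sum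
    by (rule sum.cong) (auto simp: trunc_def mult.commute complex_norm_square simp del: of_real_power)
  have "(\<Sum>j<L. trunc L (\<lambda>j. cnj (u j)) j * (fst (u, \<lambda>_. 0) j - snd (u, \<lambda>_. 0) j * of_real (ln (h j)))) = of_real S"
    using eq by simp
  then have "S \<le> 2 * sqrt S * ZT2N (u, \<lambda>_. 0)" using pairing(2)[OF p h, of L] S0
    unfolding complex_mod_cnj S_def[symmetric] by simp
  then have "sqrt S * sqrt S \<le> sqrt S * (2 * ZT2N (u, \<lambda>_. 0))" using S0 by simp
  then have "sqrt S \<le> 2 * ZT2N (u, \<lambda>_. 0)"
  proof (cases "S = 0")
    case False
    then have "0 < sqrt S" using S0 by simp
    then show ?thesis using \<open>sqrt S * sqrt S \<le> _\<close> by (simp only: mult_le_cancel_left_pos)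
  qed (use ZT2_nonneg[OF p] in simp)
  then show ?thesis unfolding S_def[symmetric] by (rule sqrt_le_D)
qed

section \<open>Linear algebra in the space of pairs of sequences\<close>

interpretation PV: vector_space pscale
  by unfold_locales (auto simp: pscale_def plus_prod_def plus_fun_def algebra_simps)

lemma padd_plus: "padd p q = p + q"
  by (simp add: padd_def plus_prod_def plus_fun_def)

lemma pzero_zero: "pzero = 0"
  by (simp add: pzero_def zero_prod_def zero_fun_def)

lemma pdiff_minus: "pdiff p q = p - q"
  by (simp add: pdiff_def minus_prod_def fun_diff_def)

lemma fst_sum_apply: "fst (\<Sum>i\<in>I. f i) j = (\<Sum>i\<in>I. fst (f i) j)"
  and snd_sum_apply: "snd (\<Sum>i\<in>I. f i) j = (\<Sum>i\<in>I. snd (f i) j)" for f :: "'a \<Rightarrow> pseq"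
  by (induction I rule: infinite_finite_induct) (auto simp: plus_prod_def zero_prod_def)

lemma pscale_apply: "fst (pscale c p) j = c * fst p j" "snd (pscale c p) j = c * snd p j"
  by (simp_all add: pscale_def)

lemma lincomb_sum: "lincomb c S = (\<Sum>b\<in>S. pscale (c b) b)"
  by (rule prod_eqI; rule ext) (simp_all add: lincomb_def fst_sum_apply snd_sum_apply pscale_apply)

lemma csubspace_iff: "csubspace E \<longleftrightarrow> PV.subspace E"
  by (simp add: csubspace_def PV.subspace_def padd_plus pzero_zero)

lemma cspan_eq: "cspan B = PV.span B"
  unfolding cspan_def PV.span_explicit lincomb_sum by blast

lemma cindep_iff: "cindep B \<longleftrightarrow> PV.independent B"
  unfolding cindep_def PV.independent_explicit_finite_subsets lincomb_sum pzero_zero by blast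

lemma has_cdim_iff:
  "has_cdim E n \<longleftrightarrow> PV.subspace E \<and> (\<exists>B. finite B \<and> card B = n \<and> PV.independent B \<and> PV.span B = E)"
  unfolding has_cdim_def cbasis_def csubspace_iff cindep_iff cspan_eq using PV.span_superset by blast

lemma has_cdim_subspace: "has_cdim E n \<Longrightarrow> PV.subspace E"
  by (simp add: has_cdim_iff)

lemma has_cdim_bound:
  assumes "has_cdim E n" "PV.independent B" "B \<subseteq> E"
  shows "finite B" "card B \<le> n"
  using assms PV.independent_span_bound unfolding has_cdim_iff by blast+

lemma has_cdim_sub:
  assumes E: "has_cdim E n" and E0: "PV.subspace E0" "E0 \<subseteq> E"
  shows "\<exists>m\<le>n. has_cdim E0 m"
proof -
  obtain B where B: "B \<subseteq> E0" "PV.independent B" "E0 \<subseteq> PV.span B"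
    by (rule PV.maximal_independent_subset)
  have "PV.span B = E0" using B PV.span_minimal[OF B(1) E0(1)] by blast
  moreover have "finite B" "card B \<le> n" using has_cdim_bound[OF E B(2)] B(1) E0(2) by blast+
  ultimately show ?thesis using E0(1) B(2) unfolding has_cdim_iff by blast
qed

text \<open>Linearity is asked only on E, because infinite sums such as inner products are additive
  only where they converge.\<close>

definition lin_on :: "pseq set \<Rightarrow> (pseq \<Rightarrow> complex) \<Rightarrow> bool" where
  "lin_on E f \<longleftrightarrow> (\<forall>x\<in>E. \<forall>y\<in>E. f (x + y) = f x + f y) \<and> (\<forall>c. \<forall>x\<in>E. f (pscale c x) = c * f x)"

lemma lin_on_subset: "lin_on E f \<Longrightarrow> E' \<subseteq> E \<Longrightarrow> lin_on E' f"
  unfolding lin_on_def by blast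

lemma lin_on_zero: "lin_on E f \<Longrightarrow> 0 \<in> E \<Longrightarrow> f 0 = 0"
  unfolding lin_on_def by (metis PV.scale_zero_left mult_zero_left)

lemma lin_on_sum:
  assumes f: "lin_on E f" and E: "PV.subspace E" and "finite I" "\<And>i. i \<in> I \<Longrightarrow> x i \<in> E"
  shows "f (\<Sum>i\<in>I. x i) = (\<Sum>i\<in>I. f (x i))"
  using assms(3,4)
proof (induction I rule: finite_induct)
  case empty
  then show ?case using lin_on_zero[OF f] PV.subspace_0[OF E] by simp
next
  case (insert i I)
  then have "(\<Sum>i\<in>I. x i) \<in> E" by (intro PV.subspace_sum[OF E]) auto
  then show ?case using insert f unfolding lin_on_def by simp
qed

lemma has_cdim_ker:
  assumes E: "has_cdim E n" and f: "lin_on E f"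
  shows "\<exists>m. has_cdim {x\<in>E. f x = 0} m \<and> n \<le> m + 1"
proof -
  have sub: "PV.subspace E" by (rule has_cdim_subspace[OF E])
  have "PV.subspace {x\<in>E. f x = 0}"
    using f lin_on_zero[OF f PV.subspace_0[OF sub]] sub
    unfolding PV.subspace_def lin_on_def by auto
  then obtain m where m: "has_cdim {x\<in>E. f x = 0} m" using has_cdim_sub[OF E, of "{x\<in>E. f x = 0}"] by blast
  then obtain B0 where B0: "finite B0" "card B0 = m" "PV.span B0 = {x\<in>E. f x = 0}" by (auto simp: has_cdim_iff)
  obtain B where B: "finite B" "card B = n" "PV.independent B" "PV.span B = E" using E by (auto simp: has_cdim_iff)
  have "\<exists>x. E \<subseteq> PV.span (insert x B0)"
  proof (cases "\<exists>x\<in>E. f x \<noteq> 0")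
    case True
    then obtain x where x: "x \<in> E" "f x \<noteq> 0" by blast
    have "y \<in> PV.span (insert x B0)" if y: "y \<in> E" for y
    proof -
      have yE: "y - pscale (f y / f x) x \<in> E"
        using PV.subspace_diff[OF sub y PV.subspace_scale[OF sub x(1)]] .
      have "y - pscale (f y / f x) x = y + pscale (- (f y / f x)) x" by simp
      then have "f (y - pscale (f y / f x) x) = f y + f (pscale (- (f y / f x)) x)"
        using f y PV.subspace_scale[OF sub x(1)] unfolding lin_on_def by metis
      moreover have "f (pscale (- (f y / f x)) x) = - (f y / f x) * f x" using f x unfolding lin_on_def by blast
      ultimately have "f (y - pscale (f y / f x) x) = 0" using x by simp
      with yE have "y - pscale (f y / f x) x \<in> PV.span B0" using B0 by blast
      then show ?thesis by (subst PV.span_breakdown_eq) blast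
    qed
    then show ?thesis by blast
  next
    case False
    then have "E = PV.span B0" using B0 by blast
    then show ?thesis using PV.span_mono[of B0 "insert undefined B0"] by blast
  qed
  then obtain x where x: "B \<subseteq> PV.span (insert x B0)" using B PV.span_superset by blast
  have "card B \<le> card (insert x B0)" using PV.independent_span_bound[OF _ B(3) x] B0 by blast
  also have "\<dots> \<le> m + 1" using B0 by (simp add: card_insert_if)
  finally show ?thesis using m B by blast
qed

lemma has_cdim_kers:
  assumes "has_cdim E n" "\<And>i::nat. i < s \<Longrightarrow> lin_on E (f i)"
  shows "\<exists>m. has_cdim {x\<in>E. \<forall>i<s. f i x = 0} m \<and> n \<le> m + s"
  using assms
proof (induction s)
  case (Suc s)
  obtain m where m: "has_cdim {x\<in>E. \<forall>i<s. f i x = 0} m" "n \<le> m + s" using Suc by auto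
  have "lin_on {x\<in>E. \<forall>i<s. f i x = 0} (f s)" by (rule lin_on_subset[OF Suc.prems(2)]) auto
  from has_cdim_ker[OF m(1) this] obtain m' where
    m': "has_cdim {x\<in>{x\<in>E. \<forall>i<s. f i x = 0}. f s x = 0} m'" "m \<le> m' + 1" by blast
  have "{x\<in>{x\<in>E. \<forall>i<s. f i x = 0}. f s x = 0} = {x\<in>E. \<forall>i<Suc s. f i x = 0}" by (auto simp: less_Suc_eq)
  then show ?case using m m' by (intro exI[of _ m']) auto
qed auto

section \<open>Hermitian forms\<close>

text \<open>Positivity is only semidefinite: the form given by second components vanishes on every
  pair (u, 0).\<close>

locale hform =
  fixes E :: "pseq set" and \<beta> :: "pseq \<Rightarrow> pseq \<Rightarrow> complex"
  assumes sub: "PV.subspace E"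
    and lin: "z \<in> E \<Longrightarrow> lin_on E (\<lambda>x. \<beta> x z)"
    and herm: "x \<in> E \<Longrightarrow> y \<in> E \<Longrightarrow> \<beta> y x = cnj (\<beta> x y)"
    and pos: "x \<in> E \<Longrightarrow> 0 \<le> Re (\<beta> x x)"
begin

definition orth :: "nat \<Rightarrow> (nat \<Rightarrow> pseq) \<Rightarrow> bool" where
  "orth s e \<longleftrightarrow> (\<forall>i<s. e i \<in> E) \<and> (\<forall>i<s. \<forall>j<s. \<beta> (e i) (e j) = (if i = j then 1 else 0))"

lemma form_real: "x \<in> E \<Longrightarrow> \<beta> x x = of_real (Re (\<beta> x x))"
  using herm[of x x] by (simp add: complex_eq_iff)

lemma form_scale2: "x \<in> E \<Longrightarrow> y \<in> E \<Longrightarrow> \<beta> x (pscale c y) = cnj c * \<beta> x y"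
  using herm[of x "pscale c y"] herm[of y x] herm[of "pscale c y" x] PV.subspace_scale[OF sub, of y c] lin[of x]
  unfolding lin_on_def by simp

lemma lincomb_mem: "(\<And>i. i < s \<Longrightarrow> e i \<in> E) \<Longrightarrow> (\<Sum>i<s. pscale (c i) (e i)) \<in> E"
  by (intro PV.subspace_sum[OF sub] PV.subspace_scale[OF sub]) auto

lemma form_lincomb:
  assumes e: "orth s e" and k: "k < s"
  shows "\<beta> (\<Sum>i<s. pscale (c i) (e i)) (e k) = c k"
proof -
  have ek: "e k \<in> E" and eE: "\<And>i. i < s \<Longrightarrow> e i \<in> E" using e k by (auto simp: orth_def)
  have "\<beta> (\<Sum>i<s. pscale (c i) (e i)) (e k) = (\<Sum>i<s. \<beta> (pscale (c i) (e i)) (e k))"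
    by (rule lin_on_sum[OF lin[OF ek] sub]) (auto intro: PV.subspace_scale[OF sub] eE)
  also have "\<dots> = (\<Sum>i<s. if i = k then c k else 0)"
  proof (rule sum.cong)
    fix i assume "i \<in> {..<s}"
    then show "\<beta> (pscale (c i) (e i)) (e k) = (if i = k then c k else 0)"
      using lin[OF ek] eE[of i] e k unfolding lin_on_def orth_def by auto
  qed simp
  finally show ?thesis using k by simp
qed

lemma form_lincomb_self:
  assumes e: "orth s e"
  shows "\<beta> (\<Sum>i<s. pscale (c i) (e i)) (\<Sum>i<s. pscale (c i) (e i)) = of_real (\<Sum>i<s. (cmod (c i))\<^sup>2)"
proof -
  let ?x = "\<Sum>i<s. pscale (c i) (e i)"
  have eE: "\<And>i. i < s \<Longrightarrow> e i \<in> E" using e by (auto simp: orth_def)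
  have x: "?x \<in> E" by (rule lincomb_mem[OF eE])
  have "\<beta> ?x ?x = (\<Sum>i<s. \<beta> (pscale (c i) (e i)) ?x)"
    by (rule lin_on_sum[OF lin[OF x] sub]) (auto intro: PV.subspace_scale[OF sub] eE)
  also have "\<dots> = (\<Sum>i<s. of_real ((cmod (c i))\<^sup>2))"
  proof (rule sum.cong)
    fix i assume "i \<in> {..<s}"
    then have i: "i < s" by simp
    have "\<beta> (pscale (c i) (e i)) ?x = c i * \<beta> (e i) ?x" using lin[OF x] eE[OF i] unfolding lin_on_def by blast
    also have "\<beta> (e i) ?x = cnj (c i)" using herm[OF x eE[OF i]] form_lincomb[OF e i] by simp
    finally show "\<beta> (pscale (c i) (e i)) ?x = of_real ((cmod (c i))\<^sup>2)" by (simp only: complex_norm_square)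
  qed simp
  finally show ?thesis by simp
qed

lemma orth_le_dim:
  assumes e: "orth s e" and E: "has_cdim E n"
  shows "s \<le> n"
proof -
  have inj: "inj_on e {..<s}"
  proof (rule inj_onI)
    fix i j assume "i \<in> {..<s}" "j \<in> {..<s}" "e i = e j"
    then have "\<beta> (e i) (e i) = (if i = i then 1 else 0)" "\<beta> (e i) (e i) = (if i = j then 1 else 0)"
      using e unfolding orth_def by (metis lessThan_iff)+
    then show "i = j" by (metis zero_neq_one)
  qed
  have "PV.independent (e ` {..<s})"
  proof (rule PV.independent_if_scalars_zero)
    fix f x assume f: "(\<Sum>x\<in>e ` {..<s}. pscale (f x) x) = 0" and x: "x \<in> e ` {..<s}"
    then obtain k where k: "k < s" "x = e k" by auto
    have "(\<Sum>i<s. pscale (f (e i)) (e i)) = 0" using f by (simp add: sum.reindex[OF inj])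
    then have "\<beta> 0 (e k) = f (e k)" using form_lincomb[OF e k(1), of "\<lambda>i. f (e i)"] by simp
    moreover have "e k \<in> E" using e k by (auto simp: orth_def)
    then have "\<beta> 0 (e k) = 0" by (rule lin_on_zero[OF lin PV.subspace_0[OF sub]])
    ultimately show "f x = 0" using k by simp
  qed simp
  moreover have "e ` {..<s} \<subseteq> E" using e by (auto simp: orth_def)
  ultimately have "card (e ` {..<s}) \<le> n" by (rule has_cdim_bound(2)[OF E])
  then show ?thesis by (simp add: card_image[OF inj])
qed

lemma orth_extend:
  assumes e: "orth s e" and x: "x \<in> E" "\<beta> x x = 1" "\<And>i. i < s \<Longrightarrow> \<beta> x (e i) = 0"
  shows "orth (Suc s) (e(s := x))"
  unfolding orth_def
proof (intro conjI allI impI)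
  fix i j assume ij: "i < Suc s" "j < Suc s"
  show "(e(s := x)) i \<in> E" using ij e x by (auto simp: orth_def less_Suc_eq)
  have "\<beta> (e i) x = 0" if "i < s" for i using herm[of x "e i"] x(1,3) e that by (simp add: orth_def)
  then show "\<beta> ((e(s := x)) i) ((e(s := x)) j) = (if i = j then 1 else 0)"
    using ij e x by (auto simp: orth_def less_Suc_eq)
qed

text \<open>Orthonormal systems are independent even for a degenerate form, so their lengths are
  bounded by the dimension and a longest one with property Q exists; a unit vector orthogonal to it
  with property Q would extend it.\<close>

lemma maximal_orth:
  assumes E: "has_cdim E n"
  obtains s e where "s \<le> n" "orth s e" "\<And>i. i < s \<Longrightarrow> Q (e i)"
    "\<And>x. x \<in> E \<Longrightarrow> (\<And>i. i < s \<Longrightarrow> \<beta> x (e i) = 0) \<Longrightarrow> \<beta> x x = 1 \<Longrightarrow> \<not> Q x"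
proof -
  define P where "P s \<longleftrightarrow> (\<exists>e. orth s e \<and> (\<forall>i<s. Q (e i)))" for s
  have P0: "P 0" by (simp add: P_def orth_def)
  have bound: "\<forall>s. P s \<longrightarrow> s \<le> n" unfolding P_def using orth_le_dim[OF _ E] by blast
  define s where "s = (GREATEST s. P s)"
  have "P s" unfolding s_def by (rule GreatestI_nat[where P = P, OF P0]) (use bound in blast)
  then obtain e where e: "orth s e" "\<And>i. i < s \<Longrightarrow> Q (e i)" unfolding P_def by blast
  have "\<not> Q x" if x: "x \<in> E" "\<And>i. i < s \<Longrightarrow> \<beta> x (e i) = 0" "\<beta> x x = 1" for x
  proof
    assume "Q x"
    then have "\<forall>i<Suc s. Q ((e(s := x)) i)" using e(2) by (simp add: less_Suc_eq)
    then have "P (Suc s)" unfolding P_def using orth_extend[OF e(1) x(1,3,2)] by blast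
    then have "Suc s \<le> s" unfolding s_def by (rule Greatest_le_nat[where P = P]) (use bound in blast)
    then show False by simp
  qed
  then show ?thesis using that[of s e] \<open>P s\<close> bound e by blast
qed

lemma residual:
  assumes e: "orth s e" and x: "x \<in> E"
  defines "r \<equiv> x - (\<Sum>i<s. pscale (\<beta> x (e i)) (e i))"
  shows "r \<in> E" "\<And>k. k < s \<Longrightarrow> \<beta> r (e k) = 0"
proof -
  let ?y = "\<Sum>i<s. pscale (\<beta> x (e i)) (e i)"
  have eE: "\<And>i. i < s \<Longrightarrow> e i \<in> E" using e by (auto simp: orth_def)
  have y: "?y \<in> E" by (rule lincomb_mem[OF eE])
  then show "r \<in> E" unfolding r_def using x PV.subspace_diff[OF sub] by blast
  fix k assume k: "k < s"
  have "x = r + ?y" by (simp add: r_def)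
  then have "\<beta> x (e k) = \<beta> r (e k) + \<beta> ?y (e k)"
    using lin[OF eE[OF k]] \<open>r \<in> E\<close> y unfolding lin_on_def by metis
  then show "\<beta> r (e k) = 0" using form_lincomb[OF e k, of "\<lambda>i. \<beta> x (e i)"] by simp
qed

text \<open>For a degenerate form the residual need not be the zero vector; it is only a null
  vector, since otherwise it could be normalized and appended.\<close>

lemma orthonormal_basis:
  assumes E: "has_cdim E n"
  obtains s e where "s \<le> n" "orth s e"
    "\<And>x. x \<in> E \<Longrightarrow> \<beta> (x - (\<Sum>i<s. pscale (\<beta> x (e i)) (e i))) (x - (\<Sum>i<s. pscale (\<beta> x (e i)) (e i))) = 0"
proof -
  obtain s e where se: "s \<le> n" "orth s e"
    and max: "\<And>x. x \<in> E \<Longrightarrow> (\<And>i. i < s \<Longrightarrow> \<beta> x (e i) = 0) \<Longrightarrow> \<beta> x x = 1 \<Longrightarrow> \<not> True"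
    by (rule maximal_orth[OF E, where Q = "\<lambda>_. True"]) blast
  have "\<beta> r r = 0" if r: "r \<in> E" "\<And>k. k < s \<Longrightarrow> \<beta> r (e k) = 0" for r
  proof (rule ccontr)
    assume ne: "\<beta> r r \<noteq> 0"
    define t where "t = Re (\<beta> r r)"
    have rr: "\<beta> r r = of_real t" using form_real[OF r(1)] by (simp add: t_def)
    have "t \<noteq> 0" using ne rr by auto
    moreover have "0 \<le> t" unfolding t_def by (rule pos[OF r(1)])
    ultimately have t: "0 < t" by simp
    define c where "c = complex_of_real (1 / sqrt t)"
    have lin': "\<beta> (pscale c r) z = c * \<beta> r z" if "z \<in> E" for z using lin[OF that] r(1) unfolding lin_on_def by blast
    have cr: "pscale c r \<in> E" by (rule PV.subspace_scale[OF sub r(1)])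
    have "\<beta> (pscale c r) (e k) = 0" if "k < s" for k using lin'[of "e k"] r(2)[OF that] se(2) that by (simp add: orth_def)
    moreover have "\<beta> (pscale c r) (pscale c r) = c * (cnj c * of_real t)"
      using lin'[OF cr] form_scale2[OF r(1) r(1)] rr by simp
    moreover have "c * (cnj c * of_real t) = 1"
      using t by (simp add: c_def flip: of_real_mult)
    ultimately show False using max[OF cr] by metis
  qed
  then show ?thesis using that[OF se] residual[OF se(2)] by blast
qed

end

lemma sqrt_le_if_le_mult:
  assumes "0 \<le> s" "0 \<le> a" "s \<le> a * sqrt s"
  shows "sqrt s \<le> a"
proof (cases "s = 0")
  case False
  then have "0 < sqrt s" using assms by simp
  moreover have "sqrt s * sqrt s \<le> a * sqrt s" using assms by simp
  ultimately show ?thesis by (simp only: mult_le_cancel_right_pos)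
qed (use assms in simp)

text \<open>The form is an inner product on E whose first argument extends to X. Expansion in an
  orthonormal basis of E therefore makes sense on X and is a projection. \<open>bounded\<close>
  controls the projection and, restricted to E, the coordinates; \<open>upper\<close> returns from
  coordinates to the norm, whence the product of two constants.\<close>

lemma hilbert_complemented:
  assumes X: "PV.subspace X" and E: "has_cdim E n" "E \<subseteq> X" and hform: "hform E \<beta>"
    and N: "\<And>x. x \<in> X \<Longrightarrow> 0 \<le> N x" "\<And>x. x \<in> X \<Longrightarrow> N x = 0 \<Longrightarrow> x = 0"
    and linX: "\<And>z. z \<in> E \<Longrightarrow> lin_on X (\<lambda>x. \<beta> x z)"
    and add2: "\<And>x y z. x \<in> X \<Longrightarrow> y \<in> E \<Longrightarrow> z \<in> E \<Longrightarrow> \<beta> x (y + z) = \<beta> x y + \<beta> x z"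
    and scale2: "\<And>x y c. x \<in> X \<Longrightarrow> y \<in> E \<Longrightarrow> \<beta> x (pscale c y) = cnj c * \<beta> x y"
    and upper: "\<And>x. x \<in> E \<Longrightarrow> N x \<le> C * sqrt (Re (\<beta> x x))"
    and bounded: "\<And>x y. x \<in> X \<Longrightarrow> y \<in> E \<Longrightarrow> cmod (\<beta> x y) \<le> C * N x * sqrt (Re (\<beta> y y))"
    and C: "0 < C"
  shows "bm_dist_l2 N E n \<le> C * C \<and>
    (\<exists>P. clinear_on X P padd pscale \<and> (\<forall>x\<in>X. P x \<in> E) \<and> (\<forall>x\<in>E. P x = x) \<and> (\<forall>x\<in>X. N (P x) \<le> (C * C) * N x))"
proof -
  interpret hform E \<beta> by fact
  obtain s e where s: "s \<le> n" and e: "orth s e"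
    and null: "\<And>x. x \<in> E \<Longrightarrow> \<beta> (x - (\<Sum>i<s. pscale (\<beta> x (e i)) (e i))) (x - (\<Sum>i<s. pscale (\<beta> x (e i)) (e i))) = 0"
    by (rule orthonormal_basis[OF E(1)]) blast
  have eE: "e i \<in> E" if "i < s" for i using e that by (auto simp: orth_def)
  have expand: "(\<Sum>i<s. pscale (\<beta> x (e i)) (e i)) = x" if x: "x \<in> E" for x
  proof -
    let ?r = "x - (\<Sum>i<s. pscale (\<beta> x (e i)) (e i))"
    have r: "?r \<in> E" by (rule residual(1)[OF e x])
    \<comment> \<open>\<open>upper\<close> makes the form definite on E, so null residuals vanish
      and the system is a basis.\<close>
    have "N ?r \<le> 0" using upper[OF r] null[OF x] by simp
    then have "?r = 0" using N r E(2) by (meson antisym subsetD)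
    then show ?thesis by simp
  qed
  have sn: "s = n"
  proof -
    obtain B where B: "card B = n" "PV.independent B" "PV.span B = E" using E(1) by (auto simp: has_cdim_iff)
    have "E \<subseteq> PV.span (e ` {..<s})"
    proof
      fix x assume "x \<in> E"
      moreover have "(\<Sum>i<s. pscale (\<beta> x (e i)) (e i)) \<in> PV.span (e ` {..<s})"
        by (intro PV.span_sum PV.span_scale PV.span_base) auto
      ultimately show "x \<in> PV.span (e ` {..<s})" using expand by simp
    qed
    then have "card B \<le> card (e ` {..<s})" using PV.independent_span_bound[OF _ B(2), of "e ` {..<s}"] B(3) PV.span_superset by blast
    also have "\<dots> \<le> s" using card_image_le[of "{..<s}" e] by simp
    finally show ?thesis using s B by simp
  qed
  have norm2: "Re (\<beta> x x) = (\<Sum>i<s. (cmod (\<beta> x (e i)))\<^sup>2)" if "x \<in> E" for x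
    using form_lincomb_self[OF e, of "\<lambda>i. \<beta> x (e i)"] expand[OF that] by simp
  define S where "S x = (\<lambda>i. if i < n then \<beta> x (e i) else 0)" for x
  have l2S: "l2norm n (S x) = sqrt (Re (\<beta> x x))" if "x \<in> E" for x
    using norm2[OF that] by (simp add: l2norm_def S_def sn)
  have Slin: "clinear_on E S (\<lambda>u v j. u j + v j) (\<lambda>c u j. c * u j)"
    unfolding clinear_on_def S_def padd_plus using lin eE sn unfolding lin_on_def by (auto simp: fun_eq_iff)
  have Sbij: "bij_betw S E (l2fin n)"
  proof (rule bij_betwI[where g = "\<lambda>v. \<Sum>i<s. pscale (v i) (e i)"])
    show "S \<in> E \<rightarrow> l2fin n" by (auto simp: S_def l2fin_def)
    show "(\<lambda>v. \<Sum>i<s. pscale (v i) (e i)) \<in> l2fin n \<rightarrow> E" by (intro funcsetI lincomb_mem eE)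
    show "(\<Sum>i<s. pscale (S x i) (e i)) = x" if "x \<in> E" for x
    proof -
      have "(\<Sum>i<s. pscale (S x i) (e i)) = (\<Sum>i<s. pscale (\<beta> x (e i)) (e i))"
        by (rule sum.cong) (auto simp: S_def sn)
      then show ?thesis using expand[OF that] by simp
    qed
    show "S (\<Sum>i<s. pscale (v i) (e i)) = v" if "v \<in> l2fin n" for v
      using form_lincomb[OF e, of _ v] that by (auto simp: S_def l2fin_def sn fun_eq_iff)
  qed
  have low: "sqrt (Re (\<beta> x x)) \<le> C * N x" if x: "x \<in> E" for x
  proof (cases "Re (\<beta> x x) = 0")
    case True
    moreover have "0 \<le> N x" by (rule N(1)) (use x E(2) in blast)
    ultimately show ?thesis using C by simp
  next
    case False
    then have p: "0 < sqrt (Re (\<beta> x x))" using pos[OF x] by simp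
    have "Re (\<beta> x x) \<le> cmod (\<beta> x x)" by (rule complex_Re_le_cmod)
    also have "\<dots> \<le> C * N x * sqrt (Re (\<beta> x x))" using bounded x E(2) by blast
    finally have "sqrt (Re (\<beta> x x)) * sqrt (Re (\<beta> x x)) \<le> C * N x * sqrt (Re (\<beta> x x))" using pos[OF x] by simp
    then show ?thesis using p by (simp only: mult_le_cancel_right_pos)
  qed
  have "bm_dist_l2 N E n \<le> C * C"
    unfolding bm_dist_l2_def
  proof (rule cInf_lower)
    show "bdd_below {a * b | a b S. clinear_on E S (\<lambda>u v j. u j + v j) (\<lambda>c u j. c * u j) \<and> bij_betw S E (l2fin n) \<and>
      0 < a \<and> 0 < b \<and> (\<forall>x\<in>E. l2norm n (S x) \<le> a * N x) \<and> (\<forall>x\<in>E. N x \<le> b * l2norm n (S x))}"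
      by (rule bdd_belowI[of _ 0]) auto
    show "C * C \<in> {a * b | a b S. clinear_on E S (\<lambda>u v j. u j + v j) (\<lambda>c u j. c * u j) \<and> bij_betw S E (l2fin n) \<and>
      0 < a \<and> 0 < b \<and> (\<forall>x\<in>E. l2norm n (S x) \<le> a * N x) \<and> (\<forall>x\<in>E. N x \<le> b * l2norm n (S x))}"
      using Slin Sbij C low upper l2S by (intro CollectI exI[of _ C] exI[of _ S]) auto
  qed
  moreover define P where "P x = (\<Sum>i<s. pscale (\<beta> x (e i)) (e i))" for x
  have "clinear_on X P padd pscale"
    unfolding clinear_on_def
  proof (intro conjI ballI allI)
    fix x y c assume x: "x \<in> X"
    show "P (padd x y) = padd (P x) (P y)" if y: "y \<in> X"
    proof -
      have "\<beta> (x + y) (e i) = \<beta> x (e i) + \<beta> y (e i)" if "i < s" for i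
        using linX[OF eE[OF that]] x y unfolding lin_on_def by blast
      then show ?thesis by (simp add: P_def padd_plus PV.scale_left_distrib sum.distrib)
    qed
    have "\<beta> (pscale c x) (e i) = c * \<beta> x (e i)" if "i < s" for i
      using linX[OF eE[OF that]] x unfolding lin_on_def by blast
    then show "P (pscale c x) = pscale c (P x)" by (simp add: P_def PV.scale_sum_right)
  qed
  moreover have PE: "P x \<in> E" for x unfolding P_def by (rule lincomb_mem[OF eE])
  moreover have "P x = x" if "x \<in> E" for x using expand[OF that] by (simp add: P_def)
  moreover have "N (P x) \<le> (C * C) * N x" if x: "x \<in> X" for x
  proof -
    \<comment> \<open>The square of the Hilbert norm of \<open>P x\<close>. It also equals \<beta> x
      (P x), so \<open>bounded\<close> gives \<sigma> \<le> C N x sqrt \<sigma>.\<close>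
    define \<sigma> where "\<sigma> = (\<Sum>i<s. (cmod (\<beta> x (e i)))\<^sup>2)"
    have \<sigma>0: "0 \<le> \<sigma>" by (simp add: \<sigma>_def sum_nonneg)
    have PP: "Re (\<beta> (P x) (P x)) = \<sigma>" using form_lincomb_self[OF e, of "\<lambda>i. \<beta> x (e i)"] by (simp add: P_def \<sigma>_def)
    have sum2: "\<beta> x (\<Sum>i\<in>I. pscale (c i) (e i)) = (\<Sum>i\<in>I. cnj (c i) * \<beta> x (e i))" if "finite I" "I \<subseteq> {..<s}" for I c
      using that
    proof (induction I rule: finite_induct)
      case empty
      have "\<beta> x (pscale 0 0) = cnj 0 * \<beta> x 0" by (rule scale2[OF x PV.subspace_0[OF sub]])
      then show ?case by simp
    next
      case (insert i I)
      have "(\<Sum>i\<in>I. pscale (c i) (e i)) \<in> E"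
        using insert by (intro PV.subspace_sum[OF sub] PV.subspace_scale[OF sub] eE) auto
      moreover have "e i \<in> E" using insert eE by auto
      ultimately show ?case using insert add2[OF x PV.subspace_scale[OF sub]] scale2[OF x] by simp
    qed
    have "\<beta> x (P x) = (\<Sum>i<s. cnj (\<beta> x (e i)) * \<beta> x (e i))" unfolding P_def by (rule sum2) auto
    also have "\<dots> = (\<Sum>i<s. of_real ((cmod (\<beta> x (e i)))\<^sup>2))"
    proof (rule sum.cong)
      fix i show "cnj (\<beta> x (e i)) * \<beta> x (e i) = of_real ((cmod (\<beta> x (e i)))\<^sup>2)"
        unfolding complex_norm_square by (rule mult.commute)
    qed simp
    also have "\<dots> = of_real \<sigma>" unfolding \<sigma>_def by (rule of_real_sum[symmetric])
    finally have "cmod (\<beta> x (P x)) = \<sigma>" using \<sigma>0 by simp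
    then have "sqrt \<sigma> * sqrt \<sigma> \<le> C * N x * sqrt \<sigma>" using bounded[OF x PE[of x]] PP \<sigma>0 by simp
    moreover have "0 \<le> C * N x" using C N(1)[OF x] by simp
    ultimately have "sqrt \<sigma> \<le> C * N x" using \<sigma>0 by (intro sqrt_le_if_le_mult) simp_all
    then have "C * sqrt \<sigma> \<le> C * (C * N x)" using C by simp
    then show ?thesis using upper[OF PE[of x]] PP by (simp add: mult.assoc)
  qed
  ultimately show ?thesis by blast
qed

section \<open>Square-summable sequences\<close>

definition l2 :: "seq set" where
  "l2 = {v. summable (\<lambda>j. (cmod (v j))\<^sup>2)}"

definition n2 :: "seq \<Rightarrow> real" where
  "n2 v = sqrt (\<Sum>j. (cmod (v j))\<^sup>2)"

definition ip :: "seq \<Rightarrow> seq \<Rightarrow> complex" where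
  "ip u v = (\<Sum>j. u j * cnj (v j))"

lemma n2_sq: "v \<in> l2 \<Longrightarrow> (n2 v)\<^sup>2 = (\<Sum>j. (cmod (v j))\<^sup>2)"
  by (simp add: n2_def l2_def suminf_nonneg)

lemma n2_nonneg: "v \<in> l2 \<Longrightarrow> 0 \<le> n2 v"
  by (simp add: n2_def l2_def suminf_nonneg)

lemma l2_partial: "v \<in> l2 \<Longrightarrow> (\<Sum>j<L. (cmod (v j))\<^sup>2) \<le> (n2 v)\<^sup>2"
  unfolding n2_sq by (rule sum_le_suminf) (auto simp: l2_def)

lemma l2_I:
  assumes "0 \<le> M" "\<And>L. (\<Sum>j<L. (cmod (v j))\<^sup>2) \<le> M\<^sup>2"
  shows "v \<in> l2" "n2 v \<le> M"
proof -
  show v: "v \<in> l2"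
    unfolding l2_def mem_Collect_eq
    by (rule bounded_imp_summable[of _ "M\<^sup>2"]) (use assms(2)[of "Suc _"] in \<open>auto simp: lessThan_Suc_atMost\<close>)
  have "(\<Sum>j. (cmod (v j))\<^sup>2) \<le> M\<^sup>2" by (rule suminf_le_const) (use v assms in \<open>auto simp: l2_def\<close>)
  then show "n2 v \<le> M" unfolding n2_def by (rule real_le_lsqrt[OF assms(1)])
qed

lemma L2_set_l2: "v \<in> l2 \<Longrightarrow> L2_set (\<lambda>j. cmod (v j)) {..<L} \<le> n2 v"
  unfolding L2_set_def using l2_partial[of v L] n2_nonneg[of v] by (intro real_le_lsqrt) (auto simp: sum_nonneg)

lemma l2_add:
  assumes "u \<in> l2" "v \<in> l2"
  shows "(\<lambda>j. u j + v j) \<in> l2" "n2 (\<lambda>j. u j + v j) \<le> n2 u + n2 v"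
proof -
  have "(\<Sum>j<L. (cmod (u j + v j))\<^sup>2) \<le> (n2 u + n2 v)\<^sup>2" for L
  proof -
    have "L2_set (\<lambda>j. cmod (u j + v j)) {..<L} \<le> L2_set (\<lambda>j. cmod (u j) + cmod (v j)) {..<L}"
      by (intro L2_set_mono norm_triangle_ineq) auto
    also have "\<dots> \<le> L2_set (\<lambda>j. cmod (u j)) {..<L} + L2_set (\<lambda>j. cmod (v j)) {..<L}" by (rule L2_set_triangle_ineq)
    also have "\<dots> \<le> n2 u + n2 v" by (intro add_mono L2_set_l2 assms)
    finally show ?thesis unfolding L2_set_def by (rule sqrt_le_D)
  qed
  moreover have "0 \<le> n2 u + n2 v" using n2_nonneg assms by simp
  ultimately show "(\<lambda>j. u j + v j) \<in> l2" "n2 (\<lambda>j. u j + v j) \<le> n2 u + n2 v"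
    using l2_I[of "n2 u + n2 v" "\<lambda>j. u j + v j"] by simp_all
qed

lemma l2_scale: "v \<in> l2 \<Longrightarrow> (\<lambda>j. c * v j) \<in> l2"
  by (simp add: l2_def norm_mult power_mult_distrib summable_mult)

lemma n2_zero: "v \<in> l2 \<Longrightarrow> n2 v = 0 \<Longrightarrow> v j = 0"
proof -
  assume v: "v \<in> l2" "n2 v = 0"
  have "(cmod (v j))\<^sup>2 \<le> (\<Sum>i<Suc j. (cmod (v i))\<^sup>2)" by (intro member_le_sum) auto
  also have "\<dots> \<le> (n2 v)\<^sup>2" by (rule l2_partial[OF v(1)])
  finally show "v j = 0" by (simp add: v(2))
qed

lemma l2_prod:
  assumes "u \<in> l2" "v \<in> l2"
  shows "summable (\<lambda>j. cmod (u j * cnj (v j)))" "(\<Sum>j. cmod (u j * cnj (v j))) \<le> n2 u * n2 v"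
proof -
  have le: "(\<Sum>j<L. cmod (u j * cnj (v j))) \<le> n2 u * n2 v" for L
  proof -
    have "(\<Sum>j<L. cmod (u j * cnj (v j))) = (\<Sum>j<L. \<bar>cmod (u j)\<bar> * \<bar>cmod (v j)\<bar>)" by (simp add: norm_mult)
    also have "\<dots> \<le> L2_set (\<lambda>j. cmod (u j)) {..<L} * L2_set (\<lambda>j. cmod (v j)) {..<L}" by (rule L2_set_mult_ineq)
    also have "\<dots> \<le> n2 u * n2 v" by (intro mult_mono L2_set_l2 assms n2_nonneg L2_set_nonneg)
    finally show ?thesis .
  qed
  show s: "summable (\<lambda>j. cmod (u j * cnj (v j)))"
    by (rule bounded_imp_summable[of _ "n2 u * n2 v"]) (use le[of "Suc _"] in \<open>auto simp: lessThan_Suc_atMost\<close>)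
  show "(\<Sum>j. cmod (u j * cnj (v j))) \<le> n2 u * n2 v" by (rule suminf_le_const[OF s le])
qed

lemma ip_summable: "u \<in> l2 \<Longrightarrow> v \<in> l2 \<Longrightarrow> summable (\<lambda>j. u j * cnj (v j))"
  by (rule summable_norm_cancel) (rule l2_prod)

lemma ip_CS: "u \<in> l2 \<Longrightarrow> v \<in> l2 \<Longrightarrow> cmod (ip u v) \<le> n2 u * n2 v"
  unfolding ip_def by (rule order_trans[OF summable_norm[OF l2_prod(1)] l2_prod(2)])

lemma ip_add: "u \<in> l2 \<Longrightarrow> v \<in> l2 \<Longrightarrow> w \<in> l2 \<Longrightarrow> ip (\<lambda>j. u j + v j) w = ip u w + ip v w"
  unfolding ip_def distrib_right by (rule suminf_add[OF ip_summable ip_summable, symmetric])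

lemma ip_scale: "u \<in> l2 \<Longrightarrow> w \<in> l2 \<Longrightarrow> ip (\<lambda>j. c * u j) w = c * ip u w"
  unfolding ip_def mult.assoc by (rule suminf_mult[OF ip_summable])

lemma ip_herm: "u \<in> l2 \<Longrightarrow> v \<in> l2 \<Longrightarrow> ip v u = cnj (ip u v)"
proof -
  assume uv: "u \<in> l2" "v \<in> l2"
  have "(\<lambda>j. u j * cnj (v j)) sums ip u v" unfolding ip_def by (rule summable_sums[OF ip_summable[OF uv]])
  then have "(\<lambda>j. cnj (u j * cnj (v j))) sums cnj (ip u v)" by (subst sums_cnj)
  then have "(\<lambda>j. v j * cnj (u j)) sums cnj (ip u v)" by (simp add: mult.commute)
  then show ?thesis unfolding ip_def[of v u] by (rule sums_unique[symmetric])
qed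

lemma ip_add2:
  assumes "u \<in> l2" "v \<in> l2" "w \<in> l2"
  shows "ip w (\<lambda>j. u j + v j) = ip w u + ip w v"
  by (simp only: ip_herm[OF l2_add(1)[OF assms(1,2)] assms(3)] ip_add[OF assms] complex_cnj_add
      ip_herm[OF assms(1,3)] ip_herm[OF assms(2,3)])

lemma ip_scale2:
  assumes "u \<in> l2" "w \<in> l2"
  shows "ip w (\<lambda>j. c * u j) = cnj c * ip w u"
  by (simp only: ip_herm[OF l2_scale[OF assms(1)] assms(2)] ip_scale[OF assms] complex_cnj_mult
      ip_herm[OF assms])

lemma ip_self: "v \<in> l2 \<Longrightarrow> ip v v = of_real ((n2 v)\<^sup>2)"
  unfolding ip_def n2_sq complex_norm_square[symmetric] by (rule suminf_of_real[symmetric]) (simp add: l2_def)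

text \<open>To be used with \<open>snd\<close> and with \<open>shear h0\<close>, so that one
  selection argument serves both components.\<close>

definition linmap :: "pseq set \<Rightarrow> (pseq \<Rightarrow> seq) \<Rightarrow> bool" where
  "linmap E Y \<longleftrightarrow> (\<forall>x\<in>E. Y x \<in> l2) \<and> (\<forall>x\<in>E. \<forall>y\<in>E. Y (x + y) = (\<lambda>j. Y x j + Y y j)) \<and>
     (\<forall>c. \<forall>x\<in>E. Y (pscale c x) = (\<lambda>j. c * Y x j))"

lemma linmapD:
  assumes "linmap E Y"
  shows "x \<in> E \<Longrightarrow> Y x \<in> l2" "x \<in> E \<Longrightarrow> y \<in> E \<Longrightarrow> Y (x + y) = (\<lambda>j. Y x j + Y y j)"
    "x \<in> E \<Longrightarrow> Y (pscale c x) = (\<lambda>j. c * Y x j)"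
  using assms unfolding linmap_def by auto

lemma linmap_subset: "linmap E Y \<Longrightarrow> E' \<subseteq> E \<Longrightarrow> linmap E' Y"
  unfolding linmap_def by blast

lemma linmap_coord: "linmap E Y \<Longrightarrow> lin_on E (\<lambda>x. Y x j)"
  unfolding lin_on_def by (simp add: linmapD)

lemma linmap_ip: "linmap E Y \<Longrightarrow> w \<in> l2 \<Longrightarrow> lin_on E (\<lambda>x. ip (Y x) w)"
  unfolding lin_on_def by (simp add: linmapD ip_add ip_scale)

lemma linmap_hform:
  assumes "PV.subspace E" "linmap E Y"
  shows "hform E (\<lambda>x y. ip (Y x) (Y y))"
proof
  show "PV.subspace E" by fact
  show "lin_on E (\<lambda>x. ip (Y x) (Y z))" if "z \<in> E" for z
    by (rule linmap_ip[OF assms(2) linmapD(1)[OF assms(2) that]])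
  show "ip (Y y) (Y x) = cnj (ip (Y x) (Y y))" if "x \<in> E" "y \<in> E" for x y
    by (rule ip_herm) (use that linmapD[OF assms(2)] in auto)
  show "0 \<le> Re (ip (Y x) (Y x))" if "x \<in> E" for x
    unfolding ip_self[OF linmapD(1)[OF assms(2) that]] by simp
qed

text \<open>Reproducing kernel: \<open>\<rho> j\<close> is the squared norm of the evaluation of \<open>Y\<close> at coordinate \<open>j\<close>.\<close>
lemma kernel_weight:
  assumes E: "has_cdim E n" and Y: "linmap E Y"
  obtains \<rho> where "\<And>j. 0 \<le> \<rho> j" "summable \<rho>" "suminf \<rho> \<le> real n"
    "\<And>p j. p \<in> E \<Longrightarrow> (cmod (Y p j))\<^sup>2 \<le> \<rho> j * (n2 (Y p))\<^sup>2"
proof -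
  have sub: "PV.subspace E" by (rule has_cdim_subspace[OF E])
  interpret hform E "\<lambda>x y. ip (Y x) (Y y)" by (rule linmap_hform[OF sub Y])
  obtain s e where s: "s \<le> n" and e: "orth s e"
    and null: "\<And>x. x \<in> E \<Longrightarrow> ip (Y (x - (\<Sum>i<s. pscale (ip (Y x) (Y (e i))) (e i)))) (Y (x - (\<Sum>i<s. pscale (ip (Y x) (Y (e i))) (e i)))) = 0"
    by (rule orthonormal_basis[OF E]) blast
  have eE: "e i \<in> E" if "i < s" for i using e that by (auto simp: orth_def)
  have ne: "(n2 (Y (e i)))\<^sup>2 = 1" if "i < s" for i
  proof -
    have "ip (Y (e i)) (Y (e i)) = 1" using e that by (auto simp: orth_def)
    then have "complex_of_real ((n2 (Y (e i)))\<^sup>2) = 1" unfolding ip_self[OF linmapD(1)[OF Y eE[OF that]]] .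
    then show ?thesis by (simp only: of_real_eq_1_iff)
  qed
  define \<rho> where "\<rho> j = (\<Sum>i<s. (cmod (Y (e i) j))\<^sup>2)" for j
  have sm: "summable (\<lambda>j. (cmod (Y (e i) j))\<^sup>2)" if "i < s" for i
    using linmapD(1)[OF Y eE[OF that]] by (simp add: l2_def)
  have "summable \<rho>" unfolding \<rho>_def by (rule summable_sum) (use sm in auto)
  moreover have "suminf \<rho> = (\<Sum>i<s. (\<Sum>j. (cmod (Y (e i) j))\<^sup>2))"
    unfolding \<rho>_def by (rule suminf_sum) (use sm in auto)
  then have "suminf \<rho> = (\<Sum>i<s. 1)" using ne n2_sq[OF linmapD(1)[OF Y eE]] by simp
  then have "suminf \<rho> \<le> real n" using s by simp
  moreover have "(cmod (Y p j))\<^sup>2 \<le> \<rho> j * (n2 (Y p))\<^sup>2" if p: "p \<in> E" for p j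
  proof -
    define c where "c i = ip (Y p) (Y (e i))" for i
    let ?q = "\<Sum>i<s. pscale (c i) (e i)"
    have q: "?q \<in> E" by (rule lincomb_mem[OF eE])
    have r: "p - ?q \<in> E" using residual(1)[OF e p] by (simp add: c_def)
    have "ip (Y (p - ?q)) (Y (p - ?q)) = 0" using null[OF p] by (simp add: c_def)
    then have "n2 (Y (p - ?q)) = 0" unfolding ip_self[OF linmapD(1)[OF Y r]] by simp
    then have r0: "Y (p - ?q) = (\<lambda>_. 0)" using n2_zero[OF linmapD(1)[OF Y r]] by blast
    have "Y (p - ?q + ?q) = (\<lambda>j. Y (p - ?q) j + Y ?q j)" by (rule linmapD(2)[OF Y r q])
    then have Yp: "Y p = Y ?q" using r0 by simp
    have "complex_of_real ((n2 (Y p))\<^sup>2) = of_real (\<Sum>i<s. (cmod (c i))\<^sup>2)"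
      using form_lincomb_self[OF e, of c] unfolding Yp[symmetric] ip_self[OF linmapD(1)[OF Y p]] .
    then have np: "(n2 (Y p))\<^sup>2 = (\<Sum>i<s. (cmod (c i))\<^sup>2)" by (simp only: of_real_eq_iff)
    have "Y p j = (\<Sum>i<s. Y (pscale (c i) (e i)) j)"
      unfolding Yp by (rule lin_on_sum[OF linmap_coord[OF Y] sub]) (auto intro: PV.subspace_scale[OF sub] eE)
    also have "\<dots> = (\<Sum>i<s. c i * Y (e i) j)" by (rule sum.cong) (auto simp: linmapD(3)[OF Y eE])
    finally have "cmod (Y p j) \<le> (\<Sum>i<s. \<bar>cmod (c i)\<bar> * \<bar>cmod (Y (e i) j)\<bar>)"
      by (simp add: sum_norm_le norm_mult)
    also have "\<dots> \<le> L2_set (\<lambda>i. cmod (c i)) {..<s} * L2_set (\<lambda>i. cmod (Y (e i) j)) {..<s}" by (rule L2_set_mult_ineq)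
    finally have "(cmod (Y p j))\<^sup>2 \<le> (L2_set (\<lambda>i. cmod (c i)) {..<s} * L2_set (\<lambda>i. cmod (Y (e i) j)) {..<s})\<^sup>2"
      by (rule power_mono) simp
    also have "\<dots> = (n2 (Y p))\<^sup>2 * \<rho> j"
      unfolding np \<rho>_def L2_set_def power_mult_distrib by (simp add: sum_nonneg)
    finally show ?thesis by (simp add: mult.commute)
  qed
  moreover have "0 \<le> \<rho> j" for j by (simp add: \<rho>_def sum_nonneg)
  ultimately show ?thesis by (intro that[of \<rho>])
qed

text \<open>The sum t is the squared norm of evaluation at j on the span of the system. Its
  representing vector w satisfies Y w j = t and has squared norm t, so t^2 \<le> r t.\<close>

lemma bessel_kernel:
  assumes sub: "PV.subspace E" and Y: "linmap E Y" and e: "hform.orth E (\<lambda>x y. ip (Y x) (Y y)) s e"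
    and dom: "\<And>p. p \<in> E \<Longrightarrow> (cmod (Y p j))\<^sup>2 \<le> r * (n2 (Y p))\<^sup>2" and r: "0 \<le> r"
  shows "(\<Sum>i<s. (cmod (Y (e i) j))\<^sup>2) \<le> r"
proof -
  interpret hform E "\<lambda>x y. ip (Y x) (Y y)" by (rule linmap_hform[OF sub Y])
  have eE: "e i \<in> E" if "i < s" for i using e that by (auto simp: orth_def)
  define t where "t = (\<Sum>i<s. (cmod (Y (e i) j))\<^sup>2)"
  define w where "w = (\<Sum>i<s. pscale (cnj (Y (e i) j)) (e i))"
  have w: "w \<in> E" unfolding w_def by (rule lincomb_mem[OF eE])
  have t0: "0 \<le> t" by (simp add: t_def sum_nonneg)
  have "Y w j = (\<Sum>i<s. Y (pscale (cnj (Y (e i) j)) (e i)) j)"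
    unfolding w_def by (rule lin_on_sum[OF linmap_coord[OF Y] sub]) (auto intro: PV.subspace_scale[OF sub] eE)
  also have "\<dots> = (\<Sum>i<s. of_real ((cmod (Y (e i) j))\<^sup>2))"
  proof (rule sum.cong)
    fix i assume "i \<in> {..<s}"
    then show "Y (pscale (cnj (Y (e i) j)) (e i)) j = of_real ((cmod (Y (e i) j))\<^sup>2)"
      unfolding complex_norm_square by (simp add: linmapD(3)[OF Y eE] mult.commute)
  qed simp
  also have "\<dots> = of_real t" unfolding t_def by (rule of_real_sum[symmetric])
  finally have Yw: "cmod (Y w j) = t" using t0 by simp
  have "complex_of_real ((n2 (Y w))\<^sup>2) = of_real (\<Sum>i<s. (cmod (cnj (Y (e i) j)))\<^sup>2)"
    using form_lincomb_self[OF e, of "\<lambda>i. cnj (Y (e i) j)"] unfolding w_def[symmetric] ip_self[OF linmapD(1)[OF Y w]] .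
  then have "(n2 (Y w))\<^sup>2 = t" unfolding of_real_eq_iff by (simp add: t_def)
  then have "t * t \<le> r * t" using dom[OF w] Yw by (simp add: power2_eq_square)
  then show ?thesis using t0 r unfolding t_def[symmetric] by (cases "t = 0") auto
qed

lemma wball_dominates_tail:
  assumes "s \<le> N + 1" "\<And>i. i < s \<Longrightarrow> g i \<in> tfuns"
  shows "\<exists>G\<in>wball. \<forall>i<s. \<forall>j\<ge>N. g i j \<le> 16 * G j"
proof -
  define r where "r i = (\<lambda>j. if j \<in> {N..} then g i j else 0)" for i
  have "\<exists>G\<in>wball. \<forall>h\<in>r ` {..<s}. \<forall>j. h j \<le> 16 * G j"
  proof (rule wball_dominates)
    show "card (r ` {..<s}) \<le> N + 1" using card_image_le[of "{..<s}" r] assms(1) by simp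
    show "r ` {..<s} \<subseteq> tfuns" using assms(2) tfuns_restrict unfolding r_def by blast
  qed (auto simp: r_def)
  then obtain G where G: "G \<in> wball" "\<And>i j. i < s \<Longrightarrow> r i j \<le> 16 * G j" by blast
  have "g i j \<le> 16 * G j" if "i < s" "N \<le> j" for i j
    using G(2)[OF that(1), of j] that(2) by (simp add: r_def)
  then show ?thesis using G(1) by blast
qed

text \<open>A maximal orthonormal system of vectors for which the weight is bad has few elements: the maximum of
  at most \<open>N + 1\<close> norming functionals beyond \<open>N\<close> is again norming up to a constant, so that the trace
  estimate for \<open>h\<close> bounds their number.\<close>
lemma good_subspace:
  assumes E: "has_cdim E n1" and Y: "linmap E Y" and supp: "\<And>p j. p \<in> E \<Longrightarrow> j < N \<Longrightarrow> Y p j = 0"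
    and h: "h \<in> wball" and \<rho>0: "\<And>j. 0 \<le> \<rho> j" and hpos: "\<And>j. 0 < \<rho> j \<Longrightarrow> 0 < h j"
    and hmax: "\<And>g L. g \<in> wball \<Longrightarrow> (\<Sum>j<L. \<rho> j * (g j / h j)) \<le> 2 * real n"
    and dom: "\<And>p j. p \<in> E \<Longrightarrow> (cmod (Y p j))\<^sup>2 \<le> \<rho> j * (n2 (Y p))\<^sup>2"
    and nN: "n \<le> 8 * N + 7"
  shows "\<exists>E' m. E' \<subseteq> E \<and> has_cdim E' m \<and> 16 * n1 \<le> 16 * m + n \<and> (\<forall>p\<in>E'. good h (23 * n2 (Y p)) (Y p))"
proof -
  have sub: "PV.subspace E" by (rule has_cdim_subspace[OF E])
  interpret hform E "\<lambda>x y. ip (Y x) (Y y)" by (rule linmap_hform[OF sub Y])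
  have h0: "0 \<le> h j" for j by (rule wballD(1)[OF h])
  \<comment> \<open>529 is the square of 23.\<close>
  define Bad where "Bad p \<longleftrightarrow> (\<exists>g\<in>tfuns. \<exists>L. 529 < (\<Sum>j<L. g j / h j * (cmod (Y p j))\<^sup>2))" for p
  obtain s e where e: "orth s e" and bad: "\<And>i. i < s \<Longrightarrow> Bad (e i)"
    and max: "\<And>x. x \<in> E \<Longrightarrow> (\<And>i. i < s \<Longrightarrow> ip (Y x) (Y (e i)) = 0) \<Longrightarrow> ip (Y x) (Y x) = 1 \<Longrightarrow> \<not> Bad x"
    by (rule maximal_orth[OF E, where Q = Bad]) blast
  have eE: "e i \<in> E" if "i < s" for i using e that by (auto simp: orth_def)
  have "16 * s \<le> n"
  proof (rule ccontr)
    assume neg: "\<not> 16 * s \<le> n"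
    \<comment> \<open>Only N + 1 functionals beyond coordinate N can be merged, so at most that many
      bad vectors are used.\<close>
    define s' where "s' = min s (N + 1)"
    have e': "orth s' e" using e by (auto simp: orth_def s'_def)
    have "\<forall>i\<in>{..<s}. \<exists>g. g \<in> tfuns \<and> (\<exists>L. 529 < (\<Sum>j<L. g j / h j * (cmod (Y (e i) j))\<^sup>2))"
      using bad unfolding Bad_def by blast
    from bchoice[OF this] obtain g where
      g': "\<forall>i\<in>{..<s}. g i \<in> tfuns \<and> (\<exists>L. 529 < (\<Sum>j<L. g i j / h j * (cmod (Y (e i) j))\<^sup>2))" by blast
    then have "\<forall>i\<in>{..<s}. \<exists>L. 529 < (\<Sum>j<L. g i j / h j * (cmod (Y (e i) j))\<^sup>2)" by blast
    from bchoice[OF this] obtain L where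
      L: "\<forall>i\<in>{..<s}. 529 < (\<Sum>j<L i. g i j / h j * (cmod (Y (e i) j))\<^sup>2)" by blast
    have g: "\<And>i. i < s \<Longrightarrow> g i \<in> tfuns"
      and gL: "\<And>i. i < s \<Longrightarrow> 529 < (\<Sum>j<L i. g i j / h j * (cmod (Y (e i) j))\<^sup>2)"
      using g' L by simp_all
    obtain G where G: "G \<in> wball" "\<And>i j. i < s' \<Longrightarrow> N \<le> j \<Longrightarrow> g i j \<le> 16 * G j"
    proof -
      have "\<exists>G\<in>wball. \<forall>i<s'. \<forall>j\<ge>N. g i j \<le> 16 * G j"
        by (rule wball_dominates_tail) (simp_all add: g s'_def)
      then show ?thesis using that by blast
    qed
    have G0: "0 \<le> G j" for j by (rule wballD(1)[OF G(1)])
    define L' where "L' = (\<Sum>i<s. L i)"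
    have each: "529 \<le> (\<Sum>j<L'. 16 * (G j / h j) * (cmod (Y (e i) j))\<^sup>2)" if i: "i < s'" for i
    proof -
      have iss: "i < s" using i by (simp add: s'_def)
      have "529 \<le> (\<Sum>j<L i. g i j / h j * (cmod (Y (e i) j))\<^sup>2)" using gL[OF iss] by simp
      also have "\<dots> \<le> (\<Sum>j<L i. 16 * (G j / h j) * (cmod (Y (e i) j))\<^sup>2)"
      proof (rule sum_mono)
        fix j
        show "g i j / h j * (cmod (Y (e i) j))\<^sup>2 \<le> 16 * (G j / h j) * (cmod (Y (e i) j))\<^sup>2"
        proof (cases "j < N")
          case True then show ?thesis using supp[OF eE[OF iss]] by simp
        next
          case False
          then have "g i j / h j \<le> 16 * G j / h j" using G(2)[OF i, of j] h0 by (intro divide_right_mono) auto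
          then show ?thesis by (intro mult_right_mono) auto
        qed
      qed
      also have "\<dots> \<le> (\<Sum>j<L'. 16 * (G j / h j) * (cmod (Y (e i) j))\<^sup>2)"
      proof (rule sum_mono2)
        have "L i \<le> L'" unfolding L'_def using iss by (intro member_le_sum) auto
        then show "{..<L i} \<subseteq> {..<L'}" by auto
      qed (use G0 h0 in auto)
      finally show ?thesis .
    qed
    have "real s' * 529 \<le> (\<Sum>i<s'. \<Sum>j<L'. 16 * (G j / h j) * (cmod (Y (e i) j))\<^sup>2)"
      using sum_mono[of "{..<s'}" "\<lambda>_. 529" "\<lambda>i. \<Sum>j<L'. 16 * (G j / h j) * (cmod (Y (e i) j))\<^sup>2"] each by simp
    also have "\<dots> = (\<Sum>j<L'. 16 * (G j / h j) * (\<Sum>i<s'. (cmod (Y (e i) j))\<^sup>2))"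
      by (subst sum.swap) (simp add: sum_distrib_left)
    also have "\<dots> \<le> (\<Sum>j<L'. 16 * (G j / h j) * \<rho> j)"
      using G0 h0 \<rho>0 dom by (intro sum_mono mult_left_mono bessel_kernel[OF sub Y e']) auto
    also have "\<dots> = 16 * (\<Sum>j<L'. \<rho> j * (G j / h j))" by (simp add: sum_distrib_left mult_ac)
    also have "\<dots> \<le> 16 * (2 * real n)" using hmax[OF G(1)] by simp
    finally have "real (s' * 529) \<le> real (32 * n)" by simp
    then have "s' * 529 \<le> 32 * n" by (simp only: of_nat_le_iff)
    \<comment> \<open>If s \<le> N + 1, then 529 s \<le> 32 n gives 16 s \<le> n, as 529 exceeds
      512. Otherwise 529 (N + 1) \<le> 32 (8 N + 7), which is impossible.\<close>
    then show False using neg nN by (cases "s \<le> N + 1") (auto simp: s'_def)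
  qed
  define E' where "E' = {p\<in>E. \<forall>i<s. ip (Y p) (Y (e i)) = 0}"
  have "\<exists>m. has_cdim E' m \<and> n1 \<le> m + s"
    unfolding E'_def by (rule has_cdim_kers[OF E]) (rule linmap_ip[OF Y linmapD(1)[OF Y eE]])
  then obtain m where m: "has_cdim E' m" "n1 \<le> m + s" by blast
  have "good h (23 * n2 (Y p)) (Y p)" if p': "p \<in> E'" for p
  proof -
    have p: "p \<in> E" and pe: "\<And>i. i < s \<Longrightarrow> ip (Y p) (Y (e i)) = 0" using p' by (auto simp: E'_def)
    have Yp: "Y p \<in> l2" by (rule linmapD(1)[OF Y p])
    define c where "c = n2 (Y p)"
    have c0: "0 \<le> c" unfolding c_def by (rule n2_nonneg[OF Yp])
    have pos: "0 < h j" if "Y p j \<noteq> 0" for j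
    proof (rule hpos)
      have "0 < (cmod (Y p j))\<^sup>2" using that by simp
      then have "0 < \<rho> j * (n2 (Y p))\<^sup>2" using dom[OF p, of j] by linarith
      then show "0 < \<rho> j" using zero_less_mult_pos2[of "\<rho> j"] \<rho>0[of j] by (auto simp: zero_less_mult_iff)
    qed
    have "(\<Sum>j<L. g j / h j * (cmod (Y p j))\<^sup>2) \<le> (23 * c)\<^sup>2" if g: "g \<in> tfuns" for g L
    proof (cases "c = 0")
      case True
      then have "Y p j = 0" for j using n2_zero[OF Yp] by (simp add: c_def)
      then show ?thesis by simp
    next
      case False
      define q where "q = pscale (of_real (1 / c)) p"
      have q: "q \<in> E" unfolding q_def by (rule PV.subspace_scale[OF sub p])
      have Yq: "Y q = (\<lambda>j. of_real (1 / c) * Y p j)" unfolding q_def by (rule linmapD(3)[OF Y p])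
      have "ip (Y q) (Y (e i)) = 0" if "i < s" for i
        unfolding Yq ip_scale[OF Yp linmapD(1)[OF Y eE[OF that]]] pe[OF that] by (rule mult_zero_right)
      moreover have "ip (Y q) (Y q) = of_real (1 / c) * (cnj (of_real (1 / c)) * of_real (c\<^sup>2))"
        unfolding Yq ip_scale[OF Yp l2_scale[OF Yp]] ip_scale2[OF Yp Yp] ip_self[OF Yp] c_def ..
      then have "ip (Y q) (Y q) = 1" using False by (simp add: power2_eq_square)
      ultimately have "\<not> Bad q" using max[OF q] by blast
      then have "(\<Sum>j<L. g j / h j * (cmod (Y q j))\<^sup>2) \<le> 529" using g unfolding Bad_def by (meson not_less)
      moreover have "(\<Sum>j<L. g j / h j * (cmod (Y q j))\<^sup>2) = (\<Sum>j<L. g j / h j * (cmod (Y p j))\<^sup>2) / c\<^sup>2"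
        unfolding Yq sum_divide_distrib using c0
        by (intro sum.cong) (auto simp: norm_mult norm_divide power_mult_distrib power_divide)
      ultimately have "(\<Sum>j<L. g j / h j * (cmod (Y p j))\<^sup>2) / c\<^sup>2 \<le> 529" by simp
      moreover have "0 < c\<^sup>2" using False by simp
      ultimately show ?thesis by (simp add: pos_divide_le_eq power_mult_distrib)
    qed
    moreover have "(\<Sum>j<L. (cmod (Y p j))\<^sup>2) \<le> (23 * c)\<^sup>2" for L
    proof -
      have "c\<^sup>2 \<le> (23 * c)\<^sup>2" by (simp add: power_mult_distrib)
      then show ?thesis using l2_partial[OF Yp, of L] unfolding c_def by linarith
    qed
    moreover have "0 \<le> 23 * c" using c0 by simp
    ultimately show ?thesis using h pos unfolding good_def c_def by blast
  qed
  moreover have "E' \<subseteq> E" by (auto simp only: E'_def)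
  moreover have "16 * n1 \<le> 16 * m + n" using m(2) \<open>16 * s \<le> n\<close> by linarith
  ultimately show ?thesis using m(1) by blast
qed

section \<open>Hilbertian subspaces of \<open>Z(T\<^sup>2)\<close>\<close>

lemma ZT2_subspace: "PV.subspace ZT2"
  using ZT.Z_csubspace unfolding csubspace_iff ZT2_eq .

lemma ZT2_plus: "p \<in> ZT2 \<Longrightarrow> q \<in> ZT2 \<Longrightarrow> ZT2N (p + q) \<le> ZT2N p + ZT2N q"
  using ZT.Z_padd unfolding ZT2_eq padd_plus by blast

lemma ZT2_minus: "p \<in> ZT2 \<Longrightarrow> q \<in> ZT2 \<Longrightarrow> p - q \<in> ZT2 \<and> ZT2N (p - q) \<le> ZT2N p + ZT2N q"
  using ZT.Z_pdiff unfolding ZT2_eq pdiff_minus by blast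

lemma snd_linmap:
  assumes "E \<subseteq> ZT2"
  shows "linmap E snd"
proof -
  have "snd p \<in> l2" if "p \<in> ZT2" for p by (rule l2_I(1)[OF ZT2_nonneg[OF that] ZT2_snd_l2[OF that]])
  then show ?thesis
    using assms unfolding linmap_def by (auto simp: plus_prod_def plus_fun_def pscale_def)
qed

lemma n2_snd_le: "p \<in> ZT2 \<Longrightarrow> n2 (snd p) \<le> ZT2N p"
  by (rule l2_I(2)[OF ZT2_nonneg ZT2_snd_l2])

lemma fst_l2:
  assumes "(u, \<lambda>_. 0) \<in> ZT2"
  shows "u \<in> l2" "n2 u \<le> 2 * ZT2N (u, \<lambda>_. 0)"
proof -
  have "0 \<le> 2 * ZT2N (u, \<lambda>_. 0)" using ZT2_nonneg[OF assms] by simp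
  then show "u \<in> l2" "n2 u \<le> 2 * ZT2N (u, \<lambda>_. 0)" by (rule l2_I[OF _ ZT2_fst_l2[OF assms]])+
qed

section \<open>Sheared components and the comparison of weights\<close>

definition shear :: "(nat \<Rightarrow> real) \<Rightarrow> pseq \<Rightarrow> seq" where
  "shear h p = (\<lambda>j. fst p j - snd p j * of_real (ln (h j)))"

lemma shear_plus: "shear h (p + q) = (\<lambda>j. shear h p j + shear h q j)"
  by (auto simp: shear_def plus_prod_def plus_fun_def algebra_simps)

lemma shear_pscale: "shear h (pscale c p) = (\<lambda>j. c * shear h p j)"
  by (auto simp: shear_def pscale_def algebra_simps)

lemma shear_decomp:
  assumes "p \<in> ZT2" "good h M (snd p)"
  shows "p = (\<lambda>j. snd p j * of_real (ln (h j)), snd p) + (shear h p, \<lambda>_. 0)" "(shear h p, \<lambda>_. 0) \<in> ZT2"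
proof -
  show eq: "p = (\<lambda>j. snd p j * of_real (ln (h j)), snd p) + (shear h p, \<lambda>_. 0)"
    by (rule prod_eqI) (auto simp: shear_def plus_prod_def plus_fun_def)
  have "p - (\<lambda>j. snd p j * of_real (ln (h j)), snd p) = (shear h p, \<lambda>_. 0)"
    by (subst (1) eq) simp
  then show "(shear h p, \<lambda>_. 0) \<in> ZT2"
    using ZT2_minus[OF assms(1) conjunct1[OF chart(1)[OF assms(2)]]] by simp
qed

text \<open>The two charts of v have the same second component, so their difference is a pair (u, 0)
  of norm at most 2 M + 2 M, and passing to l_2 doubles this.\<close>

lemma good_weights_compare:
  assumes "good h M v" "good k M v"
  shows "(\<lambda>j. v j * (of_real (ln (h j)) - of_real (ln (k j)))) \<in> l2"
    "n2 (\<lambda>j. v j * (of_real (ln (h j)) - of_real (ln (k j)))) \<le> 8 * M"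
proof -
  let ?a = "(\<lambda>j. v j * of_real (ln (h j)), v)" and ?b = "(\<lambda>j. v j * of_real (ln (k j)), v)"
  let ?D = "\<lambda>j. v j * (of_real (ln (h j)) - of_real (ln (k j)))"
  have ab: "?a \<in> ZT2" "?b \<in> ZT2" "ZT2N ?a \<le> 2 * M" "ZT2N ?b \<le> 2 * M" using chart(1)[OF assms(1)] chart(1)[OF assms(2)] by auto
  have eq: "?a - ?b = (?D, \<lambda>_. 0)"
    by (auto simp: minus_prod_def fun_diff_def zero_fun_def algebra_simps)
  have "(?D, \<lambda>_. 0) \<in> ZT2" "ZT2N (?D, \<lambda>_. 0) \<le> 4 * M" using ZT2_minus[OF ab(1,2)] ab(3,4) unfolding eq by linarith+
  then show "?D \<in> l2" "n2 ?D \<le> 8 * M" using fst_l2[of ?D] by linarith+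
qed

text \<open>For arbitrary p the sheared component need not be square-summable; only its pairing with
  a good vector is known to converge.\<close>

lemma shear_pairing:
  assumes p: "p \<in> ZT2" and v: "good h M v"
  shows "summable (\<lambda>j. shear h p j * cnj (v j))" "cmod (ip (shear h p) v) \<le> 2 * M * ZT2N p"
proof -
  have w: "good h M (\<lambda>j. cnj (v j))" by (rule good_solid[OF v]) simp
  have le: "(\<Sum>j<L. cmod (shear h p j * cnj (v j))) \<le> 2 * M * ZT2N p" for L
    using pairing_abs[OF p w, of L] by (simp add: shear_def mult.commute)
  have s: "summable (\<lambda>j. cmod (shear h p j * cnj (v j)))"
    by (rule bounded_imp_summable[of _ "2 * M * ZT2N p"]) (use le[of "Suc _"] in \<open>simp_all add: lessThan_Suc_atMost\<close>)
  show "summable (\<lambda>j. shear h p j * cnj (v j))" by (rule summable_norm_cancel[OF s])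
  show "cmod (ip (shear h p) v) \<le> 2 * M * ZT2N p"
    unfolding ip_def by (rule order_trans[OF summable_norm[OF s] suminf_le_const[OF s le]])
qed

lemma form_sum_bound:
  fixes a b :: real
  assumes "0 \<le> a" "0 \<le> b"
  shows "a \<le> sqrt (a\<^sup>2 + b\<^sup>2)" "b \<le> sqrt (a\<^sup>2 + b\<^sup>2)"
  using assms by (auto intro!: real_le_rsqrt)

text \<open>On F the norm is equivalent to that of the pair (\<open>shear h0 p\<close>,
  \<open>snd p\<close>) in l_2. The work is to extend this inner product in its first argument to
  all of Z(T2), where \<open>shear h0 p\<close> has no controlled pairing with F but
  \<open>shear h1 p\<close> does.\<close>

lemma hilbertian_subspace:
  assumes E: "E \<subseteq> ZT2" and F: "has_cdim F m" "F \<subseteq> E"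
    and good0: "\<And>p. p \<in> F \<Longrightarrow> good h0 (23 * n2 (snd p)) (snd p)"
    and good1: "\<And>p. p \<in> F \<Longrightarrow> good h1 (23 * n2 (snd p)) (snd p)"
    and goodU: "\<And>p. p \<in> F \<Longrightarrow> good h1 (23 * n2 (shear h0 p)) (shear h0 p)"
    and Ul2: "linmap F (shear h0)"
  shows "bm_dist_l2 ZT2N F m \<le> 231 * 231 \<and>
    (\<exists>P. clinear_on ZT2 P padd pscale \<and> (\<forall>x\<in>ZT2. P x \<in> F) \<and> (\<forall>x\<in>F. P x = x) \<and> (\<forall>x\<in>ZT2. ZT2N (P x) \<le> (231 * 231) * ZT2N x))"
proof -
  have FZ: "F \<subseteq> ZT2" using E F by blast
  have sub: "PV.subspace F" by (rule has_cdim_subspace[OF F(1)])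
  have Y: "linmap F snd" by (rule snd_linmap[OF FZ])
  have Yl2: "snd p \<in> l2" if "p \<in> ZT2" for p using linmapD(1)[OF snd_linmap[of "{p}"]] that by simp
  interpret S: hform F "\<lambda>x y. ip (snd x) (snd y)" by (rule linmap_hform[OF sub Y])
  interpret V: hform F "\<lambda>x y. ip (shear h0 x) (shear h0 y)" by (rule linmap_hform[OF sub Ul2])
  obtain d e where e: "S.orth d e"
    and null: "\<And>x. x \<in> F \<Longrightarrow> ip (snd (x - (\<Sum>i<d. pscale (ip (snd x) (snd (e i))) (e i)))) (snd (x - (\<Sum>i<d. pscale (ip (snd x) (snd (e i))) (e i)))) = 0"
    by (rule S.orthonormal_basis[OF F(1)]) blast
  have eF: "e i \<in> F" if "i < d" for i using e that by (auto simp: S.orth_def)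
  \<comment> \<open>The second component of \<open>Q p\<close> is the orthogonal projection of that
    of p onto the second components of F. Several elements of F may share it; the system e fixes a
    linear choice.\<close>
  define Q where "Q p = (\<Sum>i<d. pscale (ip (snd p) (snd (e i))) (e i))" for p :: pseq
  have QF: "Q p \<in> F" for p unfolding Q_def by (rule S.lincomb_mem[OF eF])
  have Q_add: "Q (p + q) = Q p + Q q" if "p \<in> ZT2" "q \<in> ZT2" for p q
  proof -
    have "ip (snd (p + q)) (snd (e i)) = ip (snd p) (snd (e i)) + ip (snd q) (snd (e i))" if "i < d" for i
      using linmap_ip[OF snd_linmap[OF order_refl] Yl2] eF[OF that] FZ \<open>p \<in> ZT2\<close> \<open>q \<in> ZT2\<close> unfolding lin_on_def by blast
    then show ?thesis by (simp add: Q_def PV.scale_left_distrib sum.distrib)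
  qed
  have Q_scale: "Q (pscale c p) = pscale c (Q p)" if "p \<in> ZT2" for c p
  proof -
    have "ip (snd (pscale c p)) (snd (e i)) = c * ip (snd p) (snd (e i))" if "i < d" for i
      using linmap_ip[OF snd_linmap[OF order_refl] Yl2] eF[OF that] FZ \<open>p \<in> ZT2\<close> unfolding lin_on_def by blast
    then show ?thesis by (simp add: Q_def PV.scale_sum_right)
  qed
  have Q_id: "snd (Q p) = snd p" if p: "p \<in> F" for p
  proof -
    have r: "p - Q p \<in> F" by (rule PV.subspace_diff[OF sub p QF])
    have "complex_of_real ((n2 (snd (p - Q p)))\<^sup>2) = 0"
      using null[OF p] unfolding Q_def[symmetric] ip_self[OF Yl2[OF subsetD[OF FZ r]]] .
    then have "n2 (snd (p - Q p)) = 0" by simp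
    then have "snd (p - Q p) = (\<lambda>_. 0)" using n2_zero[OF Yl2[OF subsetD[OF FZ r]]] by blast
    then show ?thesis by (simp add: minus_prod_def fun_diff_def fun_eq_iff)
  qed
  have Q_le: "n2 (snd (Q p)) \<le> n2 (snd p)" if p: "p \<in> ZT2" for p
  proof -
    define \<sigma> where "\<sigma> = (\<Sum>i<d. (cmod (ip (snd p) (snd (e i))))\<^sup>2)"
    have QZ: "snd (Q p) \<in> l2" by (rule Yl2[OF subsetD[OF FZ QF]])
    have \<sigma>0: "0 \<le> \<sigma>" by (simp add: \<sigma>_def sum_nonneg)
    have "complex_of_real ((n2 (snd (Q p)))\<^sup>2) = of_real \<sigma>"
      using S.form_lincomb_self[OF e, of "\<lambda>i. ip (snd p) (snd (e i))"]
      unfolding Q_def[symmetric] ip_self[OF QZ] \<sigma>_def .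
    then have n2Q: "(n2 (snd (Q p)))\<^sup>2 = \<sigma>" by (simp only: of_real_eq_iff)
    have "lin_on F (\<lambda>x. ip (snd x) (snd p))" by (rule linmap_ip[OF Y Yl2[OF p]])
    then have "ip (snd (Q p)) (snd p) = (\<Sum>i<d. ip (snd (pscale (ip (snd p) (snd (e i))) (e i))) (snd p))"
      unfolding Q_def by (rule lin_on_sum[OF _ sub]) (auto intro: PV.subspace_scale[OF sub] eF)
    also have "\<dots> = (\<Sum>i<d. of_real ((cmod (ip (snd p) (snd (e i))))\<^sup>2))"
    proof (rule sum.cong)
      fix i assume "i \<in> {..<d}"
      then have i: "i < d" by simp
      have "ip (snd (pscale (ip (snd p) (snd (e i))) (e i))) (snd p) = ip (snd p) (snd (e i)) * ip (snd (e i)) (snd p)"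
        unfolding linmapD(3)[OF Y eF[OF i]] by (rule ip_scale[OF linmapD(1)[OF Y eF[OF i]] Yl2[OF p]])
      also have "\<dots> = ip (snd p) (snd (e i)) * cnj (ip (snd p) (snd (e i)))"
        using ip_herm[OF Yl2[OF p] linmapD(1)[OF Y eF[OF i]]] by simp
      finally show "ip (snd (pscale (ip (snd p) (snd (e i))) (e i))) (snd p) = of_real ((cmod (ip (snd p) (snd (e i))))\<^sup>2)"
        unfolding complex_norm_square .
    qed simp
    also have "\<dots> = of_real \<sigma>" unfolding \<sigma>_def by (rule of_real_sum[symmetric])
    finally have "cmod (ip (snd (Q p)) (snd p)) = \<sigma>" using \<sigma>0 by simp
    then have "\<sigma> \<le> n2 (snd p) * n2 (snd (Q p))" using ip_CS[OF QZ Yl2[OF p]] by (simp add: mult.commute)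
    moreover have sq: "n2 (snd (Q p)) = sqrt \<sigma>" using n2Q n2_nonneg[OF QZ] by (metis real_sqrt_unique)
    ultimately show ?thesis using sqrt_le_if_le_mult[OF \<sigma>0 n2_nonneg[OF Yl2[OF p]]] by simp
  qed
  define D where "D v = (\<lambda>j. v j * (of_real (ln (h0 j)) - of_real (ln (h1 j))))" for v :: seq
  \<comment> \<open>Goodness for both weights with constant 23 gives 8 * 23 = 184.\<close>
  have D: "D (snd p) \<in> l2" "n2 (D (snd p)) \<le> 184 * n2 (snd p)" if "p \<in> F" for p
    using good_weights_compare[OF good0[OF that] good1[OF that]] unfolding D_def by simp_all
  \<comment> \<open>On F one has shear h0 p = shear h1 p - D (snd p). Outside F,
    \<open>D (snd p)\<close> may fail to be square-summable, so \<open>snd p\<close> is first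
    projected by Q, which changes nothing on F.\<close>
  define \<beta> where "\<beta> p q = ip (shear h1 p) (shear h0 q) - ip (D (snd (Q p))) (shear h0 q) + ip (snd p) (snd q)" for p q
  have Ul: "shear h0 q \<in> l2" if "q \<in> F" for q by (rule linmapD(1)[OF Ul2 that])
  have summ: "summable (\<lambda>j. shear h1 p j * cnj (shear h0 q j))" if "p \<in> ZT2" "q \<in> F" for p q
    by (rule shear_pairing(1)[OF that(1) goodU[OF that(2)]])
  have \<beta>_F: "\<beta> p q = ip (shear h0 p) (shear h0 q) + ip (snd p) (snd q)" if p: "p \<in> F" and q: "q \<in> F" for p q
  proof -
    have pZ: "p \<in> ZT2" using p FZ by blast
    have "ip (shear h1 p) (shear h0 q) - ip (D (snd p)) (shear h0 q)
      = (\<Sum>j. shear h1 p j * cnj (shear h0 q j) - D (snd p) j * cnj (shear h0 q j))"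
      unfolding ip_def by (rule suminf_diff[OF summ[OF pZ q] ip_summable[OF D(1)[OF p] Ul[OF q]]])
    also have "(\<lambda>j. shear h1 p j * cnj (shear h0 q j) - D (snd p) j * cnj (shear h0 q j)) = (\<lambda>j. shear h0 p j * cnj (shear h0 q j))"
      by (auto simp: shear_def D_def algebra_simps)
    finally show ?thesis by (simp add: \<beta>_def Q_id[OF p] ip_def)
  qed
  have \<beta>_self: "Re (\<beta> p p) = (n2 (shear h0 p))\<^sup>2 + (n2 (snd p))\<^sup>2" if "p \<in> F" for p
    unfolding \<beta>_F[OF that that] ip_self[OF Ul[OF that]] ip_self[OF linmapD(1)[OF Y that]] by simp
  have linX: "lin_on ZT2 (\<lambda>x. \<beta> x z)" if z: "z \<in> F" for z
    unfolding lin_on_def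
  proof (intro conjI ballI allI)
    have zl: "snd z \<in> l2" by (rule linmapD(1)[OF Y z])
    fix x assume x: "x \<in> ZT2"
    have Dx: "D (snd (Q x)) \<in> l2" by (rule D(1)[OF QF])
    show "\<beta> (x + y) z = \<beta> x z + \<beta> y z" if y: "y \<in> ZT2" for y
    proof -
      have Dy: "D (snd (Q y)) \<in> l2" by (rule D(1)[OF QF])
      have "ip (shear h1 (x + y)) (shear h0 z) = ip (shear h1 x) (shear h0 z) + ip (shear h1 y) (shear h0 z)"
        unfolding ip_def shear_plus distrib_right by (rule suminf_add[OF summ[OF x z] summ[OF y z], symmetric])
      moreover have "D (snd (Q (x + y))) = (\<lambda>j. D (snd (Q x)) j + D (snd (Q y)) j)"
        unfolding Q_add[OF x y] by (auto simp: D_def plus_prod_def plus_fun_def algebra_simps)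
      moreover have "snd (x + y) = (\<lambda>j. snd x j + snd y j)" by (simp add: plus_prod_def plus_fun_def)
      ultimately show ?thesis
        unfolding \<beta>_def using ip_add[OF Dx Dy Ul[OF z]] ip_add[OF Yl2[OF x] Yl2[OF y] zl] by simp
    qed
    fix c
    have "ip (shear h1 (pscale c x)) (shear h0 z) = c * ip (shear h1 x) (shear h0 z)"
      unfolding ip_def shear_pscale mult.assoc by (rule suminf_mult[OF summ[OF x z]])
    moreover have "D (snd (Q (pscale c x))) = (\<lambda>j. c * D (snd (Q x)) j)"
      unfolding Q_scale[OF x] by (auto simp: D_def pscale_def algebra_simps)
    moreover have "snd (pscale c x) = (\<lambda>j. c * snd x j)" by (simp add: pscale_def)
    ultimately show "\<beta> (pscale c x) z = c * \<beta> x z"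
      unfolding \<beta>_def using ip_scale[OF Dx Ul[OF z], of c] ip_scale[OF Yl2[OF x] zl, of c] by (simp add: algebra_simps)
  qed
  have hform: "hform F \<beta>"
  proof
    show "PV.subspace F" by fact
    show "lin_on F (\<lambda>x. \<beta> x z)" if "z \<in> F" for z by (rule lin_on_subset[OF linX[OF that] FZ])
    show "\<beta> y x = cnj (\<beta> x y)" if "x \<in> F" "y \<in> F" for x y
      unfolding \<beta>_F[OF that] \<beta>_F[OF that(2,1)] V.herm[OF that] S.herm[OF that] by simp
    show "0 \<le> Re (\<beta> x x)" if "x \<in> F" for x unfolding \<beta>_self[OF that] by simp
  qed
  have Fadd: "shear h0 (y + z) = (\<lambda>j. shear h0 y j + shear h0 z j)" "snd (y + z) = (\<lambda>j. snd y j + snd z j)" for y z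
    by (rule shear_plus) (simp add: plus_prod_def plus_fun_def)
  show ?thesis
  proof (rule hilbert_complemented[where \<beta> = \<beta>])
    show "PV.subspace ZT2" by (rule ZT2_subspace)
    show "has_cdim F m" "F \<subseteq> ZT2" "hform F \<beta>" by fact+
    show "0 \<le> ZT2N x" if "x \<in> ZT2" for x by (rule ZT2_nonneg[OF that])
    show "x = 0" if "x \<in> ZT2" "ZT2N x = 0" for x
      using ZT.Z_banach that unfolding banach_on_def ZT2_eq pzero_zero by blast
    show "lin_on ZT2 (\<lambda>x. \<beta> x z)" if "z \<in> F" for z by (rule linX[OF that])
    show "\<beta> x (y + z) = \<beta> x y + \<beta> x z" if x: "x \<in> ZT2" and y: "y \<in> F" and z: "z \<in> F" for x y z
    proof -
      have Dx: "D (snd (Q x)) \<in> l2" by (rule D(1)[OF QF])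
      have "ip (shear h1 x) (shear h0 (y + z)) = ip (shear h1 x) (shear h0 y) + ip (shear h1 x) (shear h0 z)"
        unfolding ip_def shear_plus complex_cnj_add distrib_left by (rule suminf_add[OF summ[OF x y] summ[OF x z], symmetric])
      then show ?thesis
        unfolding \<beta>_def using ip_add2[OF Ul[OF y] Ul[OF z] Dx] ip_add2[OF linmapD(1)[OF Y y] linmapD(1)[OF Y z] Yl2[OF x]]
        by (simp add: Fadd plus_fun_def)
    qed
    show "\<beta> x (pscale c y) = cnj c * \<beta> x y" if x: "x \<in> ZT2" and y: "y \<in> F" for x y c
    proof -
      have Dx: "D (snd (Q x)) \<in> l2" by (rule D(1)[OF QF])
      have "(\<lambda>j. shear h1 x j * cnj (c * shear h0 y j)) = (\<lambda>j. cnj c * (shear h1 x j * cnj (shear h0 y j)))" by (auto simp: mult_ac)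
      then have "ip (shear h1 x) (shear h0 (pscale c y)) = cnj c * ip (shear h1 x) (shear h0 y)"
        unfolding ip_def shear_pscale using suminf_mult[OF summ[OF x y], of "cnj c"] by simp
      moreover have "snd (pscale c y) = (\<lambda>j. c * snd y j)" by (simp add: pscale_def)
      ultimately show ?thesis
        unfolding \<beta>_def shear_pscale using ip_scale2[OF Ul[OF y] Dx, of c] ip_scale2[OF linmapD(1)[OF Y y] Yl2[OF x], of c]
        by (simp add: algebra_simps)
    qed
    \<comment> \<open>The chart of the second component and that of the sheared one cost 2 * 23 = 46
      each; the common constant 231 is set by the estimate of \<beta> below.\<close>
    show "ZT2N x \<le> 231 * sqrt (Re (\<beta> x x))" if x: "x \<in> F" for x
    proof -
      have xZ: "x \<in> ZT2" using x FZ by blast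
      have nn: "0 \<le> n2 (shear h0 x)" "0 \<le> n2 (snd x)" using n2_nonneg Ul[OF x] Yl2[OF xZ] by blast+
      have c: "(\<lambda>j. snd x j * of_real (ln (h0 j)), snd x) \<in> ZT2"
        "ZT2N (\<lambda>j. snd x j * of_real (ln (h0 j)), snd x) \<le> 2 * (23 * n2 (snd x))" using chart(1)[OF good0[OF x]] by auto
      have u: "(shear h0 x, \<lambda>_. 0) \<in> ZT2" "ZT2N (shear h0 x, \<lambda>_. 0) \<le> 2 * (23 * n2 (shear h0 x))"
        using chart(2)[OF goodU[OF x]] by auto
      have "ZT2N x \<le> ZT2N (\<lambda>j. snd x j * of_real (ln (h0 j)), snd x) + ZT2N (shear h0 x, \<lambda>_. 0)"
        using ZT2_plus[OF c(1) u(1)] shear_decomp(1)[OF xZ good0[OF x]] by simp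
      also have "\<dots> \<le> 46 * n2 (snd x) + 46 * n2 (shear h0 x)" using c(2) u(2) by linarith
      also have "\<dots> \<le> 231 * sqrt ((n2 (shear h0 x))\<^sup>2 + (n2 (snd x))\<^sup>2)"
        using form_sum_bound[OF nn] nn by linarith
      finally show ?thesis unfolding \<beta>_self[OF x] .
    qed
    show "cmod (\<beta> x y) \<le> 231 * ZT2N x * sqrt (Re (\<beta> y y))" if x: "x \<in> ZT2" and y: "y \<in> F" for x y
    proof -
      define N where "N = ZT2N x"
      define s where "s = sqrt (Re (\<beta> y y))"
      have yZ: "y \<in> ZT2" using y FZ by blast
      have nn: "0 \<le> n2 (shear h0 y)" "0 \<le> n2 (snd y)" using n2_nonneg Ul[OF y] Yl2[OF yZ] by blast+
      have s: "n2 (shear h0 y) \<le> s" "n2 (snd y) \<le> s" unfolding s_def \<beta>_self[OF y] using form_sum_bound[OF nn] by auto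
      have N0: "0 \<le> N" unfolding N_def by (rule ZT2_nonneg[OF x])
      have nx: "n2 (snd x) \<le> N" unfolding N_def by (rule n2_snd_le[OF x])
      have "cmod (ip (shear h1 x) (shear h0 y)) \<le> 2 * (23 * n2 (shear h0 y)) * N"
        unfolding N_def by (rule shear_pairing(2)[OF x goodU[OF y]])
      also have "\<dots> \<le> 2 * (23 * s) * N" using s N0 by (intro mult_right_mono) auto
      finally have 1: "cmod (ip (shear h1 x) (shear h0 y)) \<le> 46 * (N * s)" by (simp add: mult_ac)
      have "n2 (D (snd (Q x))) \<le> 184 * N" using D(2)[OF QF[of x]] Q_le[OF x] nx by linarith
      then have "n2 (D (snd (Q x))) * n2 (shear h0 y) \<le> (184 * N) * s" using s nn N0 by (intro mult_mono) auto
      then have 2: "cmod (ip (D (snd (Q x))) (shear h0 y)) \<le> 184 * (N * s)"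
        using ip_CS[OF D(1)[OF QF[of x]] Ul[OF y]] by (simp add: mult_ac)
      have "n2 (snd x) * n2 (snd y) \<le> N * s" using s nn nx N0 by (intro mult_mono) auto
      then have 3: "cmod (ip (snd x) (snd y)) \<le> N * s" using ip_CS[OF Yl2[OF x] Yl2[OF yZ]] by linarith
      have "cmod (\<beta> x y) \<le> cmod (ip (shear h1 x) (shear h0 y)) + cmod (ip (D (snd (Q x))) (shear h0 y)) + cmod (ip (snd x) (snd y))"
        unfolding \<beta>_def using norm_triangle_ineq[of "ip (shear h1 x) (shear h0 y) - ip (D (snd (Q x))) (shear h0 y)" "ip (snd x) (snd y)"]
          norm_triangle_ineq4[of "ip (shear h1 x) (shear h0 y)" "ip (D (snd (Q x))) (shear h0 y)"] by linarith
      \<comment> \<open>231 = 46 + 184 + 1.\<close>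
      also have "\<dots> \<le> 231 * (N * s)" using 1 2 3 by linarith
      finally show ?thesis by (simp add: N_def s_def mult.assoc)
    qed
  qed simp
qed

text \<open>Dimension count: vanishing of N coordinates in both components costs 2 N \<le> n / 4,
  and each of three selections costs at most n / 16.\<close>

lemma exists_good_subspace:
  assumes E: "E \<subseteq> ZT2" and dim: "has_cdim E n"
  shows "\<exists>F m h0 h1. F \<subseteq> E \<and> has_cdim F m \<and> n \<le> 2 * m \<and> linmap F (shear h0) \<and>
    (\<forall>p\<in>F. good h0 (23 * n2 (snd p)) (snd p) \<and> good h1 (23 * n2 (snd p)) (snd p) \<and>
       good h1 (23 * n2 (shear h0 p)) (shear h0 p))"
proof -
  \<comment> \<open>Large enough that N + 1 mergeable functionals exceed the number of bad vectors
    allowed by the trace, small enough that discarding 2 N dimensions is harmless.\<close>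
  define N where "N = n div 8"
  have nN: "n \<le> 8 * N + 7" "8 * N \<le> n" by (simp_all add: N_def)
  define f where "f i x = (if i < N then fst x i else snd x (i - N))" for i and x :: pseq
  define E1 where "E1 = {x\<in>E. \<forall>i<2*N. f i x = 0}"
  have "\<exists>m. has_cdim E1 m \<and> n \<le> m + 2 * N"
    unfolding E1_def
    by (rule has_cdim_kers[OF dim]) (simp add: lin_on_def f_def plus_prod_def plus_fun_def pscale_def)
  then obtain n1 where n1: "has_cdim E1 n1" "n \<le> n1 + 2 * N" by blast
  have E1E: "E1 \<subseteq> E" by (auto simp only: E1_def)
  have n1n: "n1 \<le> n"
  proof -
    obtain B where "finite B" "card B = n1" "PV.independent B" "PV.span B = E1" using n1(1) by (auto simp: has_cdim_iff)
    then show ?thesis using has_cdim_bound(2)[OF dim, of B] PV.span_superset[of B] E1E by auto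
  qed
  have zero: "fst p j = 0 \<and> snd p j = 0" if "p \<in> E1" "j < N" for p j
  proof -
    have *: "f i p = 0" if "i < 2 * N" for i using \<open>p \<in> E1\<close> that by (simp add: E1_def)
    show ?thesis using *[of j] *[of "N + j"] that(2) by (simp add: f_def)
  qed
  have Y1: "linmap E1 snd" by (rule snd_linmap) (use E1E E in blast)
  obtain \<rho>1 where \<rho>1: "\<And>j. 0 \<le> \<rho>1 j" "summable \<rho>1" "suminf \<rho>1 \<le> real n1"
    "\<And>p j. p \<in> E1 \<Longrightarrow> (cmod (snd p j))\<^sup>2 \<le> \<rho>1 j * (n2 (snd p))\<^sup>2"
    by (rule kernel_weight[OF n1(1) Y1]) blast
  obtain h0 where h0: "h0 \<in> wball" "\<And>j. 0 < \<rho>1 j \<Longrightarrow> 0 < h0 j"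
    "\<And>h L. h \<in> wball \<Longrightarrow> (\<Sum>j<L. \<rho>1 j * (h j / h0 j)) \<le> suminf \<rho>1"
    by (rule lozanovskii[OF \<rho>1(1,2)]) blast
  have "\<exists>E' m. E' \<subseteq> E1 \<and> has_cdim E' m \<and> 16 * n1 \<le> 16 * m + n \<and> (\<forall>p\<in>E'. good h0 (23 * n2 (snd p)) (snd p))"
  proof (rule good_subspace[OF n1(1) Y1 _ h0(1) \<rho>1(1) h0(2) _ \<rho>1(4) nN(1)])
    show "snd p j = 0" if "p \<in> E1" "j < N" for p j using zero[OF that] by blast
    show "(\<Sum>j<L. \<rho>1 j * (g j / h0 j)) \<le> 2 * real n" if "g \<in> wball" for g L
      using h0(3)[OF that, of L] \<rho>1(3) n1n by linarith
  qed
  then obtain E2 n2' where E2: "E2 \<subseteq> E1" "has_cdim E2 n2'" "16 * n1 \<le> 16 * n2' + n"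
    "\<And>p. p \<in> E2 \<Longrightarrow> good h0 (23 * n2 (snd p)) (snd p)" by blast
  have E2Z: "p \<in> ZT2" if "p \<in> E2" for p using that E2(1) E1E E by blast
  \<comment> \<open>Goodness for \<open>h0\<close> places the sheared component in l_2; hence the
    second kernel is formed only on E2.\<close>
  have U2: "linmap E2 (shear h0)"
    unfolding linmap_def
  proof (intro conjI ballI allI)
    show "shear h0 x \<in> l2" if "x \<in> E2" for x
      by (rule fst_l2(1)[OF shear_decomp(2)[OF E2Z[OF that] E2(4)[OF that]]])
  qed (rule shear_plus shear_pscale)+
  have n2n: "n2' \<le> n"
  proof -
    obtain B where "finite B" "card B = n2'" "PV.independent B" "PV.span B = E2" using E2(2) by (auto simp: has_cdim_iff)
    then show ?thesis using has_cdim_bound(2)[OF dim, of B] PV.span_superset[of B] E1E E2(1) by auto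
  qed
  obtain \<rho>2 where \<rho>2: "\<And>j. 0 \<le> \<rho>2 j" "summable \<rho>2" "suminf \<rho>2 \<le> real n2'"
    "\<And>p j. p \<in> E2 \<Longrightarrow> (cmod (shear h0 p j))\<^sup>2 \<le> \<rho>2 j * (n2 (shear h0 p))\<^sup>2"
    by (rule kernel_weight[OF E2(2) U2]) blast
  \<comment> \<open>The sum of both kernels makes one weight \<open>h1\<close> serve both
    components. Its total mass is up to 2 n, which accounts for the bound 2 n in
    \<open>good_subspace\<close>.\<close>
  define \<rho> where "\<rho> j = \<rho>1 j + \<rho>2 j" for j
  have \<rho>: "\<And>j. 0 \<le> \<rho> j" "summable \<rho>" using \<rho>1 \<rho>2 by (auto simp: \<rho>_def[abs_def] summable_add)
  have \<rho>n: "suminf \<rho> \<le> 2 * real n"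
    using suminf_add[OF \<rho>1(2) \<rho>2(2)] \<rho>1(3) \<rho>2(3) n1n n2n unfolding \<rho>_def by linarith
  obtain h1 where h1: "h1 \<in> wball" "\<And>j. 0 < \<rho> j \<Longrightarrow> 0 < h1 j"
    "\<And>h L. h \<in> wball \<Longrightarrow> (\<Sum>j<L. \<rho> j * (h j / h1 j)) \<le> suminf \<rho>"
    by (rule lozanovskii[OF \<rho>]) blast
  have h1n: "(\<Sum>j<L. \<rho> j * (g j / h1 j)) \<le> 2 * real n" if "g \<in> wball" for g L
    using h1(3)[OF that, of L] \<rho>n by linarith
  have Y2: "linmap E2 snd" by (rule linmap_subset[OF Y1 E2(1)])
  have "\<exists>E' m. E' \<subseteq> E2 \<and> has_cdim E' m \<and> 16 * n2' \<le> 16 * m + n \<and> (\<forall>p\<in>E'. good h1 (23 * n2 (snd p)) (snd p))"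
  proof (rule good_subspace[OF E2(2) Y2 _ h1(1) \<rho>(1) h1(2) h1n _ nN(1)])
    show "snd p j = 0" if "p \<in> E2" "j < N" for p j using zero[of p j] that E2(1) by blast
    show "(cmod (snd p j))\<^sup>2 \<le> \<rho> j * (n2 (snd p))\<^sup>2" if "p \<in> E2" for p j
    proof -
      have "\<rho>1 j * (n2 (snd p))\<^sup>2 \<le> \<rho> j * (n2 (snd p))\<^sup>2" using \<rho>2(1) by (intro mult_right_mono) (auto simp: \<rho>_def)
      then show ?thesis using \<rho>1(4)[of p j] that E2(1) by (meson order_trans subsetD)
    qed
  qed
  then obtain E3 n3 where E3: "E3 \<subseteq> E2" "has_cdim E3 n3" "16 * n2' \<le> 16 * n3 + n"
    "\<And>p. p \<in> E3 \<Longrightarrow> good h1 (23 * n2 (snd p)) (snd p)" by blast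
  have U3: "linmap E3 (shear h0)" by (rule linmap_subset[OF U2 E3(1)])
  have "\<exists>E' m. E' \<subseteq> E3 \<and> has_cdim E' m \<and> 16 * n3 \<le> 16 * m + n \<and> (\<forall>p\<in>E'. good h1 (23 * n2 (shear h0 p)) (shear h0 p))"
  proof (rule good_subspace[OF E3(2) U3 _ h1(1) \<rho>(1) h1(2) h1n _ nN(1)])
    show "shear h0 p j = 0" if "p \<in> E3" "j < N" for p j using zero[of p j] that E2(1) E3(1) by (auto simp: shear_def)
    show "(cmod (shear h0 p j))\<^sup>2 \<le> \<rho> j * (n2 (shear h0 p))\<^sup>2" if "p \<in> E3" for p j
    proof -
      have "\<rho>2 j * (n2 (shear h0 p))\<^sup>2 \<le> \<rho> j * (n2 (shear h0 p))\<^sup>2" using \<rho>1(1) by (intro mult_right_mono) (auto simp: \<rho>_def)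
      then show ?thesis using \<rho>2(4)[of p j] that E3(1) by (meson order_trans subsetD)
    qed
  qed
  then obtain F m where F: "F \<subseteq> E3" "has_cdim F m" "16 * n3 \<le> 16 * m + n"
    "\<And>p. p \<in> F \<Longrightarrow> good h1 (23 * n2 (shear h0 p)) (shear h0 p)" by blast
  have "F \<subseteq> E" using F(1) E3(1) E2(1) E1E by blast
  \<comment> \<open>At least n - n/4 - 3n/16 = 9n/16 dimensions remain.\<close>
  moreover have "n \<le> 2 * m" using n1(2) nN(2) E2(3) E3(3) F(3) by linarith
  moreover have "linmap F (shear h0)" by (rule linmap_subset[OF U3 F(1)])
  moreover have "good h0 (23 * n2 (snd p)) (snd p) \<and> good h1 (23 * n2 (snd p)) (snd p) \<and>
       good h1 (23 * n2 (shear h0 p)) (shear h0 p)" if "p \<in> F" for p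
    using F(4)[OF that] E3(4)[of p] E2(4)[of p] that F(1) E3(1) by blast
  ultimately show ?thesis using F(2) by blast
qed

theorem theorem2p3:
  shows "weak_hilbert ZT2 ZT2N"
proof -
  have banach: "banach_on ZT2 ZT2N" unfolding ZT2_eq by (rule ZT.Z_banach)
  have main: "\<exists>F m. F \<subseteq> E \<and> has_cdim F m \<and> real m \<ge> 1/2 * real n \<and> bm_dist_l2 ZT2N F m \<le> 231 * 231 \<and>
    (\<exists>P. clinear_on ZT2 P padd pscale \<and> (\<forall>x\<in>ZT2. P x \<in> F) \<and> (\<forall>x\<in>F. P x = x) \<and> (\<forall>x\<in>ZT2. ZT2N (P x) \<le> 231 * 231 * ZT2N x))"
    if E: "E \<subseteq> ZT2" "has_cdim E n" for E n
  proof -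
    obtain F m h0 h1 where F: "F \<subseteq> E" "has_cdim F m" "n \<le> 2 * m" "linmap F (shear h0)"
      and good: "\<forall>p\<in>F. good h0 (23 * n2 (snd p)) (snd p) \<and> good h1 (23 * n2 (snd p)) (snd p) \<and>
         good h1 (23 * n2 (shear h0 p)) (shear h0 p)"
      using exists_good_subspace[OF E] by (elim exE conjE)
    have "bm_dist_l2 ZT2N F m \<le> 231 * 231 \<and>
      (\<exists>P. clinear_on ZT2 P padd pscale \<and> (\<forall>x\<in>ZT2. P x \<in> F) \<and> (\<forall>x\<in>F. P x = x) \<and> (\<forall>x\<in>ZT2. ZT2N (P x) \<le> 231 * 231 * ZT2N x))"
      by (rule hilbertian_subspace[OF E(1) F(2,1) _ _ _ F(4), of h1]) (use good in simp_all)
    moreover have "real m \<ge> 1/2 * real n" using F(3) by simp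
    ultimately show ?thesis using F(1,2) by (intro exI[of _ F] exI[of _ m]) simp
  qed
  show ?thesis
    unfolding weak_hilbert_def
  proof (rule conjI[OF banach], rule exI[of _ "1/2"], rule exI[of _ "231 * 231"], intro conjI allI impI)
    fix E n assume "E \<subseteq> ZT2 \<and> has_cdim E n"
    then show "\<exists>F m. F \<subseteq> E \<and> has_cdim F m \<and> real m \<ge> 1/2 * real n \<and> bm_dist_l2 ZT2N F m \<le> 231 * 231 \<and>
      (\<exists>P. clinear_on ZT2 P padd pscale \<and> (\<forall>x\<in>ZT2. P x \<in> F) \<and> (\<forall>x\<in>F. P x = x) \<and> (\<forall>x\<in>ZT2. ZT2N (P x) \<le> 231 * 231 * ZT2N x))"
      using main by blast
  qed simp_all
qed

end
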